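(* There is an absolute constant $C>0$ such that the following holds for every $\varepsilon>0$. Let $F$ be a (commutative or non-commutative) algebraic formula of size $s$ and syntactic degree $d\ge 1$ computing a polynomial $P$. Then $P$ is also computed by an algebraic formula $F''$ of size at most $s^{1+\varepsilon}$ and depth at most $2^{C/\varepsilon}\cdot\log d$ (i.e., depth $2^{O(1/\varepsilon)}\log d$). Furthermore, if $F$ is homogeneous and/or monotone, then so is $F''$.
   Context: An algebraic formula over $\mathbb{F}[x_1,\dots,x_n]$ (or $\mathbb{F}\langle x_1,\dots,x_n\rangle$ in the non-commutative case) is a rooted tree with edges directed towards the root; leaves are labelled by variables or by the constant $1$, edges by non-zero field constants, and internal nodes by $+$ (linear combination of the children with edge weights as coefficients) or $\times$ (product of the children, in a fixed linear order in the non-commutative case). Fan-in is unbounded. Size is the number of leaves; depth is the length of a longest leaf-to-root path. Syntactic degree: a leaf labelled $1$ has syntactic degree $0$, a variable leaf $1$, a $\times$-gate the sum of its children's, a $+$-gate the maximum of its children's; the formula's syntactic degree is that of its output. A formula is homogeneous if every gate computes a homogeneous polynomial. A parse tree is defined inductively: at a $+$-gate take a parse tree of one child (with the edge), at a $\times$-gate a parse tree of each child (with the edges), a leaf is its own parse tree; it computes the product of its leaf labels and edge constants, and the formula computes the sum over all parse trees. A formula is monotone if every monomial computed by one of its parse trees has non-zero coefficient in the polynomial computed by the formula.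
   Formalization: The depth bound is proved with 1/ε and log d (base 2) replaced by max(1,1/ε) and max(1,log d), since the literal bound fails for d=1 (x1+x2) and for d=2 with large ε; C is stated for all fields on one arbitrary carrier set, which gives all fields by passing to countable subfields. *)

theory Defs
  imports Complex_Main "HOL-Algebra.Ring" "HOL-Library.Multiset"
begin

text \<open>
  Fields are HOL-Algebra records rather than a type class, so that a statement can quantify over
  all fields in the scope of an existentially quantified absolute constant.
\<close>

record 'm monomials = "'m monoid" +
  indet :: "nat \<Rightarrow> 'm"
  mdeg :: "'m \<Rightarrow> nat"

definition comm_monomials :: "nat multiset monomials" where
  "comm_monomials =
     \<lparr>carrier = UNIV, monoid.mult = (+), one = {#}, indet = (\<lambda>i. {#i#}), mdeg = size\<rparr>"

definition noncomm_monomials :: "nat list monomials" where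
  "noncomm_monomials =
     \<lparr>carrier = UNIV, monoid.mult = (@), one = [], indet = (\<lambda>i. [i]), mdeg = length\<rparr>"

text \<open>
  The monoid algebra of \<open>M\<close> over \<open>R\<close>, polynomials being their coefficient functions. For the two
  instances of \<open>M\<close> above every monomial has only finitely many factorizations \<open>u \<otimes> v\<close>, so the
  sums in the convolution product are finite.
\<close>

definition poly_ring :: "('a, 'b) ring_scheme \<Rightarrow> ('m, 'c) monoid_scheme \<Rightarrow> ('m \<Rightarrow> 'a) ring" where
  "poly_ring R M =
     \<lparr>carrier = {p. (\<forall>m. p m \<in> carrier R) \<and> finite {m. p m \<noteq> \<zero>\<^bsub>R\<^esub>} \<and> {m. p m \<noteq> \<zero>\<^bsub>R\<^esub>} \<subseteq> carrier M},
      monoid.mult = (\<lambda>p q m. \<Oplus>\<^bsub>R\<^esub>w \<in> {w \<in> carrier M \<times> carrier M. fst w \<otimes>\<^bsub>M\<^esub> snd w = m}.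
                     p (fst w) \<otimes>\<^bsub>R\<^esub> q (snd w)),
      one = (\<lambda>m. if m = \<one>\<^bsub>M\<^esub> then \<one>\<^bsub>R\<^esub> else \<zero>\<^bsub>R\<^esub>),
      zero = (\<lambda>m. \<zero>\<^bsub>R\<^esub>),
      add = (\<lambda>p q m. p m \<oplus>\<^bsub>R\<^esub> q m)\<rparr>"

definition poly_var :: "('a, 'b) ring_scheme \<Rightarrow> ('m, 'c) monomials_scheme \<Rightarrow> nat \<Rightarrow> 'm \<Rightarrow> 'a" where
  "poly_var R M i = (\<lambda>m. if m = indet M i then \<one>\<^bsub>R\<^esub> else \<zero>\<^bsub>R\<^esub>)"

definition poly_scale :: "('a, 'b) ring_scheme \<Rightarrow> 'a \<Rightarrow> ('m \<Rightarrow> 'a) \<Rightarrow> 'm \<Rightarrow> 'a" where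
  "poly_scale R c p = (\<lambda>m. c \<otimes>\<^bsub>R\<^esub> p m)"

definition homogeneous_poly ::
    "('a, 'b) ring_scheme \<Rightarrow> ('m, 'c) monomials_scheme \<Rightarrow> ('m \<Rightarrow> 'a) \<Rightarrow> bool" where
  "homogeneous_poly R M p \<longleftrightarrow> (\<exists>k. \<forall>m. p m \<noteq> \<zero>\<^bsub>R\<^esub> \<longrightarrow> mdeg M m = k)"

text \<open>
  Each child of an internal node is stored together with the constant on the edge leading to it.
\<close>

datatype 'a formula =
    One_Leaf
  | Var_Leaf nat
  | Plus_Gate "('a \<times> 'a formula) list"
  | Times_Gate "('a \<times> 'a formula) list"

text \<open>Formulas over \<open>R\<close> in the variables \<open>x\<^sub>1, \<dots>, x\<^sub>n\<close>.\<close>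

fun alg_formula :: "('a, 'b) ring_scheme \<Rightarrow> nat \<Rightarrow> 'a formula \<Rightarrow> bool" where
  "alg_formula R n One_Leaf \<longleftrightarrow> True"
| "alg_formula R n (Var_Leaf i) \<longleftrightarrow> i \<in> {1..n}"
| "alg_formula R n (Plus_Gate cs) \<longleftrightarrow>
     cs \<noteq> [] \<and> (\<forall>(c, G) \<in> set cs. c \<in> carrier R - {\<zero>\<^bsub>R\<^esub>} \<and> alg_formula R n G)"
| "alg_formula R n (Times_Gate cs) \<longleftrightarrow>
     cs \<noteq> [] \<and> (\<forall>(c, G) \<in> set cs. c \<in> carrier R - {\<zero>\<^bsub>R\<^esub>} \<and> alg_formula R n G)"

fun formula_size :: "'a formula \<Rightarrow> nat" where
  "formula_size One_Leaf = 1"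
| "formula_size (Var_Leaf i) = 1"
| "formula_size (Plus_Gate cs) = (\<Sum>(c, G) \<leftarrow> cs. formula_size G)"
| "formula_size (Times_Gate cs) = (\<Sum>(c, G) \<leftarrow> cs. formula_size G)"

fun formula_depth :: "'a formula \<Rightarrow> nat" where
  "formula_depth One_Leaf = 0"
| "formula_depth (Var_Leaf i) = 0"
| "formula_depth (Plus_Gate cs) = Suc (Max ((\<lambda>(c, G). formula_depth G) ` set cs))"
| "formula_depth (Times_Gate cs) = Suc (Max ((\<lambda>(c, G). formula_depth G) ` set cs))"

fun synt_degree :: "'a formula \<Rightarrow> nat" where
  "synt_degree One_Leaf = 0"
| "synt_degree (Var_Leaf i) = 1"
| "synt_degree (Plus_Gate cs) = Max ((\<lambda>(c, G). synt_degree G) ` set cs)"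
| "synt_degree (Times_Gate cs) = (\<Sum>(c, G) \<leftarrow> cs. synt_degree G)"

text \<open>
  Edge constants are multiplied in at both kinds of gates, as in the value of a parse tree.
\<close>

fun formula_poly ::
    "('a, 'b) ring_scheme \<Rightarrow> ('m, 'c) monomials_scheme \<Rightarrow> 'a formula \<Rightarrow> 'm \<Rightarrow> 'a" where
  "formula_poly R M One_Leaf = \<one>\<^bsub>poly_ring R M\<^esub>"
| "formula_poly R M (Var_Leaf i) = poly_var R M i"
| "formula_poly R M (Plus_Gate cs) =
     foldr (\<lambda>(c, G) p. poly_scale R c (formula_poly R M G) \<oplus>\<^bsub>poly_ring R M\<^esub> p) cs \<zero>\<^bsub>poly_ring R M\<^esub>"
| "formula_poly R M (Times_Gate cs) =
     foldr (\<lambda>(c, G) p. poly_scale R c (formula_poly R M G) \<otimes>\<^bsub>poly_ring R M\<^esub> p) cs \<one>\<^bsub>poly_ring R M\<^esub>"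

fun subformulas :: "'a formula \<Rightarrow> 'a formula set" where
  "subformulas One_Leaf = {One_Leaf}"
| "subformulas (Var_Leaf i) = {Var_Leaf i}"
| "subformulas (Plus_Gate cs) = insert (Plus_Gate cs) (\<Union>(c, G) \<in> set cs. subformulas G)"
| "subformulas (Times_Gate cs) = insert (Times_Gate cs) (\<Union>(c, G) \<in> set cs. subformulas G)"

definition homogeneous_formula ::
    "('a, 'b) ring_scheme \<Rightarrow> ('m, 'c) monomials_scheme \<Rightarrow> 'a formula \<Rightarrow> bool" where
  "homogeneous_formula R M F \<longleftrightarrow>
     (\<forall>G \<in> subformulas F. homogeneous_poly R M (formula_poly R M G))"

text \<open>
  A parse tree is itself a formula, all of whose \<open>+\<close>-gates have exactly one child; hence
  \<^const>\<open>formula_poly\<close> of a parse tree is the product of its leaf labels and edge constants.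
\<close>

inductive parse_tree :: "'a formula \<Rightarrow> 'a formula \<Rightarrow> bool" where
  "parse_tree One_Leaf One_Leaf"
| "parse_tree (Var_Leaf i) (Var_Leaf i)"
| "(c, G) \<in> set cs \<Longrightarrow> parse_tree T G \<Longrightarrow> parse_tree (Plus_Gate [(c, T)]) (Plus_Gate cs)"
| "list_all2 (rel_prod (=) parse_tree) ts cs \<Longrightarrow> parse_tree (Times_Gate ts) (Times_Gate cs)"

definition monotone_formula ::
    "('a, 'b) ring_scheme \<Rightarrow> ('m, 'c) monomials_scheme \<Rightarrow> 'a formula \<Rightarrow> bool" where
  "monotone_formula R M F \<longleftrightarrow>
     (\<forall>T m. parse_tree T F \<and> formula_poly R M T m \<noteq> \<zero>\<^bsub>R\<^esub> \<longrightarrow> formula_poly R M F m \<noteq> \<zero>\<^bsub>R\<^esub>)"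

text \<open>
  The bound \<open>2 powr O(1 / \<epsilon>) * log d\<close> on the depth is to be stated with \<open>max 1 (1 / \<epsilon>)\<close> and \<open>max 1 (log 2 d)\<close>:
  the literal bound fails for \<open>d = 1\<close>, where it forces depth \<open>0\<close> on \<open>x\<^sub>1 + x\<^sub>2\<close>, and for large \<open>\<epsilon>\<close>,
  where it forces depth \<open>1\<close> on \<open>(x\<^sub>1 + x\<^sub>2) (x\<^sub>3 + x\<^sub>4)\<close>. For \<open>\<epsilon> \<le> 1\<close> and \<open>d \<ge> 2\<close> nothing changes.
\<close>

end

theory Submission imports Defs begin

text \<open>
  Group sizes and degrees into classes by their order of magnitude and leading digit in bases \<open>n\<close>
  and \<open>k\<close>. From the root of a formula \<open>u\<close> follow a path, as long as possible, on which neither class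
  changes, ending at \<open>v\<close>. Distributing the products along this path gives \<open>u = B + L v R\<close>, where \<open>B\<close>
  is \<open>u\<close> with \<open>v\<close> replaced by \<open>0\<close>, and \<open>L\<close>, \<open>R\<close> are products of siblings of the path. As the classes
  of \<open>u\<close> and \<open>v\<close> agree, \<open>B\<close> is smaller than \<open>u\<close> by an order of magnitude, and so are the degrees of the
  factors of \<open>L\<close> and \<open>R\<close>. The only material that is copied is the siblings: once into \<open>B\<close>, and into
  \<open>L\<close>, \<open>R\<close> once for every summand into which \<open>v\<close> is expanded. The first copy is paid by a factor
  \<open>2\<close> per order of magnitude of the size, the others by a factor \<open>M\<close> per order of magnitude of the degree.

  If \<open>s \<le> d powr (1 / \<epsilon>)\<close>, then \<open>n = k = 2 powr O(1 / \<epsilon>)\<close>, without expanding \<open>v\<close>, is good enough: the depth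
  is \<open>O(k (log s + log d))\<close>. For larger \<open>s\<close>, the base \<open>n\<close> is so large that \<open>log s / log n \<le> log d\<close>. To reach
  constant depth per order of magnitude of the size, \<open>v\<close> is then expanded into a sum of up to \<open>4 n\<close>
  products; \<open>d \<le> s powr \<epsilon>\<close> makes the resulting factor \<open>(8 n) powr (log d / log k)\<close> affordable.

  Monotonicity and homogeneity follow because the monomials of the parse trees of the new formula
  are among those of the old one.
\<close>

section \<open>Formulas in a semiring with scalars\<close>

text \<open>The obstacle is the large base \<open>n\<close>. If every leading digit of the size had
  levels of its own, the depth would grow with \<open>n\<close>. So a child of \<open>v\<close> that
  keeps the order of magnitude of \<open>u\<close> must not be put below another gate; its summands
  are taken over on the level of \<open>u\<close>. Hence the induction yields sums of products
  (\<open>sum_rep\<close>) instead of single gates, and the number of summands belongs to the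
  invariant. It stays below \<open>4 * n\<close> because the leading digits of children of one order
  of magnitude add up to at most the leading digit of the parent.

  Copying is charged to the degree because the path keeps the degree class: \<open>v\<close> uses up
  the class of \<open>u\<close>, so what is left for a sibling is an order of magnitude smaller.

  The rewriting takes place in an abstract semiring with scalars, so that one argument covers the
  polynomial, the set of parse-tree monomials, and both kinds of multiplication. Sets of monomials
  forget the scalars and know no subtraction, so zero constants and empty sums survive the rewriting
  and are pruned afterwards.\<close>

text \<open>
  Generic formulas may have zero edge constants and empty sums. An empty sum stands for \<open>0\<close>; on it
  \<^const>\<open>synt_degree\<close> and \<^const>\<open>formula_depth\<close> are maxima of the empty set, hence unspecified.
\<close>

fun generic_degree :: "'a formula \<Rightarrow> nat" where
  "generic_degree One_Leaf = 0"
| "generic_degree (Var_Leaf i) = 1"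
| "generic_degree (Plus_Gate cs) = Max (insert 0 ((\<lambda>(c, G). generic_degree G) ` set cs))"
| "generic_degree (Times_Gate cs) = (\<Sum>(c, G) \<leftarrow> cs. generic_degree G)"

fun generic_depth :: "'a formula \<Rightarrow> nat" where
  "generic_depth One_Leaf = 0"
| "generic_depth (Var_Leaf i) = 0"
| "generic_depth (Plus_Gate cs) = Suc (Max (insert 0 ((\<lambda>(c, G). generic_depth G) ` set cs)))"
| "generic_depth (Times_Gate cs) = Suc (Max (insert 0 ((\<lambda>(c, G). generic_depth G) ` set cs)))"

fun generic_formula :: "('a, 'b) ring_scheme \<Rightarrow> nat \<Rightarrow> 'a formula \<Rightarrow> bool" where
  "generic_formula R n One_Leaf \<longleftrightarrow> True"
| "generic_formula R n (Var_Leaf i) \<longleftrightarrow> i \<in> {1..n}"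
| "generic_formula R n (Plus_Gate cs) \<longleftrightarrow> (\<forall>(c, G) \<in> set cs. c \<in> carrier R \<and> generic_formula R n G)"
| "generic_formula R n (Times_Gate cs) \<longleftrightarrow>
     cs \<noteq> [] \<and> (\<forall>(c, G) \<in> set cs. c \<in> carrier R \<and> generic_formula R n G)"

lemma generic_formula_of_alg: "alg_formula R n F \<Longrightarrow> generic_formula R n F"
  by (induction F) (auto split: prod.splits)

lemma generic_degree_of_alg: "alg_formula R n F \<Longrightarrow> generic_degree F = synt_degree F"
proof (induction F)
  case (Plus_Gate cs)
  have "(\<lambda>(c, G). generic_degree G) ` set cs = (\<lambda>(c, G). synt_degree G) ` set cs"
    using Plus_Gate by (intro image_cong refl) (fastforce split: prod.splits)
  moreover have "Max (insert 0 X) = Max X" if "finite X" "X \<noteq> {}" for X :: "nat set"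
    using that by simp
  ultimately show ?case using Plus_Gate.prems by simp
next
  case (Times_Gate cs)
  have "map (\<lambda>(c, G). generic_degree G) cs = map (\<lambda>(c, G). synt_degree G) cs"
    using Times_Gate by (intro map_cong refl) (fastforce split: prod.splits)
  then show ?case by (simp only: generic_degree.simps synt_degree.simps)
qed auto

lemma generic_depth_of_alg: "alg_formula R n F \<Longrightarrow> generic_depth F = formula_depth F"
proof (induction F)
  case (Plus_Gate cs)
  have "(\<lambda>(c, G). generic_depth G) ` set cs = (\<lambda>(c, G). formula_depth G) ` set cs"
    using Plus_Gate by (intro image_cong refl) (fastforce split: prod.splits)
  moreover have "Max (insert 0 X) = Max X" if "finite X" "X \<noteq> {}" for X :: "nat set"
    using that by simp
  ultimately show ?case using Plus_Gate.prems by simp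
next
  case (Times_Gate cs)
  have "(\<lambda>(c, G). generic_depth G) ` set cs = (\<lambda>(c, G). formula_depth G) ` set cs"
    using Times_Gate by (intro image_cong refl) (fastforce split: prod.splits)
  moreover have "Max (insert 0 X) = Max X" if "finite X" "X \<noteq> {}" for X :: "nat set"
    using that by simp
  ultimately show ?case using Times_Gate.prems by simp
qed auto

lemma Max_insert_0_le_iff: "Max (insert (0::nat) (f ` set cs)) \<le> D \<longleftrightarrow> (\<forall>x\<in>set cs. f x \<le> D)"
  by (subst Max_le_iff) auto

lemma generic_degree_le_size: "generic_degree F \<le> formula_size F"
proof (induction F)
  case (Plus_Gate cs)
  have "generic_degree G \<le> (\<Sum>(c, G) \<leftarrow> cs. formula_size G)" if "(c, G) \<in> set cs" for c G
  proof -
    have "generic_degree G \<le> formula_size G" using Plus_Gate that by fastforce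
    also have "\<dots> \<le> (\<Sum>(c, G) \<leftarrow> cs. formula_size G)"
      using that by (intro member_le_sum_list) (force, simp)
    finally show ?thesis .
  qed
  then show ?case unfolding generic_degree.simps Max_insert_0_le_iff by auto
next
  case (Times_Gate cs)
  then show ?case by (auto intro!: sum_list_mono simp: split_beta)
qed auto

fun formula_value :: "('v, 'w) ring_scheme \<Rightarrow> ('a \<Rightarrow> 'v \<Rightarrow> 'v) \<Rightarrow> (nat \<Rightarrow> 'v) \<Rightarrow> 'a formula \<Rightarrow> 'v" where
  "formula_value A sc x One_Leaf = \<one>\<^bsub>A\<^esub>"
| "formula_value A sc x (Var_Leaf i) = x i"
| "formula_value A sc x (Plus_Gate cs) =
     foldr (\<lambda>(c, G) p. sc c (formula_value A sc x G) \<oplus>\<^bsub>A\<^esub> p) cs \<zero>\<^bsub>A\<^esub>"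
| "formula_value A sc x (Times_Gate cs) =
     foldr (\<lambda>(c, G) p. sc c (formula_value A sc x G) \<otimes>\<^bsub>A\<^esub> p) cs \<one>\<^bsub>A\<^esub>"

text \<open>The laws are those common to polynomials and sets of monomials. In
  \<open>joint_ring\<close>, scaling by the zero of \<open>K\<close> keeps the set of monomials, so
  there is no law that makes it zero; and union has no inverses, so \<open>A\<close> is only a
  semiring. The order will mean: same polynomial, no new monomials.\<close>

locale scalar_semiring = semiring A + K: cring K
  for A :: "('v, 'w) ring_scheme" (structure) and K :: "('a, 'b) ring_scheme" +
  fixes sc :: "'a \<Rightarrow> 'v \<Rightarrow> 'v" and x :: "nat \<Rightarrow> 'v"
    and le :: "'v \<Rightarrow> 'v \<Rightarrow> bool" (infix "\<sqsubseteq>" 50) and n :: nat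
  assumes sc_closed [simp]: "c \<in> carrier K \<Longrightarrow> p \<in> carrier A \<Longrightarrow> sc c p \<in> carrier A"
    and x_closed [simp]: "x i \<in> carrier A"
    and sc_one: "p \<in> carrier A \<Longrightarrow> sc \<one>\<^bsub>K\<^esub> p = p"
    and sc_sc: "c \<in> carrier K \<Longrightarrow> d \<in> carrier K \<Longrightarrow> p \<in> carrier A \<Longrightarrow> sc c (sc d p) = sc (c \<otimes>\<^bsub>K\<^esub> d) p"
    and sc_zero: "c \<in> carrier K \<Longrightarrow> sc c \<zero> = \<zero>"
    and sc_add: "c \<in> carrier K \<Longrightarrow> p \<in> carrier A \<Longrightarrow> q \<in> carrier A \<Longrightarrow> sc c (p \<oplus> q) = sc c p \<oplus> sc c q"
    and add_sc: "c \<in> carrier K \<Longrightarrow> d \<in> carrier K \<Longrightarrow> p \<in> carrier A \<Longrightarrow> sc c p \<oplus> sc d p = sc (c \<oplus>\<^bsub>K\<^esub> d) p"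
    and sc_mult_left: "c \<in> carrier K \<Longrightarrow> p \<in> carrier A \<Longrightarrow> q \<in> carrier A \<Longrightarrow> sc c p \<otimes> q = sc c (p \<otimes> q)"
    and sc_mult_right: "c \<in> carrier K \<Longrightarrow> p \<in> carrier A \<Longrightarrow> q \<in> carrier A \<Longrightarrow> p \<otimes> sc c q = sc c (p \<otimes> q)"
    and le_refl [simp]: "p \<sqsubseteq> p"
    and le_trans: "p \<sqsubseteq> q \<Longrightarrow> q \<sqsubseteq> r \<Longrightarrow> p \<sqsubseteq> r"
    and add_le: "p \<sqsubseteq> p' \<Longrightarrow> q \<sqsubseteq> q' \<Longrightarrow> p \<oplus> q \<sqsubseteq> p' \<oplus> q'"
    and mult_le: "p \<sqsubseteq> p' \<Longrightarrow> q \<sqsubseteq> q' \<Longrightarrow> p \<otimes> q \<sqsubseteq> p' \<otimes> q'"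
    and sc_le: "p \<sqsubseteq> p' \<Longrightarrow> sc c p \<sqsubseteq> sc c p'"
begin

abbreviation ev :: "'a formula \<Rightarrow> 'v" where "ev \<equiv> formula_value A sc x"
abbreviation wf :: "'a formula \<Rightarrow> bool" where "wf \<equiv> generic_formula K n"

definition lsum :: "'v list \<Rightarrow> 'v" where "lsum ps = foldr (\<oplus>) ps \<zero>"
definition lprod :: "'v list \<Rightarrow> 'v" where "lprod ps = foldr (\<otimes>) ps \<one>"

lemma lsum_simps [simp]: "lsum [] = \<zero>" "lsum (p # ps) = p \<oplus> lsum ps"
  and lprod_simps [simp]: "lprod [] = \<one>" "lprod (p # ps) = p \<otimes> lprod ps"
  by (simp_all add: lsum_def lprod_def)

lemma lsum_closed [simp]: "set ps \<subseteq> carrier A \<Longrightarrow> lsum ps \<in> carrier A"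
  by (induction ps) auto

lemma lprod_closed [simp]: "set ps \<subseteq> carrier A \<Longrightarrow> lprod ps \<in> carrier A"
  by (induction ps) auto

lemma lsum_append: "set ps \<subseteq> carrier A \<Longrightarrow> set qs \<subseteq> carrier A \<Longrightarrow> lsum (ps @ qs) = lsum ps \<oplus> lsum qs"
  by (induction ps) (auto simp: a_assoc)

lemma lprod_append: "set ps \<subseteq> carrier A \<Longrightarrow> set qs \<subseteq> carrier A \<Longrightarrow> lprod (ps @ qs) = lprod ps \<otimes> lprod qs"
  by (induction ps) (auto simp: m_assoc)

text \<open>Separates the children of a \<open>+\<close>-gate that are expanded from those that are
  put into a gate of their own.\<close>

lemma lsum_filter:
  "f ` set ps \<subseteq> carrier A \<Longrightarrow>
   lsum (map f ps) = lsum (map f (filter P ps)) \<oplus> lsum (map f (filter (\<lambda>p. \<not> P p) ps))"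
proof (induction ps)
  case (Cons a ps)
  have "lsum (map f (filter P ps)) \<in> carrier A" "lsum (map f (filter (\<lambda>p. \<not> P p) ps)) \<in> carrier A"
    using Cons.prems by (intro lsum_closed; fastforce)+
  then show ?case using Cons by (auto simp: a_ac)
qed simp

lemma lsum_sandwich:
  "a \<in> carrier A \<Longrightarrow> b \<in> carrier A \<Longrightarrow> set ps \<subseteq> carrier A \<Longrightarrow>
   lsum (map (\<lambda>p. a \<otimes> p \<otimes> b) ps) = a \<otimes> lsum ps \<otimes> b"
  by (induction ps) (auto simp: l_distr r_distr)

lemma ev_Plus: "ev (Plus_Gate cs) = lsum (map (\<lambda>(c, G). sc c (ev G)) cs)"
  by (induction cs) auto

lemma ev_Times: "ev (Times_Gate cs) = lprod (map (\<lambda>(c, G). sc c (ev G)) cs)"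
  by (induction cs) auto

lemma ev_closed [simp]: "wf G \<Longrightarrow> ev G \<in> carrier A"
proof (induction G)
  case (Plus_Gate cs)
  then show ?case unfolding ev_Plus by (intro lsum_closed) fastforce
next
  case (Times_Gate cs)
  then show ?case unfolding ev_Times by (intro lprod_closed) fastforce
qed auto

lemma children_closed:
  "\<forall>(c, G) \<in> set cs. c \<in> carrier K \<and> wf G \<Longrightarrow> set (map (\<lambda>(c, G). sc c (ev G)) cs) \<subseteq> carrier A"
  by auto

text \<open>Scalars commute with all values even if \<open>\<otimes>\<close> is non-commutative, so
  edge constants can be collected in front.\<close>

lemma lprod_scalars:
  assumes "\<forall>(c, G) \<in> set cs. c \<in> carrier K \<and> wf G"
  shows "\<exists>c \<in> carrier K. lprod (map (\<lambda>(c, G). sc c (ev G)) cs) = sc c (lprod (map (\<lambda>aG. ev (snd aG)) cs))"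
  using assms
proof (induction cs)
  case Nil
  then show ?case using sc_one by (metis K.one_closed list.simps(8) lprod_simps(1) one_closed)
next
  case (Cons aG cs)
  obtain a G where aG: "aG = (a, G)" by force
  then have a: "a \<in> carrier K" "ev G \<in> carrier A" using Cons.prems by auto
  obtain c where c: "c \<in> carrier K"
    "lprod (map (\<lambda>(c, G). sc c (ev G)) cs) = sc c (lprod (map (\<lambda>aG. ev (snd aG)) cs))"
    using Cons by auto
  have l: "lprod (map (\<lambda>aG. ev (snd aG)) cs) \<in> carrier A"
    using Cons.prems by (intro lprod_closed) fastforce
  have "lprod (map (\<lambda>(c, G). sc c (ev G)) (aG # cs)) = sc (a \<otimes>\<^bsub>K\<^esub> c) (lprod (map (\<lambda>aG. ev (snd aG)) (aG # cs)))"
    using a c l by (simp add: aG sc_mult_left sc_mult_right sc_sc K.m_comm)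
  then show ?case using a c by blast
qed

text \<open>A formula of degree 0 contains no variable, so one constant leaf can replace it. Zero is
  a case of its own because formulas of size 0 exist, built over empty sums, and they have no leaf
  to pay for the constant.\<close>

lemma constant_formula:
  assumes "wf G" "generic_degree G = 0"
  shows "\<zero> \<sqsubseteq> ev G \<or> formula_size G \<ge> 1 \<and> (\<exists>c \<in> carrier K. sc c \<one> \<sqsubseteq> ev G)"
  using assms
proof (induction G)
  case One_Leaf
  then show ?case by (metis K.one_closed formula_size.simps(1) formula_value.simps(1) le_refl one_closed order_refl sc_one)
next
  case (Plus_Gate cs)
  have deg: "generic_degree G = 0" if "(c, G) \<in> set cs" for c G
  proof -
    have "generic_degree (Plus_Gate cs) \<le> 0" using Plus_Gate.prems by simp
    then show ?thesis using that unfolding generic_degree.simps Max_insert_0_le_iff by auto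
  qed
  have IH: "\<zero> \<sqsubseteq> ev G \<or> formula_size G \<ge> 1 \<and> (\<exists>c \<in> carrier K. sc c \<one> \<sqsubseteq> ev G)"
    if "(c, G) \<in> set cs" for c G
    using Plus_Gate.IH[of "(c, G)" G] that deg[OF that] Plus_Gate.prems(1) by auto
  have cl: "\<forall>(c, G) \<in> set cs. c \<in> carrier K \<and> wf G" using Plus_Gate.prems by simp
  from cl IH show ?case
  proof (induction cs)
    case (Cons aG cs)
    obtain a G where aG: "aG = (a, G)" by force
    have a: "a \<in> carrier K" "wf G" using Cons.prems aG by auto
    have IH: "\<zero> \<sqsubseteq> ev (Plus_Gate cs) \<or> formula_size (Plus_Gate cs) \<ge> 1 \<and> (\<exists>c \<in> carrier K. sc c \<one> \<sqsubseteq> ev (Plus_Gate cs))"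
      using Cons by (meson list.set_intros(2))
    have G: "\<zero> \<sqsubseteq> sc a (ev G) \<or> formula_size G \<ge> 1 \<and> (\<exists>c \<in> carrier K. sc c \<one> \<sqsubseteq> sc a (ev G))"
      using Cons.prems(2)[of a G] a by (metis K.m_closed aG list.set_intros(1) one_closed sc_le sc_sc sc_zero)
    have e: "ev (Plus_Gate (aG # cs)) = sc a (ev G) \<oplus> ev (Plus_Gate cs)" by (simp add: aG)
    have sz: "formula_size (Plus_Gate (aG # cs)) = formula_size G + formula_size (Plus_Gate cs)" by (simp add: aG)
    consider "\<zero> \<sqsubseteq> sc a (ev G)" "\<zero> \<sqsubseteq> ev (Plus_Gate cs)"
      | c where "\<zero> \<sqsubseteq> sc a (ev G)" "formula_size (Plus_Gate cs) \<ge> 1" "c \<in> carrier K" "sc c \<one> \<sqsubseteq> ev (Plus_Gate cs)"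
      | c where "\<zero> \<sqsubseteq> ev (Plus_Gate cs)" "formula_size G \<ge> 1" "c \<in> carrier K" "sc c \<one> \<sqsubseteq> sc a (ev G)"
      | c d where "formula_size G \<ge> 1" "c \<in> carrier K" "sc c \<one> \<sqsubseteq> sc a (ev G)" "d \<in> carrier K" "sc d \<one> \<sqsubseteq> ev (Plus_Gate cs)"
      using IH G by blast
    then show ?case
    proof cases
      case 1
      then show ?thesis unfolding e using add_le by (metis l_zero zero_closed)
    next
      case 2
      then have "\<zero> \<oplus> sc c \<one> \<sqsubseteq> ev (Plus_Gate (aG # cs))" unfolding e by (intro add_le)
      then show ?thesis using 2 sz by auto
    next
      case 3
      then have "sc c \<one> \<oplus> \<zero> \<sqsubseteq> ev (Plus_Gate (aG # cs))" unfolding e by (intro add_le)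
      then show ?thesis using 3 sz by auto
    next
      case 4
      then have "sc c \<one> \<oplus> sc d \<one> \<sqsubseteq> ev (Plus_Gate (aG # cs))" unfolding e by (intro add_le)
      then have "sc (c \<oplus>\<^bsub>K\<^esub> d) \<one> \<sqsubseteq> ev (Plus_Gate (aG # cs))" using 4 by (simp add: add_sc)
      then show ?thesis using 4 sz by auto
    qed
  qed simp
next
  case (Times_Gate cs)
  have deg: "generic_degree G = 0" if "(c, G) \<in> set cs" for c G
    using Times_Gate.prems(2) that by (auto simp: sum_list_eq_0_iff)
  have IH: "\<zero> \<sqsubseteq> ev G \<or> formula_size G \<ge> 1 \<and> (\<exists>c \<in> carrier K. sc c \<one> \<sqsubseteq> ev G)"
    if "(c, G) \<in> set cs" for c G
    using Times_Gate.IH[of "(c, G)" G] that deg[OF that] Times_Gate.prems(1) by auto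
  have cl: "\<forall>(c, G) \<in> set cs. c \<in> carrier K \<and> wf G" using Times_Gate.prems by simp
  \<comment> \<open>The empty product has value one but size 0, so the size claim is restricted to
    non-empty \<open>cs\<close>.\<close>
  from cl IH have *: "\<zero> \<sqsubseteq> ev (Times_Gate cs) \<or>
      (cs \<noteq> [] \<longrightarrow> formula_size (Times_Gate cs) \<ge> 1) \<and> (\<exists>c \<in> carrier K. sc c \<one> \<sqsubseteq> ev (Times_Gate cs))"
  proof (induction cs)
    case Nil
    then show ?case by (metis K.one_closed ev_Times le_refl list.simps(8) lprod_simps(1) one_closed sc_one)
  next
    case (Cons aG cs)
    obtain a G where aG: "aG = (a, G)" by force
    have a: "a \<in> carrier K" "wf G" using Cons.prems aG by auto
    have IH: "\<zero> \<sqsubseteq> ev (Times_Gate cs) \<or> (\<exists>c \<in> carrier K. sc c \<one> \<sqsubseteq> ev (Times_Gate cs))"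
      using Cons by (meson list.set_intros(2))
    have G: "\<zero> \<sqsubseteq> sc a (ev G) \<or> formula_size G \<ge> 1 \<and> (\<exists>c \<in> carrier K. sc c \<one> \<sqsubseteq> sc a (ev G))"
      using Cons.prems(2)[of a G] a by (metis K.m_closed aG list.set_intros(1) one_closed sc_le sc_sc sc_zero)
    have e: "ev (Times_Gate (aG # cs)) = sc a (ev G) \<otimes> ev (Times_Gate cs)" by (simp add: aG)
    have sz: "formula_size (Times_Gate (aG # cs)) = formula_size G + formula_size (Times_Gate cs)" by (simp add: aG)
    have tc: "ev (Times_Gate cs) \<in> carrier A" using Cons.prems(1) unfolding ev_Times by (intro lprod_closed) auto
    consider "\<zero> \<sqsubseteq> sc a (ev G)" | "\<zero> \<sqsubseteq> ev (Times_Gate cs)"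
      | c d where "formula_size G \<ge> 1" "c \<in> carrier K" "sc c \<one> \<sqsubseteq> sc a (ev G)" "d \<in> carrier K" "sc d \<one> \<sqsubseteq> ev (Times_Gate cs)"
      using IH G by blast
    then show ?case
    proof cases
      case 1
      then have "\<zero> \<otimes> ev (Times_Gate cs) \<sqsubseteq> ev (Times_Gate (aG # cs))" unfolding e by (intro mult_le) simp_all
      then show ?thesis using tc by simp
    next
      case 2
      then have "sc a (ev G) \<otimes> \<zero> \<sqsubseteq> ev (Times_Gate (aG # cs))" unfolding e by (intro mult_le) simp_all
      then show ?thesis using a by simp
    next
      case 3
      then have "sc c \<one> \<otimes> sc d \<one> \<sqsubseteq> ev (Times_Gate (aG # cs))" unfolding e by (intro mult_le)
      then have "sc (c \<otimes>\<^bsub>K\<^esub> d) \<one> \<sqsubseteq> ev (Times_Gate (aG # cs))" using 3 by (simp add: sc_mult_left sc_sc)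
      then show ?thesis using 3 sz by (metis K.m_closed le_add1 order_trans)
    qed
  qed
  then show ?case using Times_Gate.prems by auto
qed auto

end

section \<open>Sums of products with bounds on number of summands, size and depth\<close>

context scalar_semiring begin

abbreviation vprod :: "'a formula list \<Rightarrow> 'v" where
  "vprod Gs \<equiv> lprod (map ev Gs)"

abbreviation vsizes :: "'a formula list \<Rightarrow> nat" where
  "vsizes Gs \<equiv> sum_list (map formula_size Gs)"

text \<open>
  The scalar of a \<open>prod_rep\<close> absorbs constant factors, so that siblings of degree \<open>0\<close> can be copied
  for free.
\<close>

definition gate_rep :: "'v \<Rightarrow> nat \<Rightarrow> nat \<Rightarrow> bool" where
  "gate_rep p Z D \<longleftrightarrow> (\<exists>G. wf G \<and> ev G \<sqsubseteq> p \<and> formula_size G \<le> Z \<and> generic_depth G \<le> D)"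

definition prod_rep :: "'v \<Rightarrow> nat \<Rightarrow> nat \<Rightarrow> bool" where
  "prod_rep p Z D \<longleftrightarrow> (\<exists>c Gs. c \<in> carrier K \<and> (\<forall>G \<in> set Gs. wf G \<and> generic_depth G \<le> D) \<and>
     sc c (vprod Gs) \<sqsubseteq> p \<and> vsizes Gs \<le> Z)"

abbreviation term_values :: "('a \<times> 'a formula list) list \<Rightarrow> 'v list" where
  "term_values ts \<equiv> map (\<lambda>(c, Gs). sc c (vprod Gs)) ts"

text \<open>\<open>D\<close> bounds the depth of the factors: adding, scaling and multiplying by
  further factors leave it unchanged, and only the conversion into one formula costs levels.
  \<open>N\<close> is recorded because a factor from outside is copied into every summand. The lists
  \<open>Gs\<close> are non-empty because \<open>generic_formula\<close> has no empty
  products.\<close>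

definition sum_rep :: "'v \<Rightarrow> nat \<Rightarrow> nat \<Rightarrow> nat \<Rightarrow> bool" where
  "sum_rep p N Z D \<longleftrightarrow> (\<exists>ts. (\<forall>(c, Gs) \<in> set ts. c \<in> carrier K \<and> Gs \<noteq> [] \<and>
       (\<forall>G \<in> set Gs. wf G \<and> generic_depth G \<le> D)) \<and>
     lsum (term_values ts) \<sqsubseteq> p \<and> length ts \<le> N \<and> (\<Sum>(c, Gs) \<leftarrow> ts. vsizes Gs) \<le> Z)"

lemma gate_rep_mono:
  "gate_rep p Z D \<Longrightarrow> p \<sqsubseteq> p' \<Longrightarrow> Z \<le> Z' \<Longrightarrow> D \<le> D' \<Longrightarrow> gate_rep p' Z' D'"
  unfolding gate_rep_def by (meson le_trans order_trans)

lemma prod_rep_mono: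
  "prod_rep p Z D \<Longrightarrow> p \<sqsubseteq> p' \<Longrightarrow> Z \<le> Z' \<Longrightarrow> D \<le> D' \<Longrightarrow> prod_rep p' Z' D'"
  unfolding prod_rep_def by (meson le_trans order_trans)

lemma sum_rep_mono:
  assumes "sum_rep p N Z D" "p \<sqsubseteq> p'" "N \<le> N'" "Z \<le> Z'" "D \<le> D'"
  shows "sum_rep p' N' Z' D'"
proof -
  obtain ts where ts: "\<forall>(c, Gs) \<in> set ts. c \<in> carrier K \<and> Gs \<noteq> [] \<and> (\<forall>G \<in> set Gs. wf G \<and> generic_depth G \<le> D)"
    "lsum (term_values ts) \<sqsubseteq> p" "length ts \<le> N" "(\<Sum>(c, Gs) \<leftarrow> ts. vsizes Gs) \<le> Z"
    using assms(1) unfolding sum_rep_def by blast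
  have "\<forall>(c, Gs) \<in> set ts. c \<in> carrier K \<and> Gs \<noteq> [] \<and> (\<forall>G \<in> set Gs. wf G \<and> generic_depth G \<le> D')"
    using ts(1) assms(5) by fastforce
  moreover have "lsum (term_values ts) \<sqsubseteq> p'" using ts(2) assms(2) le_trans by blast
  ultimately show ?thesis unfolding sum_rep_def using ts(3,4) assms(3,4) by (meson order_trans)
qed

lemma vprod_closed: "\<forall>G \<in> set Gs. wf G \<Longrightarrow> vprod Gs \<in> carrier A"
  by (intro lprod_closed) auto

lemma gate_rep_zero: "gate_rep \<zero> 0 1"
  unfolding gate_rep_def by (intro exI[of _ "Plus_Gate []"]) simp

lemma gate_rep_const: "c \<in> carrier K \<Longrightarrow> gate_rep (sc c \<one>) 1 1"
  unfolding gate_rep_def by (intro exI[of _ "Plus_Gate [(c, One_Leaf)]"]) simp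

lemma prod_rep_const: "c \<in> carrier K \<Longrightarrow> prod_rep (sc c \<one>) 0 D"
  unfolding prod_rep_def by (intro exI[of _ c] exI[of _ "[]"]) simp

lemma prod_rep_of_gate_rep: "gate_rep p Z D \<Longrightarrow> prod_rep p Z D"
  unfolding prod_rep_def gate_rep_def
proof (elim exE)
  fix G assume G: "wf G \<and> ev G \<sqsubseteq> p \<and> formula_size G \<le> Z \<and> generic_depth G \<le> D"
  then show "\<exists>c Gs. c \<in> carrier K \<and> (\<forall>G \<in> set Gs. wf G \<and> generic_depth G \<le> D) \<and>
     sc c (vprod Gs) \<sqsubseteq> p \<and> vsizes Gs \<le> Z"
    by (intro exI[of _ "\<one>\<^bsub>K\<^esub>"] exI[of _ "[G]"]) (simp add: sc_one)
qed

lemma prod_rep_mult: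
  assumes "prod_rep p Z D" "prod_rep p' Z' D"
  shows "prod_rep (p \<otimes> p') (Z + Z') D"
proof -
  obtain c Gs where 1: "c \<in> carrier K" "\<forall>G \<in> set Gs. wf G \<and> generic_depth G \<le> D"
     "sc c (vprod Gs) \<sqsubseteq> p" "vsizes Gs \<le> Z" using assms(1) unfolding prod_rep_def by blast
  obtain d Hs where 2: "d \<in> carrier K" "\<forall>G \<in> set Hs. wf G \<and> generic_depth G \<le> D"
     "sc d (vprod Hs) \<sqsubseteq> p'" "vsizes Hs \<le> Z'" using assms(2) unfolding prod_rep_def by blast
  have cl: "vprod Gs \<in> carrier A" "vprod Hs \<in> carrier A" using 1 2 by (auto intro!: vprod_closed)
  have "vprod (Gs @ Hs) = vprod Gs \<otimes> vprod Hs"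
    using 1 2 by (auto intro!: lprod_append)
  then have "sc (c \<otimes>\<^bsub>K\<^esub> d) (vprod (Gs @ Hs)) = sc c (vprod Gs) \<otimes> sc d (vprod Hs)"
    using 1 2 cl by (simp add: sc_mult_left sc_mult_right sc_sc K.m_comm)
  also have "\<dots> \<sqsubseteq> p \<otimes> p'" using 1 2 by (intro mult_le)
  finally show ?thesis unfolding prod_rep_def using 1 2
    by (intro exI[of _ "c \<otimes>\<^bsub>K\<^esub> d"] exI[of _ "Gs @ Hs"]) auto
qed

lemma sum_rep_zero: "sum_rep \<zero> 0 0 D"
  unfolding sum_rep_def by (intro exI[of _ "[]"]) simp

lemma sum_rep_of_gate_rep:
  assumes "gate_rep p Z D"
  shows "sum_rep p 1 Z D"
proof -
  obtain G where G: "wf G" "ev G \<sqsubseteq> p" "formula_size G \<le> Z" "generic_depth G \<le> D"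
    using assms unfolding gate_rep_def by blast
  then show ?thesis unfolding sum_rep_def
    by (intro exI[of _ "[(\<one>\<^bsub>K\<^esub>, [G])]"]) (simp add: sc_one)
qed

lemma term_values_closed:
  "\<forall>(c, Gs) \<in> set ts. c \<in> carrier K \<and> Gs \<noteq> [] \<and> (\<forall>G \<in> set Gs. wf G \<and> generic_depth G \<le> D)
   \<Longrightarrow> set (term_values ts) \<subseteq> carrier A"
  by (auto intro!: sc_closed vprod_closed)

lemma sum_rep_add:
  assumes "sum_rep p N Z D" "sum_rep p' N' Z' D"
  shows "sum_rep (p \<oplus> p') (N + N') (Z + Z') D"
proof -
  obtain ts where 1: "\<forall>(c, Gs) \<in> set ts. c \<in> carrier K \<and> Gs \<noteq> [] \<and> (\<forall>G \<in> set Gs. wf G \<and> generic_depth G \<le> D)"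
    "lsum (term_values ts) \<sqsubseteq> p" "length ts \<le> N" "(\<Sum>(c, Gs) \<leftarrow> ts. vsizes Gs) \<le> Z"
    using assms(1) unfolding sum_rep_def by blast
  obtain us where 2: "\<forall>(c, Gs) \<in> set us. c \<in> carrier K \<and> Gs \<noteq> [] \<and> (\<forall>G \<in> set Gs. wf G \<and> generic_depth G \<le> D)"
    "lsum (term_values us) \<sqsubseteq> p'" "length us \<le> N'" "(\<Sum>(c, Gs) \<leftarrow> us. vsizes Gs) \<le> Z'"
    using assms(2) unfolding sum_rep_def by blast
  have "lsum (term_values (ts @ us)) = lsum (term_values ts) \<oplus> lsum (term_values us)"
    unfolding map_append by (intro lsum_append term_values_closed[OF 1(1)] term_values_closed[OF 2(1)])
  also have "\<dots> \<sqsubseteq> p \<oplus> p'" using 1 2 by (intro add_le)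
  finally show ?thesis unfolding sum_rep_def using 1 2
    by (intro exI[of _ "ts @ us"]) auto
qed

text \<open>Distributivity saves a level of gates at the price of \<open>N\<close> copies of the
  outer factors.\<close>

lemma sum_rep_sandwich:
  assumes "prod_rep a Z1 D" "sum_rep p N Z D" "prod_rep b Z2 D"
  shows "sum_rep (a \<otimes> p \<otimes> b) N (Z + N * (Z1 + Z2)) D"
proof -
  obtain ts where ts: "\<forall>(c, Gs) \<in> set ts. c \<in> carrier K \<and> Gs \<noteq> [] \<and> (\<forall>G \<in> set Gs. wf G \<and> generic_depth G \<le> D)"
    "lsum (term_values ts) \<sqsubseteq> p" "length ts \<le> N" "(\<Sum>(c, Gs) \<leftarrow> ts. vsizes Gs) \<le> Z"
    using assms(2) unfolding sum_rep_def by blast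
  obtain c Ls where L: "c \<in> carrier K" "\<forall>G \<in> set Ls. wf G \<and> generic_depth G \<le> D"
     "sc c (vprod Ls) \<sqsubseteq> a" "vsizes Ls \<le> Z1" using assms(1) unfolding prod_rep_def by blast
  obtain d Rs where R: "d \<in> carrier K" "\<forall>G \<in> set Rs. wf G \<and> generic_depth G \<le> D"
     "sc d (vprod Rs) \<sqsubseteq> b" "vsizes Rs \<le> Z2" using assms(3) unfolding prod_rep_def by blast
  define us where "us = map (\<lambda>(e, Gs). (c \<otimes>\<^bsub>K\<^esub> (e \<otimes>\<^bsub>K\<^esub> d), Ls @ Gs @ Rs)) ts"
  have cl: "vprod Ls \<in> carrier A" "vprod Rs \<in> carrier A" using L R by (auto intro!: vprod_closed)
  have "term_values us = map (\<lambda>p. sc c (vprod Ls) \<otimes> p \<otimes> sc d (vprod Rs)) (term_values ts)"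
    unfolding us_def map_map
  proof (intro map_cong refl)
    fix t assume "t \<in> set ts"
    then obtain e Gs where t: "t = (e, Gs)" "e \<in> carrier K" "\<forall>G \<in> set Gs. wf G" using ts(1) by fastforce
    have g: "vprod Gs \<in> carrier A" using t by (auto intro!: vprod_closed)
    have "vprod (Ls @ Gs @ Rs) = vprod Ls \<otimes> vprod (Gs @ Rs)"
      unfolding map_append[of _ Ls] using t L R by (intro lprod_append) auto
    also have "vprod (Gs @ Rs) = vprod Gs \<otimes> vprod Rs"
      unfolding map_append using t L R by (intro lprod_append) auto
    finally have e: "vprod (Ls @ Gs @ Rs) = vprod Ls \<otimes> vprod Gs \<otimes> vprod Rs"
      using cl g by (simp add: m_assoc)
    show "((\<lambda>(c, Gs). sc c (vprod Gs)) \<circ> (\<lambda>(e, Gs). (c \<otimes>\<^bsub>K\<^esub> (e \<otimes>\<^bsub>K\<^esub> d), Ls @ Gs @ Rs))) t =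
       ((\<lambda>p. sc c (vprod Ls) \<otimes> p \<otimes> sc d (vprod Rs)) \<circ> (\<lambda>(c, Gs). sc c (vprod Gs))) t"
      using cl g t(2) L(1) R(1) e unfolding t(1)
      by (simp add: sc_mult_left sc_mult_right sc_sc K.m_ac del: map_append)
  qed
  then have "lsum (term_values us) = sc c (vprod Ls) \<otimes> lsum (term_values ts) \<otimes> sc d (vprod Rs)"
    using cl L(1) R(1) term_values_closed[OF ts(1)] by (simp only: lsum_sandwich sc_closed)
  also have "\<dots> \<sqsubseteq> a \<otimes> p \<otimes> b" using L R ts by (intro mult_le)
  finally have le: "lsum (term_values us) \<sqsubseteq> a \<otimes> p \<otimes> b" .
  have "(\<Sum>(c, Gs) \<leftarrow> us. vsizes Gs) = (\<Sum>(c, Gs) \<leftarrow> ts. vsizes Gs) + length ts * (vsizes Ls + vsizes Rs)"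
    unfolding us_def by (induction ts) auto
  also have "\<dots> \<le> Z + N * (Z1 + Z2)"
    using L R ts by (intro add_mono mult_mono) auto
  finally have "(\<Sum>(c, Gs) \<leftarrow> us. vsizes Gs) \<le> Z + N * (Z1 + Z2)" .
  moreover have "\<forall>(c, Gs) \<in> set us. c \<in> carrier K \<and> Gs \<noteq> [] \<and> (\<forall>G \<in> set Gs. wf G \<and> generic_depth G \<le> D)"
    using ts(1) L R unfolding us_def by fastforce
  ultimately show ?thesis unfolding sum_rep_def using le ts(3) by (intro exI[of _ us]) (auto simp: us_def)
qed

lemma sum_rep_sc:
  assumes "sum_rep p N Z D" "c \<in> carrier K" "p \<in> carrier A"
  shows "sum_rep (sc c p) N Z D"
proof -
  \<comment> \<open>Scaling is multiplication by a constant \<open>prod_rep\<close>, whose size is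
    0.\<close>
  have "sum_rep (sc c \<one> \<otimes> p \<otimes> sc \<one>\<^bsub>K\<^esub> \<one>) N (Z + N * (0 + 0)) D"
    using assms by (intro sum_rep_sandwich prod_rep_const) auto
  then show ?thesis using assms by (simp add: sc_one sc_mult_left)
qed

text \<open>The two levels are a \<open>+\<close>-gate over \<open>\<times>\<close>-gates.\<close>

lemma gate_rep_of_sum_rep:
  assumes "sum_rep p N Z D"
  shows "gate_rep p Z (D + 2)"
proof -
  obtain ts where ts: "\<forall>(c, Gs) \<in> set ts. c \<in> carrier K \<and> Gs \<noteq> [] \<and> (\<forall>G \<in> set Gs. wf G \<and> generic_depth G \<le> D)"
    "lsum (term_values ts) \<sqsubseteq> p" "length ts \<le> N" "(\<Sum>(c, Gs) \<leftarrow> ts. vsizes Gs) \<le> Z"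
    using assms unfolding sum_rep_def by blast
  define prd :: "'a formula list \<Rightarrow> 'a formula" where "prd Gs = Times_Gate (map (Pair \<one>\<^bsub>K\<^esub>) Gs)" for Gs
  define G where "G = Plus_Gate (map (\<lambda>(c, Gs). (c, prd Gs)) ts)"
  have prd: "ev (prd Gs) = vprod Gs" "formula_size (prd Gs) = vsizes Gs" if "\<forall>G \<in> set Gs. wf G" for Gs
  proof -
    have "map (\<lambda>(c, G). sc c (ev G)) (map (Pair \<one>\<^bsub>K\<^esub>) Gs) = map ev Gs"
      using that by (auto simp: sc_one)
    then show "ev (prd Gs) = vprod Gs" unfolding prd_def ev_Times by (simp only:)
    show "formula_size (prd Gs) = vsizes Gs" unfolding prd_def by (simp add: comp_def)
  qed
  have "ev G = lsum (term_values ts)"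
  proof -
    have "map (\<lambda>(c, G). sc c (ev G)) (map (\<lambda>(c, Gs). (c, prd Gs)) ts) = term_values ts"
      unfolding map_map using ts(1) prd(1) by (intro map_cong refl) fastforce
    then show ?thesis unfolding G_def ev_Plus by (simp only:)
  qed
  moreover have "formula_size G = (\<Sum>(c, Gs) \<leftarrow> ts. vsizes Gs)"
  proof -
    have "map (\<lambda>(c, G). formula_size G) (map (\<lambda>(c, Gs). (c, prd Gs)) ts) = map (\<lambda>(c, Gs). vsizes Gs) ts"
      unfolding map_map using ts(1) prd(2) by (intro map_cong refl) fastforce
    then show ?thesis unfolding G_def formula_size.simps by (simp only:)
  qed
  moreover have "wf G" using ts(1) unfolding G_def prd_def by fastforce
  moreover have "generic_depth G \<le> D + 2"
    using ts(1) unfolding G_def prd_def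
    by (simp add: split_beta Max_insert_0_le_iff)
  ultimately show ?thesis unfolding gate_rep_def using ts by auto
qed

text \<open>Both kinds of gates combine the children by monotone operations, so one list of
  replacements serves both.\<close>

lemma gate_rep_choice:
  assumes "\<forall>(c, G) \<in> set cs. c \<in> carrier K \<and> gate_rep (ev G) (f G) D"
  shows "\<exists>ds. length ds = length cs \<and> (\<forall>(c, G) \<in> set ds. c \<in> carrier K \<and> wf G \<and> generic_depth G \<le> D) \<and>
     (\<Sum>(c, G) \<leftarrow> ds. formula_size G) \<le> (\<Sum>(c, G) \<leftarrow> cs. f G) \<and>
     ev (Plus_Gate ds) \<sqsubseteq> ev (Plus_Gate cs) \<and> ev (Times_Gate ds) \<sqsubseteq> ev (Times_Gate cs)"
  using assms
proof (induction cs)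
  case Nil
  then show ?case by auto
next
  case (Cons aG cs)
  obtain a G where aG: "aG = (a, G)" by force
  obtain H where H: "wf H" "ev H \<sqsubseteq> ev G" "formula_size H \<le> f G" "generic_depth H \<le> D"
    using Cons.prems aG unfolding gate_rep_def by auto
  have a: "a \<in> carrier K" using Cons.prems aG by auto
  obtain ds where ds: "length ds = length cs" "\<forall>(c, G) \<in> set ds. c \<in> carrier K \<and> wf G \<and> generic_depth G \<le> D"
     "(\<Sum>(c, G) \<leftarrow> ds. formula_size G) \<le> (\<Sum>(c, G) \<leftarrow> cs. f G)"
     "ev (Plus_Gate ds) \<sqsubseteq> ev (Plus_Gate cs)" "ev (Times_Gate ds) \<sqsubseteq> ev (Times_Gate cs)"
    using Cons by (metis (no_types, lifting) list.set_intros(2))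
  show ?case
    using ds H a aG by (intro exI[of _ "(a, H) # ds"]) (auto intro!: add_le mult_le sc_le simp: ev_Plus ev_Times)
qed

lemma gate_rep_Plus:
  assumes "\<forall>(c, G) \<in> set cs. c \<in> carrier K \<and> gate_rep (ev G) (f G) D"
  shows "gate_rep (ev (Plus_Gate cs)) (\<Sum>(c, G) \<leftarrow> cs. f G) (Suc D)"
proof -
  obtain ds where "\<forall>(c, G) \<in> set ds. c \<in> carrier K \<and> wf G \<and> generic_depth G \<le> D"
     "(\<Sum>(c, G) \<leftarrow> ds. formula_size G) \<le> (\<Sum>(c, G) \<leftarrow> cs. f G)" "ev (Plus_Gate ds) \<sqsubseteq> ev (Plus_Gate cs)"
    using gate_rep_choice[OF assms] by blast
  then show ?thesis unfolding gate_rep_def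
    by (intro exI[of _ "Plus_Gate ds"]) (auto simp: Max_insert_0_le_iff simp del: formula_value.simps)
qed

lemma gate_rep_Times:
  assumes "\<forall>(c, G) \<in> set cs. c \<in> carrier K \<and> gate_rep (ev G) (f G) D" "cs \<noteq> []"
  shows "gate_rep (ev (Times_Gate cs)) (\<Sum>(c, G) \<leftarrow> cs. f G) (Suc D)"
proof -
  obtain ds where "\<forall>(c, G) \<in> set ds. c \<in> carrier K \<and> wf G \<and> generic_depth G \<le> D" "length ds = length cs"
     "(\<Sum>(c, G) \<leftarrow> ds. formula_size G) \<le> (\<Sum>(c, G) \<leftarrow> cs. f G)" "ev (Times_Gate ds) \<sqsubseteq> ev (Times_Gate cs)"
    using gate_rep_choice[OF assms(1)] by blast
  then show ?thesis unfolding gate_rep_def using assms(2)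
    by (intro exI[of _ "Times_Gate ds"]) (auto simp: Max_insert_0_le_iff simp del: formula_value.simps)
qed

lemma sum_rep_Plus:
  assumes "\<forall>(c, G) \<in> set cs. c \<in> carrier K \<and> wf G \<and> sum_rep (ev G) (N G) (Z G) D"
  shows "sum_rep (ev (Plus_Gate cs)) (\<Sum>(c, G) \<leftarrow> cs. N G) (\<Sum>(c, G) \<leftarrow> cs. Z G) D"
  using assms
proof (induction cs)
  case Nil
  then show ?case using sum_rep_zero by simp
next
  case (Cons aG cs)
  then show ?case by (auto simp: split_beta intro!: sum_rep_add sum_rep_sc)
qed

text \<open>\<open>W\<close> is the budget per leaf and \<open>t\<close> the number of copies it has
  to pay for, later \<open>2 * R\<close>. A product instead of a quotient keeps the bound within the
  natural numbers.\<close>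

lemma prod_rep_list:
  assumes "\<forall>G \<in> set Gs. \<exists>Z. prod_rep (ev G) Z D \<and> t * Z \<le> formula_size G * W"
  shows "\<exists>Z. prod_rep (vprod Gs) Z D \<and> t * Z \<le> vsizes Gs * W"
  using assms
proof (induction Gs)
  case Nil
  have "prod_rep (sc \<one>\<^bsub>K\<^esub> \<one>) 0 D" by (intro prod_rep_const) simp
  then show ?case by (auto simp: sc_one intro!: exI[of _ 0])
next
  case (Cons G Gs)
  obtain Z1 where 1: "prod_rep (ev G) Z1 D" "t * Z1 \<le> formula_size G * W" using Cons by auto
  obtain Z2 where 2: "prod_rep (vprod Gs) Z2 D" "t * Z2 \<le> vsizes Gs * W" using Cons by auto
  show ?case using 1 2 prod_rep_mult[OF 1(1) 2(1)]
    by (intro exI[of _ "Z1 + Z2"]) (auto simp: distrib_left distrib_right)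
qed

end

section \<open>Depth reduction in a semiring\<close>

fun gate_children :: "'a formula \<Rightarrow> 'a formula set" where
  "gate_children (Plus_Gate cs) = snd ` set cs"
| "gate_children (Times_Gate cs) = snd ` set cs"
| "gate_children G = {}"

text \<open>A gate with a single child has the \<open>formula_size\<close> of that child; only
  \<open>size\<close> is sure to decrease.\<close>

lemma children_bounds:
  assumes "w \<in> gate_children v"
  shows "formula_size w \<le> formula_size v" "size w < size v" "generic_formula R n v \<Longrightarrow> generic_formula R n w"
proof -
  have sum: "f w \<le> (\<Sum>(c, G) \<leftarrow> cs. f G)" if "w \<in> snd ` set cs" for cs and f :: "'a formula \<Rightarrow> nat"
  proof -
    have "f w \<in> set (map (\<lambda>(c, G). f G) cs)" using that by force
    then show ?thesis by (rule member_le_sum_list) simp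
  qed
  show "formula_size w \<le> formula_size v" using assms sum by (cases v) auto
  have "size w < size_list (size_prod (\<lambda>_. 0) size) cs" if "w \<in> snd ` set cs" for cs :: "('a \<times> 'a formula) list"
    using that
  proof (induction cs)
    case (Cons cG cs)
    then show ?case by (cases cG; cases "w \<in> snd ` set cs") auto
  qed simp
  then show "size w < size v" using assms by (cases v) (auto intro: less_SucI)
  show "generic_formula R n v \<Longrightarrow> generic_formula R n w" using assms by (cases v) auto
qed

lemma sum_list_children_mult:
  "(\<Sum>(c, G) \<leftarrow> cs. f G * k) = (\<Sum>(c, G) \<leftarrow> cs. f G) * (k :: nat)"
  by (induction cs) (auto simp: distrib_right)

context scalar_semiring begin

text \<open>\<open>B\<close> is \<open>u\<close> with \<open>v\<close> replaced by the empty sum, which has size \<open>0\<close>.\<close>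

lemma path_decomposition:
  assumes "wf u" "P u"
  shows "\<exists>B c Ls v Rs. wf B \<and> c \<in> carrier K \<and>
     (\<forall>H \<in> set Ls \<union> set Rs. wf H \<and> generic_degree H + generic_degree v \<le> generic_degree u) \<and>
     wf v \<and> P v \<and> (\<forall>w \<in> gate_children v. \<not> P w) \<and>
     ev u = ev B \<oplus> sc c (vprod Ls \<otimes> ev v \<otimes> vprod Rs) \<and>
     formula_size B + formula_size v \<le> formula_size u \<and>
     vsizes Ls + vsizes Rs + formula_size v \<le> formula_size u \<and>
     generic_degree B \<le> generic_degree u \<and> generic_degree v \<le> generic_degree u \<and>
     size v \<le> size u"
    (is "?decomp u")
proof -
  \<comment> \<open>The path of length 0, where \<open>B\<close> is the empty sum.\<close>
  have trivial: "?decomp u" if "wf u" "P u" "\<forall>w \<in> gate_children u. \<not> P w" for u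
    by (rule exI[of _ "Plus_Gate []"], rule exI[of _ "\<one>\<^bsub>K\<^esub>"], rule exI[of _ "[]"], rule exI[of _ u], rule exI[of _ "[]"])
      (use that ev_closed[OF that(1)] in \<open>simp add: sc_one\<close>)
  from assms show "?decomp u"
  proof (induction u)
    case One_Leaf
    then show ?case
      by (intro trivial) auto
  next
    case (Var_Leaf i)
    then show ?case
      by (intro trivial) auto
  next
    case (Plus_Gate cs)
    show ?case
    proof (cases "\<exists>w \<in> snd ` set cs. P w")
      case False
      show ?thesis using False Plus_Gate.prems by (intro trivial) auto
    next
      case True
      then obtain a w where aw: "(a, w) \<in> set cs" "P w" by auto
      then obtain as bs where cs: "cs = as @ (a, w) # bs" using split_list by metis
      have wfw: "wf w" "a \<in> carrier K" using Plus_Gate.prems(1) aw by auto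
      obtain B c Ls v Rs where IH: "wf B" "c \<in> carrier K"
       "\<forall>H \<in> set Ls \<union> set Rs. wf H \<and> generic_degree H + generic_degree v \<le> generic_degree w"
       "wf v" "P v" "\<forall>w \<in> gate_children v. \<not> P w"
       "ev w = ev B \<oplus> sc c (vprod Ls \<otimes> ev v \<otimes> vprod Rs)"
       "formula_size B + formula_size v \<le> formula_size w"
       "vsizes Ls + vsizes Rs + formula_size v \<le> formula_size w"
       "generic_degree B \<le> generic_degree w" "generic_degree v \<le> generic_degree w" "size v \<le> size w"
        using Plus_Gate.IH[of "(a, w)" w] aw wfw by auto
      have sz: "size v \<le> size (Plus_Gate cs)" using IH(12) cs by simp
      \<comment> \<open>At a \<open>+\<close>-gate the siblings go into \<open>B'\<close> only; the
        factors \<open>Ls\<close> and \<open>Rs\<close> stay as they are.\<close>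
      define B' where "B' = Plus_Gate (as @ (a, B) # bs)"
      have cl: "set (map (\<lambda>(c, G). sc c (ev G)) as) \<subseteq> carrier A" "set (map (\<lambda>(c, G). sc c (ev G)) bs) \<subseteq> carrier A"
        using Plus_Gate.prems(1) cs by (auto simp: ball_Un)
      have X: "vprod Ls \<otimes> ev v \<otimes> vprod Rs \<in> carrier A" (is "?X \<in> _")
        using IH by (auto intro!: m_closed vprod_closed)
      have wB: "ev B \<in> carrier A" using IH by simp
      have deg: "generic_degree w \<le> generic_degree (Plus_Gate cs)" using cs by (auto simp: le_max_iff_disj)
      have "ev (Plus_Gate cs) = lsum (map (\<lambda>(c, G). sc c (ev G)) as) \<oplus> (sc a (ev w) \<oplus> lsum (map (\<lambda>(c, G). sc c (ev G)) bs))"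
        unfolding ev_Plus cs using cl wfw by (simp add: lsum_append)
      also have "sc a (ev w) = sc a (ev B) \<oplus> sc (a \<otimes>\<^bsub>K\<^esub> c) ?X"
        unfolding IH(7) using IH wfw X wB by (simp add: sc_add sc_sc)
      also have "lsum (map (\<lambda>(c, G). sc c (ev G)) as) \<oplus> (sc a (ev B) \<oplus> sc (a \<otimes>\<^bsub>K\<^esub> c) ?X \<oplus> lsum (map (\<lambda>(c, G). sc c (ev G)) bs)) =
        lsum (map (\<lambda>(c, G). sc c (ev G)) as) \<oplus> (sc a (ev B) \<oplus> lsum (map (\<lambda>(c, G). sc c (ev G)) bs)) \<oplus> sc (a \<otimes>\<^bsub>K\<^esub> c) ?X"
        using cl[THEN lsum_closed] wfw IH X wB by (simp add: a_ac)
      also have "lsum (map (\<lambda>(c, G). sc c (ev G)) as) \<oplus> (sc a (ev B) \<oplus> lsum (map (\<lambda>(c, G). sc c (ev G)) bs)) = ev B'"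
        unfolding ev_Plus B'_def using cl wfw wB by (simp add: lsum_append)
      finally have ev: "ev (Plus_Gate cs) = ev B' \<oplus> sc (a \<otimes>\<^bsub>K\<^esub> c) ?X" .
      have "\<forall>x \<in> set (as @ (a, B) # bs). (case x of (c, G) \<Rightarrow> generic_degree G) \<le> generic_degree (Plus_Gate cs)"
      proof
        fix x assume "x \<in> set (as @ (a, B) # bs)"
        then consider "x \<in> set cs" | "x = (a, B)" unfolding cs by auto
        then show "(case x of (c, G) \<Rightarrow> generic_degree G) \<le> generic_degree (Plus_Gate cs)"
        proof cases
          case 1
          then show ?thesis by (auto intro!: Max_ge)
        next
          case 2
          then show ?thesis using order_trans[OF IH(10) deg] by simp
        qed
      qed
      then have "generic_degree B' \<le> generic_degree (Plus_Gate cs)"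
        unfolding B'_def generic_degree.simps(3)[of "as @ (a, B) # bs"] Max_insert_0_le_iff .
      moreover have "wf B'" using Plus_Gate.prems(1) IH(1) unfolding B'_def cs by auto
      ultimately show ?thesis
        using ev IH deg wfw sz
        by - (rule exI[of _ B'], rule exI[of _ "a \<otimes>\<^bsub>K\<^esub> c"], rule exI[of _ Ls], rule exI[of _ v], rule exI[of _ Rs],
         auto simp: B'_def cs simp del: formula_value.simps generic_degree.simps generic_formula.simps dest: order_trans)
    qed
  next
    case (Times_Gate cs)
    show ?case
    proof (cases "\<exists>w \<in> snd ` set cs. P w")
      case False
      show ?thesis using False Times_Gate.prems by (intro trivial) auto
    next
      case True
      then obtain a w where aw: "(a, w) \<in> set cs" "P w" by auto
      then obtain as bs where cs: "cs = as @ (a, w) # bs" using split_list by metis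
      have wfw: "wf w" "a \<in> carrier K" using Times_Gate.prems(1) aw by auto
      obtain B c Ls v Rs where IH: "wf B" "c \<in> carrier K"
       "\<forall>H \<in> set Ls \<union> set Rs. wf H \<and> generic_degree H + generic_degree v \<le> generic_degree w"
       "wf v" "P v" "\<forall>w \<in> gate_children v. \<not> P w"
       "ev w = ev B \<oplus> sc c (vprod Ls \<otimes> ev v \<otimes> vprod Rs)"
       "formula_size B + formula_size v \<le> formula_size w"
       "vsizes Ls + vsizes Rs + formula_size v \<le> formula_size w"
       "generic_degree B \<le> generic_degree w" "generic_degree v \<le> generic_degree w" "size v \<le> size w"
        using Times_Gate.IH[of "(a, w)" w] aw wfw by auto
      define B' where "B' = Times_Gate (as @ (a, B) # bs)"
      have wfl: "\<forall>(c, G) \<in> set as. c \<in> carrier K \<and> wf G" "\<forall>(c, G) \<in> set bs. c \<in> carrier K \<and> wf G"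
        using Times_Gate.prems(1) cs by auto
      have cl: "set (map (\<lambda>(c, G). sc c (ev G)) as) \<subseteq> carrier A" "set (map (\<lambda>(c, G). sc c (ev G)) bs) \<subseteq> carrier A"
        using wfl by auto
      obtain c1 where c1: "c1 \<in> carrier K" "lprod (map (\<lambda>(c, G). sc c (ev G)) as) = sc c1 (lprod (map (\<lambda>aG. ev (snd aG)) as))"
        using lprod_scalars[OF wfl(1)] by blast
      obtain c2 where c2: "c2 \<in> carrier K" "lprod (map (\<lambda>(c, G). sc c (ev G)) bs) = sc c2 (lprod (map (\<lambda>aG. ev (snd aG)) bs))"
        using lprod_scalars[OF wfl(2)] by blast
      have wl: "\<forall>G \<in> set (map snd as). wf G" "\<forall>G \<in> set (map snd bs). wf G" using wfl by auto
      have pa: "lprod (map (\<lambda>aG. ev (snd aG)) as) = vprod (map snd as)" "lprod (map (\<lambda>aG. ev (snd aG)) bs) = vprod (map snd bs)"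
        by (simp_all add: comp_def)
      let ?L = "vprod (map snd as)" and ?R = "vprod (map snd bs)"
      have cl2: "?L \<in> carrier A" "?R \<in> carrier A" "vprod Ls \<in> carrier A" "vprod Rs \<in> carrier A" "ev v \<in> carrier A" "ev B \<in> carrier A"
        using wl IH by (auto intro!: vprod_closed simp del: map_map)
      let ?X = "vprod Ls \<otimes> ev v \<otimes> vprod Rs"
      have X: "?X \<in> carrier A" using cl2 by simp
      \<comment> \<open>Stated for arbitrary \<open>G\<close> in place of \<open>w\<close>: with
        \<open>w\<close> it unfolds the gate, with \<open>B\<close> it folds the first summand back
        into \<open>B'\<close>.\<close>
      have exp: "ev (Times_Gate (as @ (a, G) # bs)) = sc (c1 \<otimes>\<^bsub>K\<^esub> (a \<otimes>\<^bsub>K\<^esub> c2)) (?L \<otimes> ev G \<otimes> ?R)" if "wf G" for G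
      proof -
        have "ev (Times_Gate (as @ (a, G) # bs)) = lprod (map (\<lambda>(c, G). sc c (ev G)) as) \<otimes> (sc a (ev G) \<otimes> lprod (map (\<lambda>(c, G). sc c (ev G)) bs))"
          unfolding ev_Times using cl wfw that by (simp add: lprod_append)
        also have "\<dots> = sc (c1 \<otimes>\<^bsub>K\<^esub> (a \<otimes>\<^bsub>K\<^esub> c2)) (?L \<otimes> ev G \<otimes> ?R)"
          using c1 c2 cl2 wfw that unfolding c1(2) c2(2) pa
          by (simp add: sc_mult_left sc_mult_right sc_sc m_assoc K.m_ac)
        finally show ?thesis .
      qed
      define e where "e = c1 \<otimes>\<^bsub>K\<^esub> (a \<otimes>\<^bsub>K\<^esub> c2)"
      have e: "e \<in> carrier K" using c1 c2 wfw by (simp add: e_def)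
      have "ev (Times_Gate cs) = sc e (?L \<otimes> (ev B \<oplus> sc c ?X) \<otimes> ?R)"
        unfolding cs exp[OF wfw(1)] e_def[symmetric] IH(7) ..
      also have "\<dots> = sc e (?L \<otimes> ev B \<otimes> ?R) \<oplus> sc (e \<otimes>\<^bsub>K\<^esub> c) (?L \<otimes> ?X \<otimes> ?R)"
        using cl2 X e IH(2) by (simp add: l_distr r_distr sc_add sc_mult_left sc_mult_right sc_sc)
      also have "?L \<otimes> ?X \<otimes> ?R = (?L \<otimes> vprod Ls) \<otimes> ev v \<otimes> (vprod Rs \<otimes> ?R)"
        using cl2 by (simp add: m_assoc)
      also have "?L \<otimes> vprod Ls = vprod (map snd as @ Ls)"
        unfolding map_append using wl IH by (intro lprod_append[symmetric]) auto
      also have "vprod Rs \<otimes> ?R = vprod (Rs @ map snd bs)"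
        unfolding map_append using wl IH by (intro lprod_append[symmetric]) auto
      also have "sc e (?L \<otimes> ev B \<otimes> ?R) = ev B'" unfolding B'_def exp[OF IH(1)] e_def ..
      finally have ev: "ev (Times_Gate cs) = ev B' \<oplus> sc (e \<otimes>\<^bsub>K\<^esub> c) (vprod (map snd as @ Ls) \<otimes> ev v \<otimes> vprod (Rs @ map snd bs))" .
      have sz: "(\<Sum>(c, G) \<leftarrow> as. formula_size G) = vsizes (map snd as)" "(\<Sum>(c, G) \<leftarrow> bs. formula_size G) = vsizes (map snd bs)"
        by (simp_all add: comp_def case_prod_beta')
      have dg: "(\<Sum>(c, G) \<leftarrow> as. generic_degree G) = sum_list (map generic_degree (map snd as))"
         "(\<Sum>(c, G) \<leftarrow> bs. generic_degree G) = sum_list (map generic_degree (map snd bs))"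
        by (simp_all add: comp_def case_prod_beta')
      have mem: "generic_degree H \<le> sum_list (map generic_degree Gs)" if "H \<in> set Gs" for H :: "'a formula" and Gs
        using that by (intro member_le_sum_list) auto
      \<comment> \<open>Degrees add up at a \<open>\<times>\<close>-gate, so a sibling and the end
        of the path share the degree of the gate.\<close>
      have degs: "generic_degree H + generic_degree v \<le> generic_degree (Times_Gate cs)"
        if H: "H \<in> set (map snd as @ Ls) \<union> set (Rs @ map snd bs)" for H
      proof -
        consider "H \<in> set (map snd as)" | "H \<in> set (map snd bs)" | "H \<in> set Ls \<union> set Rs" using H by auto
        then show ?thesis
        proof cases
          case 1
          then show ?thesis using mem[OF 1] IH(11) unfolding cs by (simp add: dg del: map_map)
        next
          case 2
          then show ?thesis using mem[OF 2] IH(11) unfolding cs by (simp add: dg del: map_map)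
        next
          case 3
          then have "generic_degree H + generic_degree v \<le> generic_degree w" using IH(3) by blast
          then show ?thesis unfolding cs by simp
        qed
      qed
      have "wf B'" using Times_Gate.prems(1) IH(1) unfolding B'_def cs by auto
      moreover have "\<forall>H \<in> set (map snd as @ Ls) \<union> set (Rs @ map snd bs). wf H"
        using wl IH(3) by auto
      moreover have "formula_size B' + formula_size v \<le> formula_size (Times_Gate cs)"
        using IH(8) unfolding B'_def cs by simp
      moreover have "vsizes (map snd as @ Ls) + vsizes (Rs @ map snd bs) + formula_size v \<le> formula_size (Times_Gate cs)"
        using IH(9) unfolding cs by (simp add: sz del: map_map)
      moreover have "generic_degree B' \<le> generic_degree (Times_Gate cs)" "generic_degree v \<le> generic_degree (Times_Gate cs)"
        using IH(10,11) unfolding B'_def cs by auto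
      moreover have "e \<otimes>\<^bsub>K\<^esub> c \<in> carrier K" using e IH by simp
      moreover have "size v \<le> size (Times_Gate cs)" using IH(12) cs by simp
      ultimately show ?thesis
        using ev IH(4,5,6) degs by blast
    qed
  qed
qed

end

text \<open>
  Sizes have a fine class \<open>q\<close> and a coarse class \<open>rank\<close>, degrees a class \<open>drank\<close>; \<open>expo\<close> and \<open>dexpo\<close> are
  the orders of magnitude. The end \<open>v\<close> of the path is expanded along its children with the same \<open>rank\<close>
  and \<open>drank\<close> but another \<open>q\<close>, and \<open>terms s\<close> bounds the number of summands that this produces.
\<close>

locale class_system =
  fixes q rank terms expo :: "nat \<Rightarrow> nat" and drank dexpo :: "nat \<Rightarrow> nat" and R M :: nat
  assumes rank_mono: "s \<le> t \<Longrightarrow> rank s \<le> rank t" and rank_0: "rank 0 = 0"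
    and expo_mono: "s \<le> t \<Longrightarrow> expo s \<le> expo t"
    and drank_mono: "d \<le> e \<Longrightarrow> drank d \<le> drank e" and drank_0_iff: "drank d = 0 \<longleftrightarrow> d = 0"
    and dexpo_mono: "d \<le> e \<Longrightarrow> dexpo d \<le> dexpo e"
    and q_drop: "0 < t \<Longrightarrow> t < s \<Longrightarrow> q t = q s \<Longrightarrow> rank (s - t) < rank s \<and> expo (s - t) < expo s"
    and drank_drop: "0 < e \<Longrightarrow> e < d \<Longrightarrow> drank e = drank d \<Longrightarrow> drank (d - e) < drank d \<and> dexpo (d - e) < dexpo d"
    and terms_superadd: "0 < s \<Longrightarrow> (\<And>w. w \<in> set ws \<Longrightarrow> 0 < w \<and> rank w = rank s \<and> q w \<noteq> q s) \<Longrightarrow>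
       sum_list ws \<le> s \<Longrightarrow> 2 + sum_list (map terms ws) \<le> terms s"
    and terms_le: "terms s \<le> R"
    and M_ge: "2 * R \<le> M"
begin

definition cost :: "nat \<Rightarrow> nat \<Rightarrow> nat" where "cost s d = s * (2 ^ expo s * M ^ dexpo d)"
text \<open>One class is worth three levels: two turn a sum of products into a formula, the third is
  for a gate that collects children of lower rank.\<close>

definition level :: "nat \<Rightarrow> nat \<Rightarrow> nat" where "level s d = 3 * (rank s + drank d)"

lemma terms_ge_2: "0 < s \<Longrightarrow> 2 \<le> terms s"
  using terms_superadd[of s "[]"] by simp

lemma R_pos: "0 < R" using terms_ge_2[of 1] terms_le[of 1] by simp
lemma M_pos: "0 < M" using R_pos M_ge by simp

lemma weight_mono: "s \<le> t \<Longrightarrow> d \<le> e \<Longrightarrow> 2 ^ expo s * M ^ dexpo d \<le> (2 ^ expo t * M ^ dexpo e :: nat)"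
  using M_pos by (intro mult_mono power_increasing expo_mono dexpo_mono) auto

lemma cost_le: "s \<le> t \<Longrightarrow> d \<le> e \<Longrightarrow> cost s d \<le> s * (2 ^ expo t * M ^ dexpo e)"
  unfolding cost_def by (intro mult_left_mono weight_mono) auto

lemma level_mono: "s \<le> t \<Longrightarrow> d \<le> e \<Longrightarrow> level s d \<le> level t e"
  unfolding level_def using rank_mono drank_mono by (simp add: add_mono)

text \<open>By \<open>q_drop\<close>, what remains beside a part in the class of the whole has lost
  an order of magnitude, which frees a factor 2.\<close>

lemma cost_size_drop:
  assumes "0 < t" "b + t \<le> s" "q t = q s" "d \<le> e"
  shows "2 * cost b d \<le> b * (2 ^ expo s * M ^ dexpo e)"
proof (cases "b = 0")
  case True
  then show ?thesis by (simp add: cost_def)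
next
  case False
  then have "expo (s - t) < expo s" using assms by (intro conjunct2[OF q_drop]) auto
  moreover have "expo b \<le> expo (s - t)" using assms by (intro expo_mono) simp
  ultimately have "Suc (expo b) \<le> expo s" by simp
  then have "2 ^ Suc (expo b) * M ^ dexpo d \<le> (2 ^ expo s * M ^ dexpo e :: nat)"
    using assms M_pos by (intro mult_mono power_increasing dexpo_mono) auto
  then have "b * (2 ^ Suc (expo b) * M ^ dexpo d) \<le> b * (2 ^ expo s * M ^ dexpo e)"
    by (rule mult_left_mono) simp
  then show ?thesis unfolding cost_def by (simp add: algebra_simps)
qed

text \<open>Here \<open>h\<close> is the degree of a sibling and \<open>e\<close> that of the path's
  end. As \<open>e\<close> already has the class of \<open>d\<close>, \<open>h\<close> loses an
  order of magnitude, and the freed factor \<open>M\<close> pays for \<open>R\<close> copies twice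
  over.\<close>

lemma cost_degree_drop:
  assumes "0 < h" "0 < e" "h + e \<le> d" "drank e = drank d" "b \<le> s"
  shows "2 * R * cost b h \<le> b * (2 ^ expo s * M ^ dexpo d)"
proof -
  have "dexpo (d - e) < dexpo d" using assms by (intro conjunct2[OF drank_drop]) auto
  moreover have "dexpo h \<le> dexpo (d - e)" using assms by (intro dexpo_mono) simp
  ultimately have "Suc (dexpo h) \<le> dexpo d" by simp
  have "2 * R * (2 ^ expo b * M ^ dexpo h) \<le> M * (2 ^ expo b * M ^ dexpo h)"
    using M_ge by (intro mult_right_mono) auto
  also have "\<dots> = 2 ^ expo b * M ^ Suc (dexpo h)" by simp
  also have "\<dots> \<le> 2 ^ expo s * M ^ dexpo d"
    using assms M_pos \<open>Suc (dexpo h) \<le> dexpo d\<close> by (intro mult_mono power_increasing expo_mono) auto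
  finally have "b * (2 * R * (2 ^ expo b * M ^ dexpo h)) \<le> b * (2 ^ expo s * M ^ dexpo d)"
    by (rule mult_left_mono) simp
  then show ?thesis unfolding cost_def by (simp add: algebra_simps)
qed

end

section \<open>The induction that reduces the depth\<close>

locale depth_reduction = scalar_semiring A K sc x le n + class_system q rank terms expo drank dexpo R M
  for A :: "('v, 'w) ring_scheme" (structure) and K :: "('a, 'b) ring_scheme"
    and sc x and le (infix "\<sqsubseteq>" 50) and n q rank terms expo drank dexpo R M
begin

text \<open>Not a single formula, because a child with the classes \<open>rank\<close> and
  \<open>drank\<close> of its parent has the same \<open>level\<close>: its summands must be taken
  over as they are, since a gate around them would exceed the level.\<close>

definition reducible :: "'a formula \<Rightarrow> bool" where
  "reducible u \<longleftrightarrow> sum_rep (ev u) (terms (formula_size u)) (cost (formula_size u) (generic_degree u))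
     (level (formula_size u) (generic_degree u))"

abbreviation gate_reducible :: "'a formula \<Rightarrow> bool" where
  "gate_reducible u \<equiv> gate_rep (ev u) (cost (formula_size u) (generic_degree u))
     (level (formula_size u) (generic_degree u) + 2)"

lemma size_cost: "s \<le> cost s d"
  unfolding cost_def using M_pos by simp

lemma gate_reducibleI:
  assumes "wf u" "generic_degree u \<ge> 1 \<Longrightarrow> reducible u"
  shows "gate_reducible u"
proof (cases "generic_degree u = 0")
  case True
  then consider "\<zero> \<sqsubseteq> ev u" | c where "formula_size u \<ge> 1" "c \<in> carrier K" "sc c \<one> \<sqsubseteq> ev u"
    using constant_formula[OF assms(1)] by blast
  then show ?thesis
  proof cases
    case 1
    then show ?thesis using gate_rep_mono[OF gate_rep_zero 1] by simp
  next
    case 2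
    then show ?thesis using gate_rep_mono[OF gate_rep_const[OF 2(2)] 2(3)] size_cost[of "formula_size u" "generic_degree u"]
      by (meson le_add2 one_le_numeral order_trans)
  qed
next
  case False
  then show ?thesis using assms(2) gate_rep_of_sum_rep unfolding reducible_def by simp
qed

text \<open>\<open>R\<close> copies of a sibling fit into half of its share of the budget. A sibling
  of degree 0 need not lose an order of magnitude, but it is a scalar and its copies are
  free.\<close>

lemma reducible_sibling:
  assumes "wf h" "generic_degree h \<ge> 1 \<Longrightarrow> reducible h" "formula_size h \<le> s"
    and "generic_degree h + e \<le> d" "drank e = drank d" "0 < d"
  shows "\<exists>Z. prod_rep (ev h) Z (level s d) \<and> 2 * R * Z \<le> formula_size h * (2 ^ expo s * M ^ dexpo d)"
proof (cases "generic_degree h = 0")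
  case True
  have l: "1 \<le> level s d" using drank_0_iff[of d] assms(6) unfolding level_def by simp
  consider "\<zero> \<sqsubseteq> ev h" | c where "c \<in> carrier K" "sc c \<one> \<sqsubseteq> ev h"
    using constant_formula[OF assms(1) True] by blast
  then have "prod_rep (ev h) 0 (level s d)"
  proof cases
    case 1
    then show ?thesis using prod_rep_mono[OF prod_rep_of_gate_rep[OF gate_rep_zero] 1 order.refl l] by simp
  next
    case 2
    then show ?thesis using prod_rep_mono[OF prod_rep_const[OF 2(1)] 2(2)] by blast
  qed
  then show ?thesis by (intro exI[of _ 0]) simp
next
  case False
  have "0 < e" using assms(5,6) drank_0_iff by (metis bot_nat_0.not_eq_extremum)
  have "drank (d - e) < drank d" using assms False \<open>0 < e\<close> by (intro conjunct1[OF drank_drop]) auto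
  moreover have "drank (generic_degree h) \<le> drank (d - e)" using assms by (intro drank_mono) simp
  ultimately have "level (formula_size h) (generic_degree h) + 2 \<le> level s d"
    using rank_mono[OF assms(3)] unfolding level_def by simp
  then have "prod_rep (ev h) (cost (formula_size h) (generic_degree h)) (level s d)"
    using prod_rep_mono[OF prod_rep_of_gate_rep[OF gate_reducibleI[OF assms(1,2)]]] by simp
  then show ?thesis using cost_degree_drop[OF _ \<open>0 < e\<close> assms(4,5,3)] False by blast
qed

definition same_rank :: "nat \<Rightarrow> nat \<Rightarrow> 'a formula \<Rightarrow> bool" where
  "same_rank s d w \<longleftrightarrow> rank (formula_size w) = rank s \<and> drank (generic_degree w) = drank d"

lemma lower_rank_gate_rep:
  assumes "wf w" "generic_degree w \<ge> 1 \<Longrightarrow> reducible w" "formula_size w \<le> s" "generic_degree w \<le> d"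
    "\<not> same_rank s d w"
  shows "gate_rep (ev w) (formula_size w * (2 ^ expo s * M ^ dexpo d)) (level s d - 1)"
proof -
  have "rank (formula_size w) + drank (generic_degree w) < rank s + drank d"
    using rank_mono[OF assms(3)] drank_mono[OF assms(4)] assms(5) unfolding same_rank_def by linarith
  then have "level (formula_size w) (generic_degree w) + 2 \<le> level s d - 1" unfolding level_def by simp
  then show ?thesis using gate_rep_mono[OF gate_reducibleI[OF assms(1,2)]] cost_le[OF assms(3,4)] by simp
qed

lemma same_rank_sum_rep:
  assumes "reducible w" "formula_size w \<le> s" "generic_degree w \<le> d"
  shows "sum_rep (ev w) (terms (formula_size w)) (formula_size w * (2 ^ expo s * M ^ dexpo d)) (level s d)"
  using sum_rep_mono[OF assms(1)[unfolded reducible_def] le_refl order.refl cost_le[OF assms(2,3)] level_mono[OF assms(2,3)]] .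

text \<open>Only children with the rank of \<open>u\<close> are expanded; \<open>s\<close> and
  \<open>d\<close> are the size and degree of \<open>u\<close>, not of \<open>v\<close>. The bound
  \<open>terms s - 1\<close> leaves one summand for \<open>B\<close>.\<close>

lemma path_end_reducible:
  assumes v: "wf v" "formula_size v \<le> s" "generic_degree v \<le> d" "0 < generic_degree v"
    and sub: "\<And>w. w \<in> gate_children v \<Longrightarrow> generic_degree w \<ge> 1 \<Longrightarrow> reducible w"
    and q: "\<And>w. w \<in> gate_children v \<Longrightarrow> same_rank s d w \<Longrightarrow> q (formula_size w) \<noteq> q s"
  shows "sum_rep (ev v) (terms s - 1) (formula_size v * (2 ^ expo s * M ^ dexpo d)) (level s d)"
    (is "sum_rep _ _ (_ * ?W) ?D")
proof -
  have d: "0 < d" using v by simp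
  then have D: "1 \<le> ?D" using drank_0_iff[of d] unfolding level_def by simp
  have s: "0 < s" using generic_degree_le_size[of v] v by simp
  have W: "1 \<le> ?W" using M_pos by simp
  have pos: "0 < generic_degree w" "0 < formula_size w" if "same_rank s d w" for w
  proof -
    show "0 < generic_degree w"
      using that d drank_0_iff unfolding same_rank_def by (metis bot_nat_0.not_eq_extremum)
    then show "0 < formula_size w" using generic_degree_le_size[of w] by simp
  qed
  show ?thesis
  proof (cases v)
    case One_Leaf
    then show ?thesis using v by simp
  next
    case (Var_Leaf i)
    have "gate_rep (ev v) 1 0"
      unfolding gate_rep_def using v Var_Leaf by (intro exI[of _ v]) simp
    from sum_rep_mono[OF sum_rep_of_gate_rep[OF this] le_refl _ _ le0] terms_ge_2[OF s] W Var_Leaf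
    show ?thesis by simp
  next
    case (Plus_Gate cs)
    have ch: "c \<in> carrier K" "wf w" "formula_size w \<le> s" "generic_degree w \<le> d" "w \<in> gate_children v"
      if "(c, w) \<in> set cs" for c w
    proof -
      show "c \<in> carrier K" "wf w" using that v Plus_Gate by auto
      show "w \<in> gate_children v" using that Plus_Gate by force
      have "generic_degree w \<le> generic_degree v" using that Plus_Gate by (auto intro!: Max_ge)
      then show "generic_degree w \<le> d" using v by simp
      have "formula_size w \<in> set (map (\<lambda>(c, G). formula_size G) cs)" using that by force
      then have "formula_size w \<le> formula_size v" using member_le_sum_list Plus_Gate by fastforce
      then show "formula_size w \<le> s" using v by simp
    qed
    \<comment> \<open>The children in \<open>E\<close> contribute their own summands, those in
      \<open>F\<close> together a single one, formed by a gate that just reaches the level.\<close>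
    define E where "E = filter (\<lambda>(c, w). same_rank s d w) cs"
    define F where "F = filter (\<lambda>cw. \<not> (\<lambda>(c, w). same_rank s d w) cw) cs"
    have ev: "ev v = ev (Plus_Gate E) \<oplus> ev (Plus_Gate F)"
      unfolding Plus_Gate ev_Plus E_def F_def using ch by (intro lsum_filter) auto
    have "sum_list (map f cs) = sum_list (map f E) + sum_list (map f F)" for f :: "'a \<times> 'a formula \<Rightarrow> nat"
      unfolding E_def F_def by (induction cs) auto
    then have size: "formula_size v = (\<Sum>(c, w) \<leftarrow> E. formula_size w) + (\<Sum>(c, w) \<leftarrow> F. formula_size w)"
      unfolding Plus_Gate by simp
    have "gate_rep (ev (Plus_Gate F)) (\<Sum>(c, w) \<leftarrow> F. formula_size w * ?W) (Suc (?D - 1))"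
    proof (rule gate_rep_Plus)
      show "\<forall>(c, w) \<in> set F. c \<in> carrier K \<and> gate_rep (ev w) (formula_size w * ?W) (?D - 1)"
        using ch sub lower_rank_gate_rep unfolding F_def by auto
    qed
    then have 1: "sum_rep (ev (Plus_Gate F)) 1 (\<Sum>(c, w) \<leftarrow> F. formula_size w * ?W) ?D"
      using D sum_rep_of_gate_rep by simp
    have 2: "sum_rep (ev (Plus_Gate E)) (\<Sum>(c, w) \<leftarrow> E. terms (formula_size w)) (\<Sum>(c, w) \<leftarrow> E. formula_size w * ?W) ?D"
    proof (rule sum_rep_Plus)
      show "\<forall>(c, w) \<in> set E. c \<in> carrier K \<and> wf w \<and> sum_rep (ev w) (terms (formula_size w)) (formula_size w * ?W) ?D"
        using ch sub pos same_rank_sum_rep unfolding E_def by (auto simp: Suc_le_eq)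
    qed
    \<comment> \<open>The 2 in \<open>terms_superadd\<close> reserves one summand for
      \<open>F\<close> and one for \<open>B\<close>.\<close>
    have "2 + sum_list (map terms (map (\<lambda>(c, w). formula_size w) E)) \<le> terms s"
    proof (rule terms_superadd[OF s])
      show "0 < t \<and> rank t = rank s \<and> q t \<noteq> q s" if "t \<in> set (map (\<lambda>(c, w). formula_size w) E)" for t
        using that ch q pos unfolding E_def by (fastforce simp: same_rank_def)
      show "(\<Sum>(c, w) \<leftarrow> E. formula_size w) \<le> s" using size v by simp
    qed
    then have N: "(\<Sum>(c, w) \<leftarrow> E. terms (formula_size w)) + 1 \<le> terms s - 1"
      by (simp add: comp_def case_prod_beta')
    have "(\<Sum>(c, w) \<leftarrow> E. formula_size w * ?W) + (\<Sum>(c, w) \<leftarrow> F. formula_size w * ?W) = formula_size v * ?W"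
      unfolding size by (simp only: sum_list_children_mult distrib_right)
    then show ?thesis
      using sum_rep_mono[OF sum_rep_add[OF 2 1] le_refl N] unfolding ev by simp
  next
    case (Times_Gate cs)
    have wfl: "\<forall>(c, G) \<in> set cs. c \<in> carrier K \<and> wf G" "cs \<noteq> []" using v Times_Gate by auto
    have ch: "wf w" "formula_size w \<le> s" "generic_degree w \<le> d" "w \<in> gate_children v"
      if "(c, w) \<in> set cs" for c w
    proof -
      show "wf w" using that wfl by auto
      show "w \<in> gate_children v" using that Times_Gate by force
      have "generic_degree w \<in> set (map (\<lambda>(c, G). generic_degree G) cs)" using that by force
      then have "generic_degree w \<le> generic_degree v" using member_le_sum_list Times_Gate by fastforce
      then show "generic_degree w \<le> d" using v by simp
      have "formula_size w \<in> set (map (\<lambda>(c, G). formula_size G) cs)" using that by force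
      then have "formula_size w \<le> formula_size v" using member_le_sum_list Times_Gate by fastforce
      then show "formula_size w \<le> s" using v by simp
    qed
    show ?thesis
    proof (cases "\<exists>w \<in> snd ` set cs. same_rank s d w")
      case False
      have "gate_rep (ev v) (\<Sum>(c, w) \<leftarrow> cs. formula_size w * ?W) (Suc (?D - 1))"
        unfolding Times_Gate
      proof (rule gate_rep_Times)
        show "\<forall>(c, w) \<in> set cs. c \<in> carrier K \<and> gate_rep (ev w) (formula_size w * ?W) (?D - 1)"
          using wfl ch sub lower_rank_gate_rep False by fastforce
      qed (rule wfl)
      moreover have "(\<Sum>(c, w) \<leftarrow> cs. formula_size w * ?W) = formula_size v * ?W"
        unfolding Times_Gate by (simp only: sum_list_children_mult formula_size.simps)
      ultimately have "sum_rep (ev v) 1 (formula_size v * ?W) ?D"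
        using D sum_rep_of_gate_rep by simp
      then show ?thesis using sum_rep_mono[OF _ le_refl _ order.refl order.refl] terms_ge_2[OF s] by simp
    next
      case True
      \<comment> \<open>Any such factor will do: it uses up the degree class of \<open>d\<close>, so
        all remaining factors can be treated as siblings of lower degree.\<close>
      then obtain a w where w: "(a, w) \<in> set cs" "same_rank s d w" by auto
      then obtain as bs where cs: "cs = as @ (a, w) # bs" using split_list by metis
      have a: "a \<in> carrier K" "ev w \<in> carrier A" using w wfl by auto
      have wl: "\<forall>(c, G) \<in> set as. c \<in> carrier K \<and> wf G" "\<forall>(c, G) \<in> set bs. c \<in> carrier K \<and> wf G"
        using wfl cs by auto
      obtain c1 where c1: "c1 \<in> carrier K" "lprod (map (\<lambda>(c, G). sc c (ev G)) as) = sc c1 (vprod (map snd as))"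
        using lprod_scalars[OF wl(1)] by (auto simp: comp_def)
      obtain c2 where c2: "c2 \<in> carrier K" "lprod (map (\<lambda>(c, G). sc c (ev G)) bs) = sc c2 (vprod (map snd bs))"
        using lprod_scalars[OF wl(2)] by (auto simp: comp_def)
      have cl: "vprod (map snd as) \<in> carrier A" "vprod (map snd bs) \<in> carrier A"
        using wl by (intro vprod_closed; fastforce)+
      let ?e = "c1 \<otimes>\<^bsub>K\<^esub> (a \<otimes>\<^bsub>K\<^esub> c2)" and ?X = "vprod (map snd as) \<otimes> ev w \<otimes> vprod (map snd bs)"
      have e: "?e \<in> carrier K" and X: "?X \<in> carrier A" using a cl c1 c2 by auto
      have "ev v = lprod (map (\<lambda>(c, G). sc c (ev G)) as) \<otimes> (sc a (ev w) \<otimes> lprod (map (\<lambda>(c, G). sc c (ev G)) bs))"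
        unfolding Times_Gate cs ev_Times using children_closed[OF wl(1)] children_closed[OF wl(2)] a
        by (simp add: lprod_append)
      also have "\<dots> = sc ?e ?X"
        unfolding c1(2) c2(2) using c1 c2 cl a by (simp add: sc_mult_left sc_mult_right sc_sc m_assoc K.m_ac)
      finally have ev: "ev v = sc ?e ?X" .
      have deg: "generic_degree v = sum_list (map generic_degree (map snd as)) + generic_degree w +
          sum_list (map generic_degree (map snd bs))"
        unfolding Times_Gate cs by (simp add: comp_def case_prod_beta')
      have sib: "\<exists>Z. prod_rep (ev h) Z ?D \<and> 2 * R * Z \<le> formula_size h * ?W"
        if h: "h \<in> set (map snd as) \<union> set (map snd bs)" for h
      proof -
        have "h \<in> snd ` set cs" using h cs by auto
        then obtain c where c: "(c, h) \<in> set cs" by auto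
        have mem: "generic_degree h \<le> sum_list (map generic_degree Gs)" if "h \<in> set Gs" for Gs
          using that by (intro member_le_sum_list) auto
        have "generic_degree h + generic_degree w \<le> generic_degree v"
          using h mem unfolding deg by fastforce
        then have "generic_degree h + generic_degree w \<le> d" using v by simp
        then show ?thesis using reducible_sibling ch[OF c] sub w(2) d unfolding same_rank_def by blast
      qed
      obtain Z1 where Z1: "prod_rep (vprod (map snd as)) Z1 ?D" "2 * R * Z1 \<le> vsizes (map snd as) * ?W"
        using prod_rep_list[of "map snd as" ?D "2 * R" ?W] sib by blast
      obtain Z2 where Z2: "prod_rep (vprod (map snd bs)) Z2 ?D" "2 * R * Z2 \<le> vsizes (map snd bs) * ?W"
        using prod_rep_list[of "map snd bs" ?D "2 * R" ?W] sib by blast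
      have "reducible w" using sub ch[OF w(1)] pos[OF w(2)] by simp
      then have "sum_rep (ev w) (terms (formula_size w)) (formula_size w * ?W) ?D"
        using same_rank_sum_rep ch[OF w(1)] by blast
      from sum_rep_sc[OF sum_rep_sandwich[OF Z1(1) this Z2(1)] e X]
      have *: "sum_rep (ev v) (terms (formula_size w)) (formula_size w * ?W + terms (formula_size w) * (Z1 + Z2)) ?D"
        unfolding ev .
      have "2 + sum_list (map terms [formula_size w]) \<le> terms s"
        using w(2) q[OF ch(4)[OF w(1)]] pos[OF w(2)] ch[OF w(1)] by (intro terms_superadd[OF s]) (auto simp: same_rank_def)
      then have N: "terms (formula_size w) \<le> terms s - 1" by simp
      have "terms (formula_size w) * (Z1 + Z2) \<le> R * (Z1 + Z2)" using terms_le by (rule mult_right_mono) simp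
      also have "\<dots> \<le> 2 * R * Z1 + 2 * R * Z2" by (simp add: distrib_left)
      also have "\<dots> \<le> vsizes (map snd as) * ?W + vsizes (map snd bs) * ?W" using Z1 Z2 by (rule_tac add_mono)
      finally have "formula_size w * ?W + terms (formula_size w) * (Z1 + Z2) \<le>
         (vsizes (map snd as) + formula_size w + vsizes (map snd bs)) * ?W"
        by (simp add: distrib_right)
      also have "vsizes (map snd as) + formula_size w + vsizes (map snd bs) = formula_size v"
        unfolding Times_Gate cs by (simp add: comp_def case_prod_beta')
      finally show ?thesis using sum_rep_mono[OF * le_refl N] by simp
    qed
  qed
qed

lemma reducible_if_degree_pos:
  assumes "wf u" "generic_degree u \<ge> 1"
  shows "reducible u"
  using assms
\<comment> \<open>\<open>B\<close> is not a subformula of \<open>u\<close> but has smaller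
  \<open>formula_size\<close>; children of \<open>v\<close> may have the \<open>formula_size\<close>
  of \<open>u\<close> but have smaller \<open>size\<close>.\<close>
proof (induction u rule: wf_induct_rule[OF wf_measures[of "[formula_size, size]"]])
  case (1 u)
  have IH: "reducible w" if "wf w" "generic_degree w \<ge> 1"
    "formula_size w < formula_size u \<or> formula_size w = formula_size u \<and> size w < size u" for w
    using 1(1)[of w] that by auto
  let ?s = "formula_size u" and ?d = "generic_degree u"
  let ?W = "2 ^ expo ?s * M ^ dexpo ?d" and ?D = "level ?s ?d"
  have s: "0 < ?s" using generic_degree_le_size[of u] 1(3) by simp
  obtain B c Ls v Rs where D: "wf B" "c \<in> carrier K"
     "\<forall>H \<in> set Ls \<union> set Rs. wf H \<and> generic_degree H + generic_degree v \<le> ?d"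
     "wf v" "q (formula_size v) = q ?s \<and> drank (generic_degree v) = drank ?d"
     "\<forall>w \<in> gate_children v. \<not> (q (formula_size w) = q ?s \<and> drank (generic_degree w) = drank ?d)"
     "ev u = ev B \<oplus> sc c (vprod Ls \<otimes> ev v \<otimes> vprod Rs)"
     "formula_size B + formula_size v \<le> ?s"
     "vsizes Ls + vsizes Rs + formula_size v \<le> ?s"
     "generic_degree B \<le> ?d" "generic_degree v \<le> ?d" "size v \<le> size u"
    using path_decomposition[OF 1(2), of "\<lambda>w. q (formula_size w) = q ?s \<and> drank (generic_degree w) = drank ?d"]
    by blast
  have vpos: "0 < generic_degree v" using D(5) 1(3) drank_0_iff
    by (metis bot_nat_0.not_eq_extremum less_numeral_extra(3) less_one not_less)
  then have vsz: "0 < formula_size v" using generic_degree_le_size[of v] by simp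
  have B: "2 * cost (formula_size B) (generic_degree B) \<le> formula_size B * ?W"
    using cost_size_drop[OF vsz D(8)] D(5,10) by simp
  have "gate_rep (ev B) (cost (formula_size B) (generic_degree B)) ?D"
  proof -
    have "gate_reducible B" using IH D(1,8) vsz by (intro gate_reducibleI) auto
    moreover have "level (formula_size B) (generic_degree B) + 2 \<le> ?D"
    \<comment> \<open>If \<open>v\<close> has the full size of \<open>u\<close>, then
      \<open>q_drop\<close> does not apply, but \<open>B\<close> has size and degree 0 and so level
      0.\<close>
    proof (cases "formula_size B = 0")
      case True
      then have "generic_degree B = 0" using generic_degree_le_size[of B] by simp
      then have "rank (formula_size B) = 0" "drank (generic_degree B) = 0" using True rank_0 drank_0_iff by auto
      moreover have "0 < drank ?d" using 1(3) drank_0_iff[of ?d] by simp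
      ultimately show ?thesis unfolding level_def by simp
    next
      case False
      then have "rank (?s - formula_size v) < rank ?s" using D(5,8) vsz by (intro conjunct1[OF q_drop]) auto
      moreover have "rank (formula_size B) \<le> rank (?s - formula_size v)" using D(8) by (intro rank_mono) simp
      ultimately show ?thesis using drank_mono[OF D(10)] unfolding level_def by simp
    qed
    ultimately show ?thesis by (rule gate_rep_mono[OF _ le_refl order.refl])
  qed
  then have SB: "sum_rep (ev B) 1 (cost (formula_size B) (generic_degree B)) ?D" by (rule sum_rep_of_gate_rep)
  have sib: "\<exists>Z. prod_rep (ev h) Z ?D \<and> 2 * R * Z \<le> formula_size h * ?W"
    if h: "h \<in> set Ls \<union> set Rs" for h
  proof -
    have mem: "formula_size h \<le> vsizes Gs" if "h \<in> set Gs" for Gs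
      using that by (intro member_le_sum_list) auto
    have "formula_size h + formula_size v \<le> ?s" using h mem D(9) by fastforce
    then have "formula_size h < ?s" "formula_size h \<le> ?s" using vsz by auto
    then show ?thesis using h D(3,5) IH 1(3) by (intro reducible_sibling[of _ _ "generic_degree v"]) auto
  qed
  obtain Z1 where Z1: "prod_rep (vprod Ls) Z1 ?D" "2 * R * Z1 \<le> vsizes Ls * ?W"
    using prod_rep_list[of Ls ?D "2 * R" ?W] sib by blast
  obtain Z2 where Z2: "prod_rep (vprod Rs) Z2 ?D" "2 * R * Z2 \<le> vsizes Rs * ?W"
    using prod_rep_list[of Rs ?D "2 * R" ?W] sib by blast
  have ch: "wf w" "formula_size w \<le> formula_size v" "size w < size v" if "w \<in> gate_children v" for w
    using that D(4) children_bounds[of w v] by auto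
  have SV: "sum_rep (ev v) (terms ?s - 1) (formula_size v * ?W) ?D"
  proof (rule path_end_reducible)
    show "reducible w" if "w \<in> gate_children v" "generic_degree w \<ge> 1" for w
      using IH[of w] ch[OF that(1)] that(2) D(8,12) by linarith
    show "q (formula_size w) \<noteq> q ?s" if "w \<in> gate_children v" "same_rank ?s ?d w" for w
      using that D(6) unfolding same_rank_def by blast
  qed (use D vpos in auto)
  let ?X = "vprod Ls \<otimes> ev v \<otimes> vprod Rs"
  have X: "?X \<in> carrier A" using D by (auto intro!: m_closed vprod_closed)
  have *: "sum_rep (ev u) (1 + (terms ?s - 1)) (cost (formula_size B) (generic_degree B) +
     (formula_size v * ?W + (terms ?s - 1) * (Z1 + Z2))) ?D"
    unfolding D(7) by (intro sum_rep_add SB sum_rep_sc sum_rep_sandwich Z1 Z2 SV D(2) X)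
  \<comment> \<open>Siblings occur both in \<open>B\<close> and in \<open>Ls\<close>,
    \<open>Rs\<close>. Each occurrence has been bounded by half of its share, so the inequality is
    doubled: \<open>B\<close> with \<open>v\<close>, and \<open>Ls\<close>, \<open>Rs\<close> with
    \<open>v\<close>, each have size at most \<open>s\<close>.\<close>
  have "2 * ((terms ?s - 1) * (Z1 + Z2)) \<le> 2 * (R * (Z1 + Z2))"
    using terms_le[of ?s] by (intro mult_left_mono mult_right_mono) auto
  also have "\<dots> = 2 * R * Z1 + 2 * R * Z2" by (simp add: distrib_left)
  also have "\<dots> \<le> vsizes Ls * ?W + vsizes Rs * ?W" using Z1 Z2 by (intro add_mono)
  finally have "2 * (cost (formula_size B) (generic_degree B) + (formula_size v * ?W + (terms ?s - 1) * (Z1 + Z2))) \<le>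
     formula_size B * ?W + 2 * (formula_size v * ?W) + (vsizes Ls * ?W + vsizes Rs * ?W)"
    using B by simp
  also have "\<dots> = ((formula_size B + formula_size v) + (vsizes Ls + vsizes Rs + formula_size v)) * ?W"
    by (simp add: algebra_simps)
  also have "\<dots> \<le> (?s + ?s) * ?W" using D(8,9) by (intro mult_right_mono add_mono) auto
  also have "(?s + ?s) * ?W = 2 * cost ?s ?d" unfolding cost_def by simp
  finally have "cost (formula_size B) (generic_degree B) + (formula_size v * ?W + (terms ?s - 1) * (Z1 + Z2)) \<le> cost ?s ?d"
    unfolding mult_le_cancel1 by simp
  then show ?case
    unfolding reducible_def using sum_rep_mono[OF * le_refl] terms_ge_2[OF s] by simp
qed

theorem depth_reduction:
  assumes "wf u"
  shows "\<exists>G. wf G \<and> ev G \<sqsubseteq> ev u \<and> formula_size G \<le> cost (formula_size u) (generic_degree u) \<and>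
     generic_depth G \<le> level (formula_size u) (generic_degree u) + 2"
  using gate_reducibleI[OF assms reducible_if_degree_pos[OF assms]] unfolding gate_rep_def .

end

section \<open>Polynomials and the monomials of parse trees\<close>

text \<open>Flattens the nested sums in the two bracketings of a triple convolution product.\<close>

lemma (in abelian_monoid) finsum_Sigma:
  assumes "finite X" "\<And>w. w \<in> X \<Longrightarrow> finite (Y w)" "\<And>w z. w \<in> X \<Longrightarrow> z \<in> Y w \<Longrightarrow> f w z \<in> carrier G"
  shows "(\<Oplus>w\<in>X. \<Oplus>z\<in>Y w. f w z) = (\<Oplus>t\<in>Sigma X Y. f (fst t) (snd t))"
  using assms
proof (induction X rule: finite_induct)
  case (insert a X)
  have split: "Sigma (insert a X) Y = Pair a ` Y a \<union> Sigma X Y" by auto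
  have "(\<Oplus>t\<in>Sigma (insert a X) Y. f (fst t) (snd t)) =
      (\<Oplus>t\<in>Pair a ` Y a. f (fst t) (snd t)) \<oplus> (\<Oplus>t\<in>Sigma X Y. f (fst t) (snd t))"
    unfolding split using insert by (intro finsum_Un_disjoint) auto
  also have "(\<Oplus>t\<in>Pair a ` Y a. f (fst t) (snd t)) = (\<Oplus>z\<in>Y a. f a z)"
    using insert by (subst finsum_reindex) (auto simp: inj_on_def)
  finally show ?case using insert by simp
qed simp

definition monomial_prod :: "('m, 'c) monoid_scheme \<Rightarrow> 'm set \<Rightarrow> 'm set \<Rightarrow> 'm set" where
  "monomial_prod M S T = {u \<otimes>\<^bsub>M\<^esub> v |u v. u \<in> S \<and> v \<in> T}"

text \<open>Edge constants are ignored, so cancellation is invisible here. The set is what the parse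
  trees contribute before summation.\<close>

fun parse_monomials :: "('m, 'c) monomials_scheme \<Rightarrow> 'a formula \<Rightarrow> 'm set" where
  "parse_monomials M One_Leaf = {\<one>\<^bsub>M\<^esub>}"
| "parse_monomials M (Var_Leaf i) = {indet M i}"
| "parse_monomials M (Plus_Gate cs) = (\<Union>(c, G) \<in> set cs. parse_monomials M G)"
| "parse_monomials M (Times_Gate cs) = foldr (\<lambda>(c, G) S. monomial_prod M (parse_monomials M G) S) cs {\<one>\<^bsub>M\<^esub>}"

text \<open>
  The value of a formula paired with its set of parse-tree monomials. Both components are
  transformed by the same semiring identities, so monotonicity is tracked along with the value.
\<close>

definition joint_ring :: "('a, 'b) ring_scheme \<Rightarrow> ('m, 'c) monomials_scheme \<Rightarrow> (('m \<Rightarrow> 'a) \<times> 'm set) ring" where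
  "joint_ring K M = \<lparr>carrier = {p. \<forall>m. p m \<in> carrier K} \<times> UNIV,
     monoid.mult = (\<lambda>p q. (fst p \<otimes>\<^bsub>poly_ring K M\<^esub> fst q, monomial_prod M (snd p) (snd q))),
     one = (\<one>\<^bsub>poly_ring K M\<^esub>, {\<one>\<^bsub>M\<^esub>}),
     zero = (\<zero>\<^bsub>poly_ring K M\<^esub>, {}),
     add = (\<lambda>p q. (fst p \<oplus>\<^bsub>poly_ring K M\<^esub> fst q, snd p \<union> snd q))\<rparr>"

definition joint_scale :: "('a, 'b) ring_scheme \<Rightarrow> 'a \<Rightarrow> ('m \<Rightarrow> 'a) \<times> 'm set \<Rightarrow> ('m \<Rightarrow> 'a) \<times> 'm set" where
  "joint_scale K c p = (poly_scale K c (fst p), snd p)"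

definition joint_var :: "('a, 'b) ring_scheme \<Rightarrow> ('m, 'c) monomials_scheme \<Rightarrow> nat \<Rightarrow> ('m \<Rightarrow> 'a) \<times> 'm set" where
  "joint_var K M i = (poly_var K M i, {indet M i})"

definition joint_le :: "('m \<Rightarrow> 'a) \<times> 'm set \<Rightarrow> ('m \<Rightarrow> 'a) \<times> 'm set \<Rightarrow> bool" where
  "joint_le p q \<longleftrightarrow> fst p = fst q \<and> snd p \<subseteq> snd q"

text \<open>The common ground of commutative and non-commutative monomials: finite factorizations
  make the convolution well behaved, additive degrees are what homogeneity rests on.\<close>

locale monomial_algebra = field K + M: monoid M
  for K :: "('a, 'b) ring_scheme" (structure) and M :: "('m, 'c) monomials_scheme" +
  assumes carrier_M [simp]: "carrier M = UNIV"
    and finite_factorizations: "finite {w. fst w \<otimes>\<^bsub>M\<^esub> snd w = m}"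
    and mdeg_mult: "mdeg M (u \<otimes>\<^bsub>M\<^esub> v) = mdeg M u + mdeg M v"
begin

abbreviation P :: "('m \<Rightarrow> 'a) ring" where "P \<equiv> poly_ring K M"
abbreviation poly :: "'a formula \<Rightarrow> 'm \<Rightarrow> 'a" where "poly \<equiv> formula_poly K M"
abbreviation pmonos :: "'a formula \<Rightarrow> 'm set" where "pmonos \<equiv> parse_monomials M"

section \<open>Arithmetic of coefficient functions\<close>

definition factorizations :: "'m \<Rightarrow> ('m \<times> 'm) set" where "factorizations m = {w. fst w \<otimes>\<^bsub>M\<^esub> snd w = m}"

lemma finite_factorizations_of [simp]: "finite (factorizations m)" unfolding factorizations_def by (rule finite_factorizations)

lemma mem_factorizations: "w \<in> factorizations m \<longleftrightarrow> fst w \<otimes>\<^bsub>M\<^esub> snd w = m" by (simp add: factorizations_def)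

text \<open>Larger than the carrier of \<open>poly_ring\<close>: with finite factorizations the
  convolution is a finite sum for arbitrary coefficient functions, so supports are not
  tracked.\<close>

definition coeffs :: "('m \<Rightarrow> 'a) set" where "coeffs = {p. \<forall>m. p m \<in> carrier K}"

lemma coeffs_closed [simp]: "p \<in> coeffs \<Longrightarrow> p m \<in> carrier K" by (simp add: coeffs_def)

lemma mult_eq: "(p \<otimes>\<^bsub>P\<^esub> q) m = (\<Oplus>w\<in>factorizations m. p (fst w) \<otimes> q (snd w))"
  by (simp add: poly_ring_def factorizations_def)

lemma add_eq: "(p \<oplus>\<^bsub>P\<^esub> q) m = p m \<oplus> q m" by (simp add: poly_ring_def)
lemma zero_eq: "\<zero>\<^bsub>P\<^esub> m = \<zero>" by (simp add: poly_ring_def)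
lemma one_eq: "\<one>\<^bsub>P\<^esub> m = (if m = \<one>\<^bsub>M\<^esub> then \<one> else \<zero>)" by (simp add: poly_ring_def)
lemma scale_eq: "poly_scale K c p m = c \<otimes> p m" by (simp add: poly_scale_def)

lemma mult_coeffs [simp]: "p \<in> coeffs \<Longrightarrow> q \<in> coeffs \<Longrightarrow> p \<otimes>\<^bsub>P\<^esub> q \<in> coeffs"
  unfolding coeffs_def by (auto simp: mult_eq intro!: finsum_closed)
lemma add_coeffs [simp]: "p \<in> coeffs \<Longrightarrow> q \<in> coeffs \<Longrightarrow> p \<oplus>\<^bsub>P\<^esub> q \<in> coeffs"
  unfolding coeffs_def by (auto simp: add_eq)
lemma zero_coeffs [simp]: "\<zero>\<^bsub>P\<^esub> \<in> coeffs" unfolding coeffs_def by (auto simp: zero_eq)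
lemma one_coeffs [simp]: "\<one>\<^bsub>P\<^esub> \<in> coeffs" unfolding coeffs_def by (auto simp: one_eq)
lemma scale_coeffs [simp]: "c \<in> carrier K \<Longrightarrow> p \<in> coeffs \<Longrightarrow> poly_scale K c p \<in> coeffs"
  unfolding coeffs_def by (auto simp: scale_eq)
lemma var_coeffs [simp]: "poly_var K M i \<in> coeffs" unfolding coeffs_def poly_var_def by auto

lemma mult_assoc:
  assumes "p \<in> coeffs" "q \<in> coeffs" "r \<in> coeffs"
  shows "p \<otimes>\<^bsub>P\<^esub> q \<otimes>\<^bsub>P\<^esub> r = p \<otimes>\<^bsub>P\<^esub> (q \<otimes>\<^bsub>P\<^esub> r)"
proof
  fix m
  define f where "f t = p (fst t) \<otimes> q (fst (snd t)) \<otimes> r (snd (snd t))" for t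
  have f: "f t \<in> carrier K" for t using assms by (simp add: f_def)
  \<comment> \<open>Both bracketings factor one factor of \<open>m\<close> again. \<open>?l\<close>
    and \<open>?r\<close> send such nested factorizations to triples, and the images agree by
    associativity in \<open>M\<close>.\<close>
  let ?l = "\<lambda>t :: ('m \<times> 'm) \<times> 'm \<times> 'm. (fst (snd t), snd (snd t), snd (fst t))"
  let ?r = "\<lambda>t :: ('m \<times> 'm) \<times> 'm \<times> 'm. (fst (fst t), snd t)"
  let ?L = "Sigma (factorizations m) (\<lambda>w. factorizations (fst w))" and ?R = "Sigma (factorizations m) (\<lambda>w. factorizations (snd w))"
  have "(p \<otimes>\<^bsub>P\<^esub> q \<otimes>\<^bsub>P\<^esub> r) m = (\<Oplus>w\<in>factorizations m. \<Oplus>z\<in>factorizations (fst w). f (fst z, snd z, snd w))"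
    unfolding mult_eq f_def using assms by (intro finsum_cong') (auto simp: finsum_ldistr)
  also have "\<dots> = finsum K (f \<circ> ?l) ?L"
    using f by (subst finsum_Sigma) (auto simp: comp_def)
  also have "\<dots> = finsum K f (?l ` ?L)"
    using f by (subst finsum_reindex) (auto simp: inj_on_def mem_factorizations comp_def)
  also have "?l ` ?L = ?r ` ?R"
  proof -
    have L: "t \<in> ?l ` ?L \<longleftrightarrow> fst t \<otimes>\<^bsub>M\<^esub> fst (snd t) \<otimes>\<^bsub>M\<^esub> snd (snd t) = m" for t
    proof
      assume "fst t \<otimes>\<^bsub>M\<^esub> fst (snd t) \<otimes>\<^bsub>M\<^esub> snd (snd t) = m"
      then show "t \<in> ?l ` ?L"
        by (intro image_eqI[of _ _ "((fst t \<otimes>\<^bsub>M\<^esub> fst (snd t), snd (snd t)), (fst t, fst (snd t)))"]) (auto simp: mem_factorizations)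
    qed (auto simp: mem_factorizations)
    have R: "t \<in> ?r ` ?R \<longleftrightarrow> fst t \<otimes>\<^bsub>M\<^esub> (fst (snd t) \<otimes>\<^bsub>M\<^esub> snd (snd t)) = m" for t
    proof
      assume "fst t \<otimes>\<^bsub>M\<^esub> (fst (snd t) \<otimes>\<^bsub>M\<^esub> snd (snd t)) = m"
      then show "t \<in> ?r ` ?R"
        by (intro image_eqI[of _ _ "((fst t, fst (snd t) \<otimes>\<^bsub>M\<^esub> snd (snd t)), snd t)"]) (auto simp: mem_factorizations)
    qed (auto simp: mem_factorizations)
    show ?thesis unfolding set_eq_iff L R by (simp add: M.m_assoc)
  qed
  also have "finsum K f (?r ` ?R) = finsum K (f \<circ> ?r) ?R"
    using f by (subst finsum_reindex) (auto simp: inj_on_def mem_factorizations comp_def)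
  also have "\<dots> = (\<Oplus>w\<in>factorizations m. \<Oplus>z\<in>factorizations (snd w). f (fst w, z))"
    using f by (subst finsum_Sigma) (auto simp: comp_def)
  also have "\<dots> = (p \<otimes>\<^bsub>P\<^esub> (q \<otimes>\<^bsub>P\<^esub> r)) m"
    unfolding mult_eq f_def using assms by (intro finsum_cong') (auto simp: finsum_rdistr m_assoc)
  finally show "(p \<otimes>\<^bsub>P\<^esub> q \<otimes>\<^bsub>P\<^esub> r) m = (p \<otimes>\<^bsub>P\<^esub> (q \<otimes>\<^bsub>P\<^esub> r)) m" .
qed

lemma finsum_only:
  assumes "finite X" "i \<in> X" "f i \<in> carrier K" "\<And>j. j \<in> X \<Longrightarrow> j \<noteq> i \<Longrightarrow> f j = \<zero>"
  shows "finsum K f X = f i"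
proof -
  have "finsum K f X = (\<Oplus>j\<in>X. if i = j then (\<lambda>_. f i) j else \<zero>)"
    using assms by (intro finsum_cong') (auto simp: eq_commute[of i])
  also have "\<dots> = f i" using assms by (subst finsum_singleton) auto
  finally show ?thesis .
qed

definition monomial :: "'a \<Rightarrow> 'm \<Rightarrow> 'm \<Rightarrow> 'a" where "monomial c m = (\<lambda>m'. if m' = m then c else \<zero>)"

lemma one_monomial: "\<one>\<^bsub>P\<^esub> = monomial \<one> \<one>\<^bsub>M\<^esub>"
  and var_monomial: "poly_var K M i = monomial \<one> (indet M i)"
  by (auto simp: monomial_def one_eq poly_var_def)

lemma scale_monomial: "c \<in> carrier K \<Longrightarrow> poly_scale K c (monomial d m) = monomial (c \<otimes> d) m"
  by (auto simp: monomial_def scale_eq)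

lemma monomial_mult:
  assumes "c \<in> carrier K" "d \<in> carrier K"
  shows "monomial c u \<otimes>\<^bsub>P\<^esub> monomial d v = monomial (c \<otimes> d) (u \<otimes>\<^bsub>M\<^esub> v)"
proof
  fix m
  show "(monomial c u \<otimes>\<^bsub>P\<^esub> monomial d v) m = monomial (c \<otimes> d) (u \<otimes>\<^bsub>M\<^esub> v) m"
  proof (cases "m = u \<otimes>\<^bsub>M\<^esub> v")
    case True
    have "(monomial c u \<otimes>\<^bsub>P\<^esub> monomial d v) m = monomial c u (fst (u, v)) \<otimes> monomial d v (snd (u, v))"
      unfolding mult_eq using assms True by (intro finsum_only) (auto simp: mem_factorizations monomial_def)
    then show ?thesis using True by (simp add: monomial_def)
  next
    case False
    have "(monomial c u \<otimes>\<^bsub>P\<^esub> monomial d v) m = (\<Oplus>w\<in>factorizations m. \<zero>)"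
      unfolding mult_eq using assms False by (intro finsum_cong') (auto simp: mem_factorizations monomial_def)
    then show ?thesis using False by (simp add: monomial_def)
  qed
qed

lemma one_mult: assumes "p \<in> coeffs" shows "\<one>\<^bsub>P\<^esub> \<otimes>\<^bsub>P\<^esub> p = p"
proof
  fix m
  have "(\<one>\<^bsub>P\<^esub> \<otimes>\<^bsub>P\<^esub> p) m = \<one>\<^bsub>P\<^esub> (fst (\<one>\<^bsub>M\<^esub>, m)) \<otimes> p (snd (\<one>\<^bsub>M\<^esub>, m))"
    unfolding mult_eq using assms by (intro finsum_only) (auto simp: mem_factorizations one_eq)
  then show "(\<one>\<^bsub>P\<^esub> \<otimes>\<^bsub>P\<^esub> p) m = p m" using assms by (simp add: one_eq)
qed

lemma mult_one: assumes "p \<in> coeffs" shows "p \<otimes>\<^bsub>P\<^esub> \<one>\<^bsub>P\<^esub> = p"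
proof
  fix m
  have "(p \<otimes>\<^bsub>P\<^esub> \<one>\<^bsub>P\<^esub>) m = p (fst (m, \<one>\<^bsub>M\<^esub>)) \<otimes> \<one>\<^bsub>P\<^esub> (snd (m, \<one>\<^bsub>M\<^esub>))"
    unfolding mult_eq using assms by (intro finsum_only) (auto simp: mem_factorizations one_eq)
  then show "(p \<otimes>\<^bsub>P\<^esub> \<one>\<^bsub>P\<^esub>) m = p m" using assms by (simp add: one_eq)
qed

lemma mult_nonzero_coeff:
  assumes "p \<in> coeffs" "q \<in> coeffs" "(p \<otimes>\<^bsub>P\<^esub> q) m \<noteq> \<zero>"
  shows "\<exists>u v. m = u \<otimes>\<^bsub>M\<^esub> v \<and> p u \<noteq> \<zero> \<and> q v \<noteq> \<zero>"
proof (rule ccontr)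
  assume none: "\<not> ?thesis"
  have "(p \<otimes>\<^bsub>P\<^esub> q) m = (\<Oplus>w\<in>factorizations m. \<zero>)"
    unfolding mult_eq
  proof (rule finsum_cong')
    fix w assume "w \<in> factorizations m"
    then have "p (fst w) = \<zero> \<or> q (snd w) = \<zero>" using none by (auto simp: mem_factorizations)
    then show "p (fst w) \<otimes> q (snd w) = \<zero>" using assms by auto
  qed auto
  then show False using assms by simp
qed

lemma mult_distrib:
  assumes "p \<in> coeffs" "q \<in> coeffs" "r \<in> coeffs"
  shows "(p \<oplus>\<^bsub>P\<^esub> q) \<otimes>\<^bsub>P\<^esub> r = p \<otimes>\<^bsub>P\<^esub> r \<oplus>\<^bsub>P\<^esub> q \<otimes>\<^bsub>P\<^esub> r"
    and "r \<otimes>\<^bsub>P\<^esub> (p \<oplus>\<^bsub>P\<^esub> q) = r \<otimes>\<^bsub>P\<^esub> p \<oplus>\<^bsub>P\<^esub> r \<otimes>\<^bsub>P\<^esub> q"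
proof -
  show "(p \<oplus>\<^bsub>P\<^esub> q) \<otimes>\<^bsub>P\<^esub> r = p \<otimes>\<^bsub>P\<^esub> r \<oplus>\<^bsub>P\<^esub> q \<otimes>\<^bsub>P\<^esub> r"
  proof
    fix m show "((p \<oplus>\<^bsub>P\<^esub> q) \<otimes>\<^bsub>P\<^esub> r) m = (p \<otimes>\<^bsub>P\<^esub> r \<oplus>\<^bsub>P\<^esub> q \<otimes>\<^bsub>P\<^esub> r) m"
      unfolding mult_eq add_eq using assms
      by (subst finsum_addf[symmetric]) (auto simp: l_distr intro!: finsum_cong')
  qed
  show "r \<otimes>\<^bsub>P\<^esub> (p \<oplus>\<^bsub>P\<^esub> q) = r \<otimes>\<^bsub>P\<^esub> p \<oplus>\<^bsub>P\<^esub> r \<otimes>\<^bsub>P\<^esub> q"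
  proof
    fix m show "(r \<otimes>\<^bsub>P\<^esub> (p \<oplus>\<^bsub>P\<^esub> q)) m = (r \<otimes>\<^bsub>P\<^esub> p \<oplus>\<^bsub>P\<^esub> r \<otimes>\<^bsub>P\<^esub> q) m"
      unfolding mult_eq add_eq using assms
      by (subst finsum_addf[symmetric]) (auto simp: r_distr intro!: finsum_cong')
  qed
qed

lemma zero_mult: "p \<in> coeffs \<Longrightarrow> \<zero>\<^bsub>P\<^esub> \<otimes>\<^bsub>P\<^esub> p = \<zero>\<^bsub>P\<^esub>" "p \<in> coeffs \<Longrightarrow> p \<otimes>\<^bsub>P\<^esub> \<zero>\<^bsub>P\<^esub> = \<zero>\<^bsub>P\<^esub>"
  by (auto simp: mult_eq zero_eq fun_eq_iff finsum_zero)

lemma scale_mult: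
  assumes "c \<in> carrier K" "p \<in> coeffs" "q \<in> coeffs"
  shows "poly_scale K c p \<otimes>\<^bsub>P\<^esub> q = poly_scale K c (p \<otimes>\<^bsub>P\<^esub> q)"
    and "p \<otimes>\<^bsub>P\<^esub> poly_scale K c q = poly_scale K c (p \<otimes>\<^bsub>P\<^esub> q)"
proof -
  show "poly_scale K c p \<otimes>\<^bsub>P\<^esub> q = poly_scale K c (p \<otimes>\<^bsub>P\<^esub> q)"
  proof
    fix m show "(poly_scale K c p \<otimes>\<^bsub>P\<^esub> q) m = poly_scale K c (p \<otimes>\<^bsub>P\<^esub> q) m"
      unfolding mult_eq scale_eq using assms
      by (subst finsum_rdistr) (auto simp: m_assoc intro!: finsum_cong')
  qed
  show "p \<otimes>\<^bsub>P\<^esub> poly_scale K c q = poly_scale K c (p \<otimes>\<^bsub>P\<^esub> q)"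
  proof
    fix m show "(p \<otimes>\<^bsub>P\<^esub> poly_scale K c q) m = poly_scale K c (p \<otimes>\<^bsub>P\<^esub> q) m"
      unfolding mult_eq scale_eq using assms
      by (subst finsum_rdistr) (auto simp: m_lcomm intro!: finsum_cong')
  qed
qed

lemma monomial_prod_laws:
  "monomial_prod M (monomial_prod M S T) U = monomial_prod M S (monomial_prod M T U)"
  "monomial_prod M {\<one>\<^bsub>M\<^esub>} S = S" "monomial_prod M S {\<one>\<^bsub>M\<^esub>} = S"
  "monomial_prod M {} S = {}" "monomial_prod M S {} = {}"
  "monomial_prod M (S \<union> T) U = monomial_prod M S U \<union> monomial_prod M T U"
  "monomial_prod M U (S \<union> T) = monomial_prod M U S \<union> monomial_prod M U T"
  "S \<subseteq> S' \<Longrightarrow> T \<subseteq> T' \<Longrightarrow> monomial_prod M S T \<subseteq> monomial_prod M S' T'"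
proof -
  show "monomial_prod M (monomial_prod M S T) U = monomial_prod M S (monomial_prod M T U)"
  proof -
    have "monomial_prod M (monomial_prod M S T) U = {u \<otimes>\<^bsub>M\<^esub> v \<otimes>\<^bsub>M\<^esub> w |u v w. u \<in> S \<and> v \<in> T \<and> w \<in> U}"
      unfolding monomial_prod_def by blast
    also have "\<dots> = {u \<otimes>\<^bsub>M\<^esub> (v \<otimes>\<^bsub>M\<^esub> w) |u v w. u \<in> S \<and> v \<in> T \<and> w \<in> U}"
      by (simp add: M.m_assoc)
    also have "\<dots> = monomial_prod M S (monomial_prod M T U)" unfolding monomial_prod_def by blast
    finally show ?thesis .
  qed
qed (auto simp: monomial_prod_def)

lemma joint_scalar_semiring:
  "scalar_semiring (joint_ring K M) K (joint_scale K) (joint_var K M) joint_le"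
proof -
  have cf: "{p. \<forall>m. p m \<in> carrier K} = coeffs" by (rule coeffs_def[symmetric])
  note J = joint_ring_def joint_scale_def joint_var_def joint_le_def cf
  have zero_add: "\<zero>\<^bsub>P\<^esub> \<oplus>\<^bsub>P\<^esub> p = p" if "p \<in> coeffs" for p
    using that by (auto simp: fun_eq_iff add_eq zero_eq)
  have add_comm: "p \<oplus>\<^bsub>P\<^esub> q = q \<oplus>\<^bsub>P\<^esub> p" if "p \<in> coeffs" "q \<in> coeffs" for p q
    using that by (auto simp: fun_eq_iff add_eq a_comm)
  have add_assoc: "p \<oplus>\<^bsub>P\<^esub> q \<oplus>\<^bsub>P\<^esub> r = p \<oplus>\<^bsub>P\<^esub> (q \<oplus>\<^bsub>P\<^esub> r)" if "p \<in> coeffs" "q \<in> coeffs" "r \<in> coeffs" for p q r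
    using that by (auto simp: fun_eq_iff add_eq a_assoc)
  have scale_one: "poly_scale K \<one> p = p" if "p \<in> coeffs" for p
    using that by (auto simp: fun_eq_iff scale_eq)
  have scale_zero: "poly_scale K c \<zero>\<^bsub>P\<^esub> = \<zero>\<^bsub>P\<^esub>" if "c \<in> carrier K" for c
    using that by (auto simp: fun_eq_iff scale_eq zero_eq)
  have scale_scale: "poly_scale K c (poly_scale K d p) = poly_scale K (c \<otimes> d) p"
     "poly_scale K c p \<oplus>\<^bsub>P\<^esub> poly_scale K d p = poly_scale K (c \<oplus> d) p"
    if "c \<in> carrier K" "d \<in> carrier K" "p \<in> coeffs" for c d p
    using that by (auto simp: fun_eq_iff scale_eq add_eq m_assoc l_distr)
  have scale_add: "poly_scale K c (p \<oplus>\<^bsub>P\<^esub> q) = poly_scale K c p \<oplus>\<^bsub>P\<^esub> poly_scale K c q"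
    if "c \<in> carrier K" "p \<in> coeffs" "q \<in> coeffs" for c p q
    using that by (auto simp: fun_eq_iff scale_eq add_eq r_distr)
  have "abelian_monoid (joint_ring K M)"
    by (rule abelian_monoidI) (simp_all add: J mem_Times_iff prod_eq_iff zero_add add_assoc Un_assoc, simp add: add_comm Un_commute)
  moreover have "monoid (joint_ring K M)"
    by (rule monoidI) (simp_all add: J mem_Times_iff prod_eq_iff mult_assoc one_mult mult_one monomial_prod_laws(1-3))
  ultimately have "semiring (joint_ring K M)"
    by (intro semiring.intro semiring_axioms.intro)
      (simp_all add: J mem_Times_iff prod_eq_iff mult_distrib zero_mult monomial_prod_laws(4-7))
  moreover have "scalar_semiring_axioms (joint_ring K M) K (joint_scale K) (joint_var K M) joint_le"
  \<comment> \<open>The goals 11 to 13 are transitivity of the order and monotonicity of addition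
    and multiplication.\<close>
  proof (rule scalar_semiring_axioms.intro, goal_cases)
    case 11
    then show ?case by (simp add: J) blast
  next
    case 12
    then show ?case by (simp add: J) blast
  next
    case 13
    then show ?case by (simp add: J monomial_prod_laws(8))
  qed (simp_all add: J mem_Times_iff prod_eq_iff scale_one scale_zero scale_scale scale_add scale_mult)
  ultimately show ?thesis by (intro scalar_semiring.intro is_cring)
qed

lemma joint_ops:
  "p \<oplus>\<^bsub>joint_ring K M\<^esub> q = (fst p \<oplus>\<^bsub>P\<^esub> fst q, snd p \<union> snd q)"
  "p \<otimes>\<^bsub>joint_ring K M\<^esub> q = (fst p \<otimes>\<^bsub>P\<^esub> fst q, monomial_prod M (snd p) (snd q))"
  "\<zero>\<^bsub>joint_ring K M\<^esub> = (\<zero>\<^bsub>P\<^esub>, {})" "\<one>\<^bsub>joint_ring K M\<^esub> = (\<one>\<^bsub>P\<^esub>, {\<one>\<^bsub>M\<^esub>})"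
  by (simp_all add: joint_ring_def)

lemma joint_value:
  "formula_value (joint_ring K M) (joint_scale K) (joint_var K M) G = (poly G, pmonos G)"
proof (induction G)
  case (Plus_Gate cs)
  then have "\<forall>(c, G) \<in> set cs. formula_value (joint_ring K M) (joint_scale K) (joint_var K M) G = (poly G, pmonos G)"
    by fastforce
  then show ?case by (induction cs) (auto simp: joint_ops joint_scale_def)
next
  case (Times_Gate cs)
  then have "\<forall>(c, G) \<in> set cs. formula_value (joint_ring K M) (joint_scale K) (joint_var K M) G = (poly G, pmonos G)"
    by fastforce
  then show ?case by (induction cs) (auto simp: joint_ops joint_scale_def)
qed (auto simp: joint_ops joint_var_def)

lemma poly_coeffs: "generic_formula K n G \<Longrightarrow> poly G \<in> coeffs"
proof (induction G)
  case (Plus_Gate cs)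
  have "\<forall>(c, G) \<in> set cs. c \<in> carrier K \<and> poly G \<in> coeffs" using Plus_Gate by fastforce
  then show ?case by (induction cs) auto
next
  case (Times_Gate cs)
  have "\<forall>(c, G) \<in> set cs. c \<in> carrier K \<and> poly G \<in> coeffs" using Times_Gate by fastforce
  then show ?case by (induction cs) auto
qed auto

text \<open>Summation over parse trees can only cancel monomials, never create them.\<close>

lemma poly_support: "generic_formula K n G \<Longrightarrow> poly G m \<noteq> \<zero> \<Longrightarrow> m \<in> pmonos G"
proof (induction G arbitrary: m)
  case (Plus_Gate cs)
  then show ?case
  proof (induction cs)
    case (Cons cG cs)
    obtain c G where [simp]: "cG = (c, G)" by force
    have "c \<in> carrier K" "poly G \<in> coeffs" "poly (Plus_Gate cs) \<in> coeffs"
      using Cons.prems(2) by (auto intro!: poly_coeffs simp del: formula_poly.simps)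
    have "c \<otimes> poly G m \<oplus> poly (Plus_Gate cs) m \<noteq> \<zero>"
      using Cons.prems(3) by (simp add: add_eq scale_eq)
    then consider "poly G m \<noteq> \<zero>" | "poly (Plus_Gate cs) m \<noteq> \<zero>" using \<open>c \<in> carrier K\<close> by fastforce
    then show ?case
    proof cases
      case 1
      then show ?thesis using Cons.prems(1)[of "(c, G)" G] Cons.prems(2) by auto
    next
      case 2
      have "m \<in> pmonos (Plus_Gate cs)"
        by (rule Cons.IH[OF _ _ 2]) (use Cons.prems(1,2) in \<open>auto simp del: formula_poly.simps\<close>)
      then show ?thesis by simp
    qed
  qed (simp add: zero_eq)
next
  case (Times_Gate cs)
  have IH: "\<forall>(c, G) \<in> set cs. c \<in> carrier K \<and> poly G \<in> coeffs \<and> (\<forall>m. poly G m \<noteq> \<zero> \<longrightarrow> m \<in> pmonos G)"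
    using Times_Gate.IH Times_Gate.prems(1) poly_coeffs by fastforce
  from IH Times_Gate.prems(2) show ?case
  proof (induction cs arbitrary: m)
    case Nil
    then show ?case by (auto simp: one_eq split: if_splits)
  next
    case (Cons cG cs)
    obtain c G where [simp]: "cG = (c, G)" by force
    have tc: "poly (Times_Gate cs) \<in> coeffs" using Cons.prems(1) by (induction cs) auto
    have c: "c \<in> carrier K" "poly G \<in> coeffs" using Cons.prems(1) by auto
    have "(poly_scale K c (poly G) \<otimes>\<^bsub>P\<^esub> poly (Times_Gate cs)) m \<noteq> \<zero>" using Cons.prems(2) by simp
    then obtain u v where uv: "m = u \<otimes>\<^bsub>M\<^esub> v" "poly_scale K c (poly G) u \<noteq> \<zero>" "poly (Times_Gate cs) v \<noteq> \<zero>"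
      using mult_nonzero_coeff[OF scale_coeffs[OF c] tc] by blast
    have "u \<in> pmonos G" using uv(2) c Cons.prems(1) by (cases "poly G u = \<zero>") (auto simp: scale_eq)
    moreover have "v \<in> pmonos (Times_Gate cs)" using Cons.IH[OF _ uv(3)] Cons.prems(1) by simp
    ultimately show ?case using uv(1) by (auto simp: monomial_prod_def)
  qed
qed (auto simp: one_eq poly_var_def split: if_splits)

end

section \<open>Parse trees, monotonicity and homogeneity\<close>

lemma parse_tree_alg: "parse_tree T G \<Longrightarrow> alg_formula R n G \<Longrightarrow> alg_formula R n T"
proof (induction rule: parse_tree.induct)
  case (4 ts cs)
  from 4(1) have "(\<forall>(c, G) \<in> set cs. c \<in> carrier R - {\<zero>\<^bsub>R\<^esub>} \<and> alg_formula R n G) \<longrightarrow>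
     (\<forall>(c, T) \<in> set ts. c \<in> carrier R - {\<zero>\<^bsub>R\<^esub>} \<and> alg_formula R n T)"
  proof (induction rule: list_all2_induct)
    case (Cons t ts g cs)
    then show ?case by (cases t; cases g) auto
  qed simp
  moreover have "ts \<noteq> []" using 4 by auto
  ultimately show ?case using 4(2) by simp
qed auto

lemma alg_formula_size_pos: "alg_formula R n G \<Longrightarrow> 1 \<le> formula_size G"
proof (induction G)
  case (Plus_Gate cs)
  then show ?case by (cases cs) fastforce+
next
  case (Times_Gate cs)
  then show ?case by (cases cs) fastforce+
qed auto

context monomial_algebra begin

lemma parse_tree_monomials: "parse_tree T G \<Longrightarrow> pmonos T \<subseteq> pmonos G"
proof (induction rule: parse_tree.induct)
  case (4 ts cs)
  then show ?case
  proof (induction rule: list_all2_induct)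
    case (Cons t ts g cs)
    then show ?case using monomial_prod_laws(8) by (cases t; cases g) simp
  qed simp
qed auto

text \<open>Edge constants are nonzero and a field has no zero divisors, so the choices that put
  \<open>m\<close> into the set also yield a parse tree in which it survives.\<close>

lemma parse_tree_of_monomial:
  "alg_formula K n G \<Longrightarrow> m \<in> pmonos G \<Longrightarrow>
   \<exists>T c. parse_tree T G \<and> c \<in> carrier K - {\<zero>} \<and> poly T = monomial c m"
proof (induction G arbitrary: m)
  case One_Leaf
  then show ?case using parse_tree.intros(1) one_monomial by (auto intro!: exI[of _ One_Leaf])
next
  case (Var_Leaf i)
  then show ?case using parse_tree.intros(2) var_monomial by (auto intro!: exI[of _ "Var_Leaf i"])
next
  case (Plus_Gate cs)
  then obtain c G where G: "(c, G) \<in> set cs" "m \<in> pmonos G" "alg_formula K n G" "c \<in> carrier K - {\<zero>}" by fastforce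
  then obtain T d where T: "parse_tree T G" "d \<in> carrier K - {\<zero>}" "poly T = monomial d m"
    using Plus_Gate.IH[of "(c, G)" G] by fastforce
  have "poly (Plus_Gate [(c, T)]) = monomial (c \<otimes> d) m"
    using G(4) T(2) by (auto simp: T(3) scale_eq add_eq zero_eq fun_eq_iff monomial_def)
  then show ?case using parse_tree.intros(3)[OF G(1) T(1)] G(4) T(2) integral_iff
    by (intro exI[of _ "Plus_Gate [(c, T)]"] exI[of _ "c \<otimes> d"]) auto
next
  case (Times_Gate cs)
  have "\<forall>(c, G) \<in> set cs. c \<in> carrier K - {\<zero>} \<and>
      (\<forall>m \<in> pmonos G. \<exists>T d. parse_tree T G \<and> d \<in> carrier K - {\<zero>} \<and> poly T = monomial d m)"
    using Times_Gate.IH Times_Gate.prems(1) by fastforce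
  from this Times_Gate.prems(2) have "\<exists>ts c. list_all2 (rel_prod (=) parse_tree) ts cs \<and> c \<in> carrier K - {\<zero>} \<and>
      poly (Times_Gate ts) = monomial c m"
  proof (induction cs arbitrary: m)
    case Nil
    then show ?case by (intro exI[of _ "[]"] exI[of _ \<one>]) (simp add: one_monomial)
  next
    case (Cons cG cs)
    obtain c G where cG: "cG = (c, G)" by force
    obtain u v where uv: "m = u \<otimes>\<^bsub>M\<^esub> v" "u \<in> pmonos G" "v \<in> pmonos (Times_Gate cs)"
      using Cons.prems(2) unfolding cG by (auto simp: monomial_prod_def)
    have c: "c \<in> carrier K - {\<zero>}" using Cons.prems(1) cG by auto
    obtain T d where T: "parse_tree T G" "d \<in> carrier K - {\<zero>}" "poly T = monomial d u"
      using Cons.prems(1) cG uv(2) by auto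
    have "\<forall>(c, G) \<in> set cs. c \<in> carrier K - {\<zero>} \<and>
      (\<forall>m \<in> pmonos G. \<exists>T d. parse_tree T G \<and> d \<in> carrier K - {\<zero>} \<and> poly T = monomial d m)"
      using Cons.prems(1) by simp
    then obtain ts e where ts: "list_all2 (rel_prod (=) parse_tree) ts cs" "e \<in> carrier K - {\<zero>}"
      "poly (Times_Gate ts) = monomial e v"
      using Cons.IH uv(3) by blast
    have "poly (Times_Gate ((c, T) # ts)) = poly_scale K c (poly T) \<otimes>\<^bsub>P\<^esub> poly (Times_Gate ts)" by simp
    also have "\<dots> = poly_scale K c (monomial d u) \<otimes>\<^bsub>P\<^esub> monomial e v" by (simp only: T(3) ts(3))
    also have "\<dots> = monomial (c \<otimes> d \<otimes> e) m"
      using c T(2) ts(2) by (simp add: scale_monomial monomial_mult uv(1))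
    finally show ?case using ts(1,2) T(1,2) c cG integral_iff
      by (intro exI[of _ "(c, T) # ts"] exI[of _ "c \<otimes> d \<otimes> e"]) (auto simp del: formula_poly.simps)
  qed
  then show ?case using parse_tree.intros(4) by blast
qed

text \<open>Together with \<open>poly_support\<close> this says that no monomial cancels. In this
  form monotonicity passes to every formula with the same polynomial and fewer parse-tree
  monomials.\<close>

lemma monotone_formula_iff:
  assumes "alg_formula K n G"
  shows "monotone_formula K M G \<longleftrightarrow> (\<forall>m \<in> pmonos G. poly G m \<noteq> \<zero>)"
proof
  assume mono: "monotone_formula K M G"
  show "\<forall>m \<in> pmonos G. poly G m \<noteq> \<zero>"
  proof
    fix m assume "m \<in> pmonos G"
    then obtain T c where T: "parse_tree T G" "c \<noteq> \<zero>" "poly T = monomial c m"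
      using parse_tree_of_monomial[OF assms] by blast
    have "poly T m \<noteq> \<zero>" using T(2,3) by (simp add: monomial_def)
    then show "poly G m \<noteq> \<zero>" using mono T(1) unfolding monotone_formula_def by blast
  qed
next
  assume "\<forall>m \<in> pmonos G. poly G m \<noteq> \<zero>"
  then show "monotone_formula K M G"
    unfolding monotone_formula_def
    using parse_tree_monomials poly_support[OF generic_formula_of_alg[OF parse_tree_alg[OF _ assms]]] by blast
qed

lemma pmonos_nonempty: "alg_formula K n G \<Longrightarrow> pmonos G \<noteq> {}"
proof (induction G)
  case (Plus_Gate cs)
  then show ?case by (cases cs) fastforce+
next
  case (Times_Gate cs)
  have "\<forall>(c, G) \<in> set cs. pmonos G \<noteq> {}" using Times_Gate by fastforce
  then show ?case by (induction cs) (auto simp: monomial_prod_def)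
qed auto

text \<open>In a product, fix one monomial of each other factor. As degrees are additive, a single
  degree of the product then forces a single degree of the remaining factor.\<close>

lemma subformulas_single_degree:
  "alg_formula K n G \<Longrightarrow> \<forall>m \<in> pmonos G. mdeg M m = k \<Longrightarrow> H \<in> subformulas G \<Longrightarrow>
   alg_formula K n H \<and> (\<exists>k. \<forall>m \<in> pmonos H. mdeg M m = k)"
proof (induction G arbitrary: k)
  case (Plus_Gate cs)
  consider "H = Plus_Gate cs" | c G where "(c, G) \<in> set cs" "H \<in> subformulas G" using Plus_Gate.prems(3) by auto
  then show ?case
  proof cases
    case 2
    have "alg_formula K n G" "\<forall>m \<in> pmonos G. mdeg M m = k" using Plus_Gate.prems 2 by auto
    then show ?thesis using Plus_Gate.IH[OF 2(1) _ _ _ 2(2)] by auto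
  qed (use Plus_Gate.prems in blast)
next
  case (Times_Gate cs)
  consider "H = Times_Gate cs" | c G where "(c, G) \<in> set cs" "H \<in> subformulas G" using Times_Gate.prems(3) by auto
  then show ?case
  proof cases
    case 2
    have ne: "\<forall>(c, G) \<in> set cs. pmonos G \<noteq> {}" using Times_Gate.prems(1) pmonos_nonempty by fastforce
    \<comment> \<open>\<open>a\<close> is the total degree of the monomials chosen from the other
      factors; \<open>pmonos_nonempty\<close> provides them.\<close>
    have "\<exists>a. \<forall>u \<in> pmonos G. \<exists>m \<in> pmonos (Times_Gate cs). mdeg M m = mdeg M u + a"
      using ne 2(1)
    proof (induction cs)
      case (Cons dH cs)
      obtain d H where dH: "dH = (d, H)" by force
      have "pmonos (Times_Gate cs) \<noteq> {}" using Cons.prems(1) by (induction cs) (auto simp: monomial_prod_def)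
      then obtain v where v: "v \<in> pmonos (Times_Gate cs)" by blast
      show ?case
      proof (cases "dH = (c, G)")
        case True
        then have "\<exists>m \<in> pmonos (Times_Gate (dH # cs)). mdeg M m = mdeg M u + mdeg M v" if "u \<in> pmonos G" for u
          using v that by (intro bexI[of _ "u \<otimes>\<^bsub>M\<^esub> v"]) (auto simp: monomial_prod_def mdeg_mult)
        then show ?thesis by blast
      next
        case False
        then obtain a where a: "\<forall>u \<in> pmonos G. \<exists>m \<in> pmonos (Times_Gate cs). mdeg M m = mdeg M u + a"
          using Cons by auto
        obtain w where w: "w \<in> pmonos H" using Cons.prems(1) dH by auto
        have "\<exists>m \<in> pmonos (Times_Gate (dH # cs)). mdeg M m = mdeg M u + (mdeg M w + a)" if u: "u \<in> pmonos G" for u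
        proof -
          obtain m where "m \<in> pmonos (Times_Gate cs)" "mdeg M m = mdeg M u + a" using a u by blast
          then show ?thesis using w dH
            by (intro bexI[of _ "w \<otimes>\<^bsub>M\<^esub> m"]) (auto simp: monomial_prod_def mdeg_mult)
        qed
        then show ?thesis by blast
      qed
    qed simp
    then obtain a where a: "\<forall>u \<in> pmonos G. \<exists>m \<in> pmonos (Times_Gate cs). mdeg M m = mdeg M u + a" by blast
    have "\<forall>u \<in> pmonos G. mdeg M u = k - a" using a Times_Gate.prems(2) by fastforce
    moreover have "alg_formula K n G" using Times_Gate.prems(1) 2(1) by auto
    ultimately show ?thesis using Times_Gate.IH[OF 2(1), of G "k - a"] 2(2) by simp
  qed (use Times_Gate.prems in blast)
qed auto

lemma homogeneous_if_single_degree: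
  assumes "alg_formula K n G" "\<forall>m \<in> pmonos G. mdeg M m = k"
  shows "homogeneous_formula K M G"
  unfolding homogeneous_formula_def homogeneous_poly_def
proof
  fix H assume "H \<in> subformulas G"
  from subformulas_single_degree[OF assms this] obtain k where k: "alg_formula K n H" "\<forall>m \<in> pmonos H. mdeg M m = k" by blast
  then show "\<exists>k. \<forall>m. poly H m \<noteq> \<zero> \<longrightarrow> mdeg M m = k" using poly_support generic_formula_of_alg by blast
qed

text \<open>Such a formula is a chain of unary gates above one leaf. Hence a formula for zero has
  size at least 2, which leaves room for \<open>\<one> \<oplus> \<ominus> \<one>\<close>.\<close>

lemma poly_size_one_nonzero:
  "alg_formula K n G \<Longrightarrow> formula_size G \<le> 1 \<Longrightarrow> \<exists>c m. c \<in> carrier K - {\<zero>} \<and> poly G = monomial c m"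
proof (induction G)
  case One_Leaf
  then show ?case using one_monomial by auto
next
  case (Var_Leaf i)
  then show ?case using var_monomial by auto
next
  case (Plus_Gate cs)
  obtain c G ds where cs: "cs = (c, G) # ds" using Plus_Gate.prems(1) by (cases cs) auto
  have c: "c \<in> carrier K - {\<zero>}" "alg_formula K n G" using Plus_Gate.prems(1) cs by auto
  have "ds = []"
  proof (rule ccontr)
    assume "ds \<noteq> []"
    then obtain e H es where ds: "ds = (e, H) # es" by (cases ds) auto
    then have "1 \<le> formula_size G" "1 \<le> formula_size H"
      using alg_formula_size_pos[of K n] Plus_Gate.prems(1) cs by auto
    then show False using Plus_Gate.prems(2) cs ds by simp
  qed
  obtain d m where d: "d \<in> carrier K - {\<zero>}" "poly G = monomial d m"
    using Plus_Gate.IH[of "(c, G)" G] Plus_Gate.prems(2) c(2) cs by fastforce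
  have "poly (Plus_Gate cs) = monomial (c \<otimes> d) m"
    using c(1) d by (auto simp: cs \<open>ds = []\<close> scale_eq add_eq zero_eq fun_eq_iff monomial_def)
  then show ?case using c d integral_iff by auto
next
  case (Times_Gate cs)
  obtain c G ds where cs: "cs = (c, G) # ds" using Times_Gate.prems(1) by (cases cs) auto
  have c: "c \<in> carrier K - {\<zero>}" "alg_formula K n G" using Times_Gate.prems(1) cs by auto
  have "ds = []"
  proof (rule ccontr)
    assume "ds \<noteq> []"
    then obtain e H es where ds: "ds = (e, H) # es" by (cases ds) auto
    then have "1 \<le> formula_size G" "1 \<le> formula_size H"
      using alg_formula_size_pos[of K n] Times_Gate.prems(1) cs by auto
    then show False using Times_Gate.prems(2) cs ds by simp
  qed
  obtain d m where d: "d \<in> carrier K - {\<zero>}" "poly G = monomial d m"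
    using Times_Gate.IH[of "(c, G)" G] Times_Gate.prems(2) c(2) cs by fastforce
  have "poly (Times_Gate cs) = monomial (c \<otimes> d) m"
    using c(1) d by (simp add: cs \<open>ds = []\<close> scale_monomial one_monomial monomial_mult)
  then show ?case using c d integral_iff by auto
qed

text \<open>
  The children of a \<open>+\<close>-gate of a homogeneous formula may have different degrees, provided that
  those of the wrong degree cancel. Removing these as well as the zero gates leaves a formula whose
  parse trees all have the same degree, and this property passes to every formula derived from it.
\<close>

definition prunes :: "nat \<Rightarrow> bool \<Rightarrow> 'a formula \<Rightarrow> 'a formula \<Rightarrow> bool" where
  "prunes n h G G' \<longleftrightarrow> alg_formula K n G' \<and> poly G' = poly G \<and> formula_size G' \<le> formula_size G \<and>
     generic_depth G' \<le> generic_depth G \<and> generic_degree G' \<le> generic_degree G \<and> pmonos G' \<subseteq> pmonos G \<and>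
     (h \<longrightarrow> (\<exists>k. \<forall>m \<in> pmonos G'. mdeg M m = k))"

text \<open>Lets pruning descend into the factors of a product that does not vanish.\<close>

lemma factors_nonzero:
  "\<forall>(c, H) \<in> set cs. c \<in> carrier K \<and> poly H \<in> coeffs \<Longrightarrow> poly (Times_Gate cs) m \<noteq> \<zero> \<Longrightarrow>
   \<forall>(c, H) \<in> set cs. c \<noteq> \<zero> \<and> (\<exists>m. poly H m \<noteq> \<zero>)"
proof (induction cs arbitrary: m)
  case (Cons cH cs)
  obtain c H where cH: "cH = (c, H)" by force
  have c: "c \<in> carrier K" "poly H \<in> coeffs" using Cons.prems(1) cH by auto
  have tc: "poly (Times_Gate cs) \<in> coeffs" using Cons.prems(1) by (induction cs) auto
  have "(poly_scale K c (poly H) \<otimes>\<^bsub>P\<^esub> poly (Times_Gate cs)) m \<noteq> \<zero>" using Cons.prems(2) cH by simp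
  then obtain u v where uv: "poly_scale K c (poly H) u \<noteq> \<zero>" "poly (Times_Gate cs) v \<noteq> \<zero>"
    using mult_nonzero_coeff[OF scale_coeffs[OF c] tc] by blast
  have "c \<noteq> \<zero>" "poly H u \<noteq> \<zero>" using uv(1) c by (auto simp: scale_eq)
  then show ?case using Cons.IH[OF _ uv(2)] Cons.prems(1) cH by auto
qed simp

text \<open>The nonzero coefficient at \<open>m\<close> ensures that no sum becomes empty. With
  \<open>h\<close> false only zero gates and zero edges disappear.\<close>

lemma prune:
  assumes "generic_formula K n G" "poly G m \<noteq> \<zero>" "h \<Longrightarrow> homogeneous_formula K M G"
  shows "\<exists>G'. prunes n h G G'"
  using assms
proof (induction G arbitrary: m)
  case One_Leaf
  then show ?case by (intro exI[of _ One_Leaf]) (auto simp: prunes_def)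
next
  case (Var_Leaf i)
  then show ?case by (intro exI[of _ "Var_Leaf i"]) (auto simp: prunes_def)
next
  case (Plus_Gate cs)
  \<comment> \<open>Under \<open>h\<close> the degree of the gate is that of \<open>m\<close>; a
    child stays if it is nonzero in this degree.\<close>
  define keep where "keep = (\<lambda>(c, H). c \<noteq> \<zero> \<and> (\<exists>m'. poly H m' \<noteq> \<zero> \<and> (h \<longrightarrow> mdeg M m' = mdeg M m)))"
  have hom: "homogeneous_formula K M H" if "h" "(c, H) \<in> set cs" for c H
    using Plus_Gate.prems(3) that unfolding homogeneous_formula_def by fastforce
  have self: "G \<in> subformulas G" for G :: "'a formula" by (cases G) auto
  have hdeg: "mdeg M m' = mdeg M m" if "h" "poly (Plus_Gate cs) m' \<noteq> \<zero>" for m'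
    using Plus_Gate.prems(3)[OF that(1)] that(2) Plus_Gate.prems(2) self
    unfolding homogeneous_formula_def homogeneous_poly_def by metis
  have hdeg': "mdeg M m' = mdeg M m" if "h" "(c, H) \<in> set cs" "keep (c, H)" "poly H m' \<noteq> \<zero>" for c H m'
    using hom[OF that(1,2)] that(1,3,4) self unfolding homogeneous_formula_def homogeneous_poly_def keep_def by fastforce
  have wf: "c \<in> carrier K" "generic_formula K n H" "poly H \<in> coeffs" if "(c, H) \<in> set cs" for c H
    using Plus_Gate.prems(1) that poly_coeffs by fastforce+
  have ex: "\<exists>H'. prunes n h H H'" if "(c, H) \<in> set cs" "keep (c, H)" for c H
    using Plus_Gate.IH[OF that(1), of H] wf[OF that(1)] hom[OF _ that(1)] that(2) unfolding keep_def by auto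
  define f where "f H = (SOME H'. prunes n h H H')" for H
  have f: "prunes n h H (f H)" if "(c, H) \<in> set cs" "keep (c, H)" for c H
    unfolding f_def using ex[OF that] by (rule someI_ex)
  define ds where "ds = map (\<lambda>(c, H). (c, f H)) (filter keep cs)"
  have ds: "\<exists>H. (c, H) \<in> set cs \<and> keep (c, H) \<and> H' = f H" if "(c, H') \<in> set ds" for c H'
    using that unfolding ds_def by auto
  have coeff: "poly (Plus_Gate es) m' = foldr (\<lambda>(c, H) a. c \<otimes> poly H m' \<oplus> a) es \<zero>" for es m'
    by (induction es) (auto simp: add_eq scale_eq zero_eq)
  have "poly (Plus_Gate ds) m' = poly (Plus_Gate cs) m'" for m'
  \<comment> \<open>In the degree of \<open>m\<close> the dropped children contribute nothing. In
    every other degree the old sum is zero by homogeneity, and so is every child that was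
    kept.\<close>
  proof (cases "h \<longrightarrow> mdeg M m' = mdeg M m")
    case True
    have "foldr (\<lambda>(c, H) a. c \<otimes> poly H m' \<oplus> a) (map (\<lambda>(c, H). (c, f H)) (filter keep es)) \<zero> =
        foldr (\<lambda>(c, H) a. c \<otimes> poly H m' \<oplus> a) es \<zero> \<and>
        foldr (\<lambda>(c, H) a. c \<otimes> poly H m' \<oplus> a) es \<zero> \<in> carrier K" if "set es \<subseteq> set cs" for es
      using that
    proof (induction es)
      case (Cons cH es)
      obtain c H where cH: "cH = (c, H)" by force
      have cHs: "(c, H) \<in> set cs" using Cons.prems cH by simp
      show ?case
      proof (cases "keep (c, H)")
        case True
        then show ?thesis using Cons wf[OF cHs] f[OF cHs] cH by (simp add: prunes_def)
      next
        case False
        then have "c = \<zero> \<or> poly H m' = \<zero>" using \<open>h \<longrightarrow> mdeg M m' = mdeg M m\<close> unfolding keep_def by blast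
        then have "c \<otimes> poly H m' = \<zero>" using wf[OF cHs] by auto
        then show ?thesis using Cons wf[OF cHs] False cH by simp
      qed
    qed simp
    then show ?thesis unfolding coeff ds_def by blast
  next
    case False
    then have "poly (Plus_Gate cs) m' = \<zero>" using hdeg by blast
    moreover have "foldr (\<lambda>(c, H) a. c \<otimes> poly H m' \<oplus> a) es \<zero> = \<zero>" if "set es \<subseteq> set ds" for es
      using that
    proof (induction es)
      case (Cons cH es)
      obtain c H where cH: "cH = (c, H)" by force
      then obtain H0 where H0: "(c, H0) \<in> set cs" "keep (c, H0)" "H = f H0" using ds[of c H] Cons.prems by auto
      have "poly H m' = poly H0 m'" using f[OF H0(1,2)] H0(3) by (simp add: prunes_def)
      moreover have "poly H0 m' = \<zero>" using hdeg'[OF _ H0(1,2)] False by blast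
      ultimately show ?case using Cons wf[OF H0(1)] cH by simp
    qed simp
    ultimately show ?thesis unfolding coeff by auto
  qed
  then have eq: "poly (Plus_Gate ds) = poly (Plus_Gate cs)" by blast
  have "ds \<noteq> []" using fun_cong[OF eq, of m] Plus_Gate.prems(2) by (auto simp: zero_eq)
  have child: "alg_formula K n H'" "generic_depth H' < generic_depth (Plus_Gate cs)"
     "generic_degree H' \<le> generic_degree (Plus_Gate cs)" "pmonos H' \<subseteq> pmonos (Plus_Gate cs)"
     "c \<in> carrier K - {\<zero>}" "h \<Longrightarrow> \<forall>m' \<in> pmonos H'. mdeg M m' = mdeg M m" if mem: "(c, H') \<in> set ds" for c H'
  proof -
    obtain H where H: "(c, H) \<in> set cs" "keep (c, H)" "H' = f H" using ds[OF mem] by blast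
    note p = f[OF H(1,2), folded H(3), unfolded prunes_def]
    have "generic_depth H < generic_depth (Plus_Gate cs)" "generic_degree H \<le> generic_degree (Plus_Gate cs)"
      using H(1) by (auto intro!: Max_ge simp: less_Suc_eq_le)
    then show "generic_depth H' < generic_depth (Plus_Gate cs)" "generic_degree H' \<le> generic_degree (Plus_Gate cs)"
      using p by (meson le_less_trans order_trans)+
    show "alg_formula K n H'" using p by blast
    show "pmonos H' \<subseteq> pmonos (Plus_Gate cs)" using p H(1) by auto
    show "c \<in> carrier K - {\<zero>}" using wf[OF H(1)] H(2) by (auto simp: keep_def)
    assume h
    obtain m' where m': "poly H m' \<noteq> \<zero>" "mdeg M m' = mdeg M m" using H(2) \<open>h\<close> by (auto simp: keep_def)
    obtain k where "\<forall>m \<in> pmonos H'. mdeg M m = k" using p \<open>h\<close> by blast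
    \<comment> \<open>The monomial \<open>m'\<close> survives the pruning of \<open>H\<close> and so
      identifies the single degree of \<open>H'\<close> as that of \<open>m\<close>.\<close>
    moreover have "m' \<in> pmonos H'" using poly_support[OF generic_formula_of_alg] p m' by metis
    ultimately show "\<forall>m' \<in> pmonos H'. mdeg M m' = mdeg M m" using m'(2) by auto
  qed
  have "formula_size (Plus_Gate ds) \<le> formula_size (Plus_Gate cs)"
  proof -
    have "(\<Sum>(c, H) \<leftarrow> map (\<lambda>(c, H). (c, f H)) (filter keep es). formula_size H) \<le> (\<Sum>(c, H) \<leftarrow> es. formula_size H)"
      if "set es \<subseteq> set cs" for es
      using that
    proof (induction es)
      case (Cons cH es)
      obtain c H where "cH = (c, H)" by force
      then show ?case using Cons f[of c H] by (auto simp: prunes_def intro: add_mono trans_le_add2)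
    qed simp
    then show ?thesis unfolding ds_def by simp
  qed
  moreover have "generic_depth (Plus_Gate ds) \<le> generic_depth (Plus_Gate cs)"
    using child(2) unfolding generic_depth.simps(3)[of ds]
    by (simp add: Suc_le_eq) (auto simp: less_Suc_eq_le)
  moreover have "generic_degree (Plus_Gate ds) \<le> generic_degree (Plus_Gate cs)"
    unfolding generic_degree.simps(3)[of ds] Max_insert_0_le_iff using child(3)
    by (auto simp del: generic_degree.simps)
  moreover have "pmonos (Plus_Gate ds) \<subseteq> pmonos (Plus_Gate cs)" using child(4) by auto
  moreover have "h \<longrightarrow> (\<exists>k. \<forall>m \<in> pmonos (Plus_Gate ds). mdeg M m = k)" using child(6) by auto
  moreover have "alg_formula K n (Plus_Gate ds)" using child(1,5) \<open>ds \<noteq> []\<close> by auto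
  ultimately have "prunes n h (Plus_Gate cs) (Plus_Gate ds)" unfolding prunes_def using eq by blast
  then show ?case ..
next
  case (Times_Gate cs)
  have hom: "homogeneous_formula K M H" if "h" "(c, H) \<in> set cs" for c H
    using Times_Gate.prems(3) that unfolding homogeneous_formula_def by fastforce
  have wf: "c \<in> carrier K" "generic_formula K n H" "poly H \<in> coeffs" if "(c, H) \<in> set cs" for c H
    using Times_Gate.prems(1) that poly_coeffs by fastforce+
  have nz: "\<forall>(c, H) \<in> set cs. c \<noteq> \<zero> \<and> (\<exists>m. poly H m \<noteq> \<zero>)"
    using factors_nonzero[OF _ Times_Gate.prems(2)] wf by blast
  have ex: "\<exists>H'. prunes n h H H'" if "(c, H) \<in> set cs" for c H
    using Times_Gate.IH[OF that, of H] wf[OF that] hom[OF _ that] nz that by fastforce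
  define f where "f H = (SOME H'. prunes n h H H')" for H
  have f: "prunes n h H (f H)" if "(c, H) \<in> set cs" for c H
    unfolding f_def using ex[OF that] by (rule someI_ex)
  define ds where "ds = map (\<lambda>(c, H). (c, f H)) cs"
  have list: "poly (Times_Gate ds) = poly (Times_Gate cs)" "formula_size (Times_Gate ds) \<le> formula_size (Times_Gate cs)"
     "generic_degree (Times_Gate ds) \<le> generic_degree (Times_Gate cs)" "pmonos (Times_Gate ds) \<subseteq> pmonos (Times_Gate cs)"
     "h \<Longrightarrow> \<exists>k. \<forall>m \<in> pmonos (Times_Gate ds). mdeg M m = k"
  proof -
    have "\<forall>(c, H) \<in> set cs. prunes n h H (f H)" using f by blast
    then have "poly (Times_Gate ds) = poly (Times_Gate cs) \<and> formula_size (Times_Gate ds) \<le> formula_size (Times_Gate cs) \<and>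
     generic_degree (Times_Gate ds) \<le> generic_degree (Times_Gate cs) \<and> pmonos (Times_Gate ds) \<subseteq> pmonos (Times_Gate cs) \<and>
     (h \<longrightarrow> (\<exists>k. \<forall>m \<in> pmonos (Times_Gate ds). mdeg M m = k))"
      unfolding ds_def
    proof (induction cs)
      case (Cons cH cs)
      obtain c H where cH: "cH = (c, H)" by force
      have p: "prunes n h H (f H)" using Cons.prems cH by simp
      let ?ds = "map (\<lambda>(c, H). (c, f H)) cs"
      have IH: "poly (Times_Gate ?ds) = poly (Times_Gate cs)" "formula_size (Times_Gate ?ds) \<le> formula_size (Times_Gate cs)"
       "generic_degree (Times_Gate ?ds) \<le> generic_degree (Times_Gate cs)" "pmonos (Times_Gate ?ds) \<subseteq> pmonos (Times_Gate cs)"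
       "h \<longrightarrow> (\<exists>k. \<forall>m \<in> pmonos (Times_Gate ?ds). mdeg M m = k)"
        using Cons by auto
      have "h \<longrightarrow> (\<exists>k. \<forall>m \<in> pmonos (Times_Gate ((c, f H) # ?ds)). mdeg M m = k)"
      proof
        assume h
        then obtain k l where "\<forall>m \<in> pmonos (f H). mdeg M m = k" "\<forall>m \<in> pmonos (Times_Gate ?ds). mdeg M m = l"
          using p IH(5) unfolding prunes_def by blast
        then show "\<exists>k. \<forall>m \<in> pmonos (Times_Gate ((c, f H) # ?ds)). mdeg M m = k"
          by (intro exI[of _ "k + l"]) (auto simp: monomial_prod_def mdeg_mult)
      qed
      moreover have "pmonos (Times_Gate ((c, f H) # ?ds)) \<subseteq> pmonos (Times_Gate ((c, H) # cs))"
        using p IH(4) monomial_prod_laws(8) by (simp add: prunes_def)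
      ultimately show ?case using IH(1-3) p cH by (simp add: prunes_def add_mono)
    qed simp
    then show "poly (Times_Gate ds) = poly (Times_Gate cs)" "formula_size (Times_Gate ds) \<le> formula_size (Times_Gate cs)"
     "generic_degree (Times_Gate ds) \<le> generic_degree (Times_Gate cs)" "pmonos (Times_Gate ds) \<subseteq> pmonos (Times_Gate cs)"
     "h \<Longrightarrow> \<exists>k. \<forall>m \<in> pmonos (Times_Gate ds). mdeg M m = k" by blast+
  qed
  have "generic_depth (f H) < generic_depth (Times_Gate cs)" if "(c, H) \<in> set cs" for c H
  proof -
    have "generic_depth H < generic_depth (Times_Gate cs)"
      using that by (auto intro!: Max_ge simp: less_Suc_eq_le)
    then show ?thesis using f[OF that] unfolding prunes_def by (meson le_less_trans)
  qed
  then have "generic_depth (Times_Gate ds) \<le> generic_depth (Times_Gate cs)"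
    unfolding generic_depth.simps(4)[of ds] ds_def
    by (simp add: Suc_le_eq) (auto simp: less_Suc_eq_le)
  moreover have "alg_formula K n (Times_Gate ds)"
    using Times_Gate.prems(1) f wf nz unfolding ds_def prunes_def by fastforce
  ultimately have "prunes n h (Times_Gate cs) (Times_Gate ds)" unfolding prunes_def using list by blast
  then show ?case ..
qed

end

section \<open>Choice of the size and degree classes\<close>

text \<open>For \<open>2 \<le> b\<close>, the position of the leading digit of \<open>x\<close> in
  base \<open>b\<close>, with value 0 at \<open>x = 0\<close>; \<open>lead\<close> is that
  digit.\<close>

fun ilog :: "nat \<Rightarrow> nat \<Rightarrow> nat" where
  "ilog b x = (if b < 2 \<or> x < b then 0 else Suc (ilog b (x div b)))"

fun lead :: "nat \<Rightarrow> nat \<Rightarrow> nat" where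
  "lead b x = (if b < 2 \<or> x < b then x else lead b (x div b))"

declare ilog.simps [simp del] lead.simps [simp del]

text \<open>The lexicographic order on pairs of \<open>ilog\<close> and \<open>lead\<close>, encoded
  as a number; this is faithful because \<open>lead b x < b\<close>.\<close>

definition rank_of :: "nat \<Rightarrow> nat \<Rightarrow> nat" where "rank_of b x = b * ilog b x + lead b x"

context
  fixes b :: nat
  assumes b: "2 \<le> b"
begin

lemma ilog_lead_small: "x < b \<Longrightarrow> ilog b x = 0 \<and> lead b x = x"
  by (simp add: ilog.simps lead.simps)

lemma ilog_lead_big: "b \<le> x \<Longrightarrow> ilog b x = Suc (ilog b (x div b)) \<and> lead b x = lead b (x div b)"
  using b by (subst ilog.simps, subst lead.simps) simp

lemma div_less: "b \<le> x \<Longrightarrow> x div b < x"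
  using b by simp

lemma lead_less: "lead b x < b"
proof (induction x rule: less_induct)
  case (less x)
  then show ?case using ilog_lead_small ilog_lead_big div_less by (metis linorder_not_less)
qed

lemma lead_pos: "0 < x \<Longrightarrow> 0 < lead b x"
proof (induction x rule: less_induct)
  case (less x)
  show ?case
  proof (cases "x < b")
    case False
    then have "0 < x div b" using b by (simp add: div_greater_zero_iff)
    then show ?thesis using less.IH[OF div_less] ilog_lead_big False by simp
  qed (use less ilog_lead_small in simp)
qed

lemma ilog_lead_bounds: "b ^ ilog b x * lead b x \<le> x \<and> x < b ^ ilog b x * Suc (lead b x)"
proof (induction x rule: less_induct)
  case (less x)
  show ?case
  proof (cases "x < b")
    case False
    let ?y = "x div b"
    have IH: "b ^ ilog b ?y * lead b ?y \<le> ?y" "?y < b ^ ilog b ?y * Suc (lead b ?y)"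
      using less.IH[OF div_less] False by auto
    have "b * (b ^ ilog b ?y * lead b ?y) \<le> x"
      using mult_le_mono2[OF IH(1), of b] by (metis dual_order.trans times_div_less_eq_dividend)
    moreover have "x < b * (b ^ ilog b ?y * Suc (lead b ?y))"
      using IH(2) b by (metis div_less_iff_less_mult mult.commute not_numeral_le_zero zero_less_iff_neq_zero)
    ultimately show ?thesis using ilog_lead_big False by (simp add: algebra_simps)
  qed (use ilog_lead_small in simp)
qed

lemma ilog_power_le: "0 < x \<Longrightarrow> b ^ ilog b x \<le> x"
  using ilog_lead_bounds[of x] lead_pos[of x] by (metis dual_order.trans less_one linorder_not_less mult.right_neutral mult_le_mono2)

lemma ilog_lead_mono: "x \<le> y \<Longrightarrow> ilog b x < ilog b y \<or> ilog b x = ilog b y \<and> lead b x \<le> lead b y"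
proof (induction y arbitrary: x rule: less_induct)
  case (less y)
  consider "y < b" | "x < b" "b \<le> y" | "b \<le> x" "b \<le> y" using less.prems by linarith
  then show ?case
  proof cases
    case 1
    then show ?thesis using ilog_lead_small less.prems by simp
  next
    case 2
    then show ?thesis using ilog_lead_small ilog_lead_big by simp
  next
    case 3
    have "x div b \<le> y div b" using less.prems by (rule div_le_mono)
    then show ?thesis using less.IH[OF div_less[OF 3(2)]] ilog_lead_big 3 by auto
  qed
qed

lemma ilog_mono: "x \<le> y \<Longrightarrow> ilog b x \<le> ilog b y"
  using ilog_lead_mono by fastforce

lemma rank_of_less: "ilog b x < ilog b y \<Longrightarrow> rank_of b x < rank_of b y"
proof -
  assume "ilog b x < ilog b y"
  then have "b * Suc (ilog b x) \<le> b * ilog b y" by (intro mult_le_mono2) simp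
  then show ?thesis unfolding rank_of_def using lead_less[of x] by simp
qed

lemma rank_of_mono: "x \<le> y \<Longrightarrow> rank_of b x \<le> rank_of b y"
  using ilog_lead_mono[of x y] rank_of_less[of x y] unfolding rank_of_def by auto

lemma rank_of_eq_iff: "rank_of b x = rank_of b y \<longleftrightarrow> ilog b x = ilog b y \<and> lead b x = lead b y"
  using rank_of_less[of x y] rank_of_less[of y x] unfolding rank_of_def by (metis add_left_cancel linorder_neq_iff)

lemma rank_of_0_iff: "rank_of b x = 0 \<longleftrightarrow> x = 0"
  using lead_pos[of x] ilog_lead_small[of 0] b unfolding rank_of_def by (cases "x = 0") auto

text \<open>Two numbers with the same leading digit at the same position differ by less than one
  unit of that position.\<close>

lemma rank_of_drop:
  assumes "0 < t" "t < s" "rank_of b t = rank_of b s"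
  shows "rank_of b (s - t) < rank_of b s \<and> ilog b (s - t) < ilog b s"
proof -
  have eq: "ilog b t = ilog b s" "lead b t = lead b s" using assms(3) rank_of_eq_iff by auto
  have "s - t < b ^ ilog b s"
    using ilog_lead_bounds[of s] ilog_lead_bounds[of t] eq assms(2) by simp
  moreover have "b ^ ilog b (s - t) \<le> s - t" using assms(2) by (intro ilog_power_le) simp
  ultimately have "b ^ ilog b (s - t) < b ^ ilog b s" by simp
  then have "ilog b (s - t) < ilog b s" using b by (meson power_less_imp_less_exp less_le_trans one_less_numeral_iff semiring_norm(76))
  then show ?thesis using rank_of_less by blast
qed

lemma rank_of_le: "rank_of b x \<le> b * Suc (ilog b x)"
  unfolding rank_of_def using lead_less[of x] by simp

end

section \<open>The two class systems and the estimates for them\<close>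

lemma ilog_log_le:
  assumes "0 < x" "0 < a"
  shows "real a * real (ilog (2 ^ a) x) \<le> log 2 (real x)"
proof -
  have "(2::nat) \<le> 2 ^ a" using assms(2) by (metis power_increasing power_one_right Suc_leI One_nat_def one_le_numeral)
  then have "(2 ^ a) ^ ilog (2 ^ a) x \<le> x" by (intro ilog_power_le assms)
  then have "real ((2 ^ a) ^ ilog (2 ^ a) x) \<le> real x" by (simp only: of_nat_le_iff)
  then have "2 powr (real a * real (ilog (2 ^ a) x)) \<le> real x"
    by (simp add: power_mult[symmetric] powr_realpow[symmetric] powr_powr)
  then show ?thesis using assms(1) by (simp add: le_log_iff)
qed

text \<open>With the fine class as rank, no child of the path's end has the rank of
  \<open>u\<close>. The two summands are \<open>B\<close> and the product containing
  \<open>v\<close>.\<close>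

lemma class_system_dense:
  assumes "2 \<le> k"
  shows "class_system (rank_of k) (rank_of k) (\<lambda>_. 2) (ilog k) (rank_of k) (ilog k) 2 4"
proof
  fix s :: nat and ws
  assume "\<And>w. w \<in> set ws \<Longrightarrow> 0 < w \<and> rank_of k w = rank_of k s \<and> rank_of k w \<noteq> rank_of k s"
  then have "ws = []" by (cases ws) auto
  then show "2 + sum_list (map (\<lambda>_. 2) ws) \<le> (2::nat)" by simp
qed (use assms rank_of_mono rank_of_0_iff ilog_mono rank_of_drop in auto)

text \<open>The rank ignores the leading digit, so the depth does not grow with \<open>n\<close>;
  the digit governs the number of summands instead. Sizes with the same \<open>ilog\<close> whose
  sum is at most \<open>s\<close> have leading digits with sum at most
  \<open>lead n s\<close>.\<close>

lemma class_system_sparse: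
  assumes k: "2 \<le> k" and n: "2 \<le> n"
  shows "class_system (rank_of n) (ilog n) (\<lambda>s. 4 * lead n s - 2) (ilog n) (rank_of k) (ilog k) (4 * n) (8 * n)"
proof
  fix s :: nat and ws
  assume s: "0 < s" and ws: "\<And>w. w \<in> set ws \<Longrightarrow> 0 < w \<and> ilog n w = ilog n s \<and> rank_of n w \<noteq> rank_of n s"
    and sum: "sum_list ws \<le> s"
  have pos: "0 < lead n w" if "w \<in> set ws" for w using ws[OF that] lead_pos[OF n] by simp
  have "n ^ ilog n s * sum_list (map (lead n) us) \<le> sum_list us" if "set us \<subseteq> set ws" for us
    using that
  proof (induction us)
    case (Cons u us)
    have "n ^ ilog n s * lead n u \<le> u" using ws[of u] ilog_lead_bounds[OF n, of u] Cons.prems by simp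
    then show ?case using Cons by (simp add: distrib_left)
  qed simp
  then have "n ^ ilog n s * sum_list (map (lead n) ws) \<le> s" using sum by (meson order_refl order_trans)
  then have "n ^ ilog n s * sum_list (map (lead n) ws) < n ^ ilog n s * Suc (lead n s)"
    using ilog_lead_bounds[OF n, of s] by simp
  then have lead: "sum_list (map (lead n) ws) \<le> lead n s" unfolding mult_less_cancel1 by simp
  have "sum_list (map (\<lambda>s. 4 * lead n s - 2) us) + 2 * length us = 4 * sum_list (map (lead n) us)"
    if "set us \<subseteq> set ws" for us
    using that
  proof (induction us)
    case (Cons u us)
    then show ?case using pos[of u] by simp
  qed simp
  then have terms: "sum_list (map (\<lambda>s. 4 * lead n s - 2) ws) + 2 * length ws = 4 * sum_list (map (lead n) ws)" by simp
  have ls: "0 < lead n s" using lead_pos[OF n s] .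
  \<comment> \<open>For \<open>a * lead - c\<close> in place of \<open>4 * lead - 2\<close>, the
    case of two parts requires \<open>c \<ge> 2\<close>, and the case of no part with leading digit
    1 then requires \<open>a \<ge> 4\<close>. A single part has a smaller leading digit, since its
    \<open>rank_of\<close> differs.\<close>
  consider "ws = []" | w where "ws = [w]" | "2 \<le> length ws"
    by (metis One_nat_def Suc_1 length_0_conv length_Suc_conv less_2_cases linorder_not_less)
  then show "2 + sum_list (map (\<lambda>s. 4 * lead n s - 2) ws) \<le> 4 * lead n s - 2"
  proof cases
    case 1
    then show ?thesis using ls by simp
  next
    case 2
    then have "lead n w \<noteq> lead n s" using ws[of w] rank_of_eq_iff[OF n] by auto
    then show ?thesis using 2 lead pos[of w] by simp
  next
    case 3
    then show ?thesis using terms lead by linarith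
  qed
next
  show "4 * lead n s - 2 \<le> 4 * n" for s using lead_less[OF n, of s] by simp
qed (use k n rank_of_mono[OF k] rank_of_0_iff[OF k] ilog_mono rank_of_drop[OF n] rank_of_drop[OF k] ilog_lead_small[OF n, of 0] in auto)

lemma rank_of_log_le:
  assumes "0 < x" "0 < a"
  shows "real (rank_of (2 ^ a) x) \<le> 2 ^ a * (log 2 (real x) + 1)"
proof -
  have "(2::nat) \<le> 2 ^ a" using assms(2) by (metis power_increasing power_one_right Suc_leI One_nat_def one_le_numeral)
  then have "rank_of (2 ^ a) x \<le> 2 ^ a * Suc (ilog (2 ^ a) x)" by (rule rank_of_le)
  then have "real (rank_of (2 ^ a) x) \<le> real (2 ^ a * Suc (ilog (2 ^ a) x))" by (simp only: of_nat_le_iff)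
  also have "\<dots> = 2 ^ a * (real (ilog (2 ^ a) x) + 1)" by (simp add: algebra_simps)
  also have "real (ilog (2 ^ a) x) \<le> real a * real (ilog (2 ^ a) x)"
    using assms(2) by (simp add: mult_le_cancel_right1)
  also have "\<dots> \<le> log 2 (real x)" by (rule ilog_log_le[OF assms])
  finally show ?thesis by simp
qed

text \<open>Applied with \<open>u = expo s\<close>, \<open>v = dexpo d\<close> and
  \<open>2 ^ w\<close> as the factor \<open>M\<close>.\<close>

lemma powr_size_bound:
  fixes \<epsilon> :: real
  assumes "0 < s" "real u + real w * real v \<le> \<epsilon> * log 2 (real s)"
  shows "real (s * (2 ^ u * (2 ^ w) ^ v)) \<le> real s powr (1 + \<epsilon>)"
proof -
  have "real (2 ^ u * (2 ^ w) ^ v) = 2 powr (real u + real w * real v)"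
    by (simp add: powr_add powr_realpow[symmetric] powr_powr power_mult[symmetric])
  also have "\<dots> \<le> 2 powr (\<epsilon> * log 2 (real s))" using assms(2) by simp
  also have "\<dots> = real s powr \<epsilon>" using assms(1) by (simp add: powr_powr[symmetric] mult.commute[of \<epsilon>])
  finally have "real s * real (2 ^ u * (2 ^ w) ^ v) \<le> real s * real s powr \<epsilon>"
    by (rule mult_left_mono) simp
  then show ?thesis using assms(1) by (simp add: powr_add)
qed

text \<open>Rounding the exponent up adds less than 1, hence less than one further
  \<open>x\<close>.\<close>

lemma power_ceiling_bound:
  fixes x :: real
  assumes "1 \<le> x" "0 < c" "real c * x = y"
  shows "y \<le> real (nat \<lceil>y\<rceil>)" "(2::real) ^ nat \<lceil>y\<rceil> \<le> 2 powr ((real c + 1) * x)" "0 < nat \<lceil>y\<rceil>"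
proof -
  have y: "0 < y" using assms by auto
  show "y \<le> real (nat \<lceil>y\<rceil>)" by (rule real_nat_ceiling_ge)
  show "0 < nat \<lceil>y\<rceil>" using y by simp
  have "real (nat \<lceil>y\<rceil>) \<le> y + 1" using y by linarith
  also have "\<dots> \<le> (real c + 1) * x" using assms by (simp add: distrib_right)
  finally have "2 powr real (nat \<lceil>y\<rceil>) \<le> (2::real) powr ((real c + 1) * x)" by simp
  then show "(2::real) ^ nat \<lceil>y\<rceil> \<le> 2 powr ((real c + 1) * x)" by (simp add: powr_realpow)
qed

lemma le_two_powr: "(x::real) \<le> 2 powr x"
proof (cases "0 \<le> x")
  case True
  have "x \<le> real (nat \<lfloor>x\<rfloor>) + 1" by linarith
  also have "real (nat \<lfloor>x\<rfloor>) + 1 \<le> 2 ^ nat \<lfloor>x\<rfloor>"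
    using less_exp[of "nat \<lfloor>x\<rfloor>"] by (metis Suc_leI of_nat_Suc of_nat_le_iff of_nat_numeral of_nat_power add.commute)
  also have "(2::real) ^ nat \<lfloor>x\<rfloor> = 2 powr real (nat \<lfloor>x\<rfloor>)" by (simp add: powr_realpow)
  also have "\<dots> \<le> 2 powr x" using True by simp
  finally show ?thesis .
next
  case False
  then show ?thesis by (smt (verit) powr_gt_zero)
qed

text \<open>The two cases lead to the exponents \<open>9 * x\<close> and \<open>21 * x\<close>; 25
  is a common round bound.\<close>

lemma class_system_exists:
  fixes \<epsilon> :: real
  assumes "0 < \<epsilon>" "\<epsilon> \<le> 1" "0 < d" "d \<le> s"
  shows "\<exists>q rank terms expo drank dexpo R M. class_system q rank terms expo drank dexpo R M \<and>
     real (s * (2 ^ expo s * M ^ dexpo d)) \<le> real s powr (1 + \<epsilon>) \<and>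
     real (3 * (rank s + drank d) + 3) \<le> 2 powr (25 * (1 / \<epsilon>)) * max 1 (log 2 (real d))"
proof -
  define x where "x = 1 / \<epsilon>"
  have x: "1 \<le> x" "\<epsilon> * x = 1" using assms(1,2) by (auto simp: x_def)
  define y where "y = max 1 (log 2 (real d))"
  have y: "1 \<le> y" "log 2 (real d) \<le> y" by (auto simp: y_def)
  have s: "0 < s" using assms by simp
  have ld: "0 \<le> log 2 (real d)" and lds: "log 2 (real d) \<le> log 2 (real s)" using assms by auto
  then have ls: "0 \<le> log 2 (real s)" by simp
  have two: "(2::nat) \<le> 2 ^ a" if "0 < a" for a
    using that by (metis power_increasing power_one_right Suc_leI One_nat_def one_le_numeral)
  show ?thesis
  proof (cases "log 2 (real s) \<le> log 2 (real d) * x")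
    case True
    \<comment> \<open>Since \<open>M = 2 ^ 2\<close>, the exponent to be paid is at most
      \<open>(log 2 s + 2 * log 2 d) / a \<le> 3 * log 2 s / a\<close>, hence the 3.\<close>
    define a where "a = nat \<lceil>3 * x\<rceil>"
    have a: "3 * x \<le> real a" "2 ^ a \<le> 2 powr (4 * x)" "0 < a"
      using power_ceiling_bound[OF x(1), of 3 "3 * x"] x(1) by (simp_all add: a_def)
    let ?k = "2 ^ a :: nat"
    have "real a * (real (ilog ?k s) + 2 * real (ilog ?k d)) \<le> log 2 (real s) + 2 * log 2 (real d)"
      using ilog_log_le[OF s a(3)] ilog_log_le[OF assms(3) a(3)] by (simp add: distrib_left)
    also have "\<dots> \<le> 3 * log 2 (real s)" using lds by simp
    also have "\<dots> = (3 * x) * (\<epsilon> * log 2 (real s))" using x(2) by (simp add: mult.assoc mult.left_commute)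
    also have "\<dots> \<le> real a * (\<epsilon> * log 2 (real s))" using a(1) ls assms(1) by (intro mult_right_mono) auto
    finally have "real (ilog ?k s) + 2 * real (ilog ?k d) \<le> \<epsilon> * log 2 (real s)" using a(3) by simp
    then have 1: "real (s * (2 ^ ilog ?k s * (2 ^ 2) ^ ilog ?k d)) \<le> real s powr (1 + \<epsilon>)"
      by (intro powr_size_bound s) simp
    have lsy: "log 2 (real s) \<le> x * y" using True y x(1)
      by (smt (verit, best) mult.commute mult_left_mono)
    have yx: "y \<le> x * y" using x(1) y(1) by (simp add: mult_le_cancel_right1)
    have k1: "1 \<le> (2::real) ^ a" by simp
    have "real (rank_of ?k s) + real (rank_of ?k d) \<le> 2 ^ a * (log 2 (real s) + 1) + 2 ^ a * (log 2 (real d) + 1)"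
      by (intro add_mono rank_of_log_le s assms a(3))
    also have "\<dots> = 2 ^ a * (log 2 (real s) + log 2 (real d) + 2)" by (simp add: algebra_simps)
    also have "\<dots> \<le> 2 ^ a * (4 * (x * y))" 
    proof (rule mult_left_mono)
      show "log 2 (real s) + log 2 (real d) + 2 \<le> 4 * (x * y)" using lsy yx y by linarith
    qed simp
    finally have "3 * (real (rank_of ?k s) + real (rank_of ?k d)) + 3 \<le> 12 * (2 ^ a * (x * y)) + 3" by simp
    also have "1 \<le> 2 ^ a * (x * y)" using k1 yx y(1) by (metis mult_mono mult_1 order_trans zero_le_one)
    then have "12 * (2 ^ a * (x * y)) + 3 \<le> 16 * (2 ^ a * (x * y))" by linarith
    also have "\<dots> \<le> 2 powr (4 * x) * (2 powr (4 * x) * (2 powr x * y))"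
    proof -
      have "(16::real) = 2 powr 4" by simp
      also have "\<dots> \<le> 2 powr (4 * x)" using x(1) by (intro powr_mono) auto
      finally show ?thesis using a(2) le_two_powr[of x] y x by (intro mult_mono) auto
    qed
    also have "\<dots> = 2 powr (9 * x) * y" by (simp add: powr_add[symmetric] mult.assoc[symmetric])
    also have "\<dots> \<le> 2 powr (25 * x) * y" using x(1) y(1) by (intro mult_right_mono) auto
    finally have "real (3 * (rank_of ?k s + rank_of ?k d) + 3) \<le> 2 powr (25 * x) * y" by simp
    then show ?thesis using class_system_dense[OF two[OF a(3)]] 1 unfolding x_def y_def by fastforce
  next
    case False
    \<comment> \<open>The copies will cost an exponent of at most \<open>8 * log 2 s / a\<close>;
      the 16 makes this half of the allowed \<open>\<epsilon> * log 2 s\<close>.\<close>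
    define a where "a = nat \<lceil>16 * x\<rceil>"
    have a: "16 * x \<le> real a" "2 ^ a \<le> 2 powr (17 * x)" "0 < a"
      using power_ceiling_bound[OF x(1), of 16 "16 * x"] x(1) by (simp_all add: a_def)
    \<comment> \<open>\<open>2 * x\<close> limits the exponent \<open>ilog n s\<close> to the other
      half of the allowance, and \<open>log 2 s / y\<close> limits the depth \<open>ilog n s\<close>
      to \<open>y\<close>.\<close>
    define b where "b = nat \<lceil>max (2 * x) (log 2 (real s) / y)\<rceil>"
    have b: "2 * x \<le> real b" "log 2 (real s) / y \<le> real b"
      using real_nat_ceiling_ge[of "max (2 * x) (log 2 (real s) / y)"] unfolding b_def by auto
    have b0: "0 < b" using b(1) x(1) by (cases b) auto
    have nn: "0 \<le> log 2 (real s) / y" using ls y by simp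
    have b_le: "real b \<le> 2 * x + log 2 (real s) / y + 1"
      using nn x(1) unfolding b_def by linarith
    let ?k = "2 ^ a :: nat" and ?n = "2 ^ b :: nat"
    have small: "log 2 (real d) \<le> \<epsilon> * log 2 (real s)"
      using False x assms(1) by (simp add: x_def field_simps)
    have "real b * real (ilog ?n s) \<le> log 2 (real s)" by (rule ilog_log_le[OF s b0])
    then have dn: "real (ilog ?n s) \<le> log 2 (real s) / real b" using b0 by (simp add: field_simps)
    have "log 2 (real s) / real b \<le> log 2 (real s) / (2 * x)" using b(1) x(1) ls b0 by (intro divide_left_mono) auto
    also have "\<dots> = \<epsilon> / 2 * log 2 (real s)" by (simp add: x_def)
    finally have 1: "real (ilog ?n s) \<le> \<epsilon> / 2 * log 2 (real s)" using dn by linarith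
    \<comment> \<open>\<open>b + 3\<close> is the exponent of \<open>M = 8 * n\<close>. Its large
      part \<open>log 2 s / y\<close> is harmless because \<open>log 2 d \<le> y\<close>, the rest
      because \<open>d\<close> is small compared with \<open>s\<close>.\<close>
    have "(real b + 3) * log 2 (real d) \<le> (2 * x + log 2 (real s) / y + 4) * log 2 (real d)"
      using b_le ld by (intro mult_right_mono) auto
    also have "\<dots> = (2 * x + 4) * log 2 (real d) + log 2 (real s) * (log 2 (real d) / y)" by (simp add: algebra_simps)
    also have "\<dots> \<le> (2 * x + 4) * (\<epsilon> * log 2 (real s)) + log 2 (real s) * 1"
      using small y ls x(1) by (intro add_mono mult_left_mono) auto
    also have "\<dots> = (3 + 4 * \<epsilon>) * log 2 (real s)" using x(2) by (simp add: algebra_simps)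
    also have "\<dots> \<le> 8 * log 2 (real s)" using assms(2) ls by (intro mult_right_mono) auto
    finally have bd: "(real b + 3) * log 2 (real d) \<le> 8 * log 2 (real s)" .
    have "real a * ((real b + 3) * real (ilog ?k d)) = (real b + 3) * (real a * real (ilog ?k d))" by simp
    also have "\<dots> \<le> (real b + 3) * log 2 (real d)"
      using ilog_log_le[OF assms(3) a(3)] by (intro mult_left_mono) auto
    also have "\<dots> \<le> 8 * log 2 (real s)" by (rule bd)
    also have "\<dots> = (16 * x) * (\<epsilon> / 2 * log 2 (real s))" using x(2) by (simp add: mult.assoc mult.left_commute)
    also have "\<dots> \<le> real a * (\<epsilon> / 2 * log 2 (real s))" using a(1) ls assms(1) by (intro mult_right_mono) auto
    finally have "(real b + 3) * real (ilog ?k d) \<le> \<epsilon> / 2 * log 2 (real s)" using a(3) by simp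
    then have "real (ilog ?n s) + real (b + 3) * real (ilog ?k d) \<le> \<epsilon> * log 2 (real s)" using 1 by simp
    from powr_size_bound[OF s this]
    have 2: "real (s * (2 ^ ilog ?n s * (8 * ?n) ^ ilog ?k d)) \<le> real s powr (1 + \<epsilon>)"
      by (simp add: power_add mult.commute)
    have "log 2 (real s) / real b \<le> y" using b(2) b0 y(1) by (simp add: field_simps)
    then have ny: "real (ilog ?n s) \<le> y" using dn by simp
    have k1: "1 \<le> (2::real) ^ a" by simp
    then have ky: "y \<le> 2 ^ a * y" using y(1) by (simp add: mult_le_cancel_right1)
    have "real (rank_of ?k d) \<le> 2 ^ a * (log 2 (real d) + 1)" by (intro rank_of_log_le assms a(3))
    also have "\<dots> \<le> 2 ^ a * (2 * y)" using y by (intro mult_left_mono) auto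
    also have "\<dots> = 2 * (2 ^ a * y)" by simp
    finally have rank: "real (rank_of ?k d) \<le> 2 * (2 ^ a * y)" .
    have "3 * (real (ilog ?n s) + real (rank_of ?k d)) + 3 \<le> 16 * (2 ^ a * y)"
    proof -
      have "3 * (u + v) + 3 \<le> 16 * z" if "u \<le> y" "y \<le> z" "v \<le> 2 * z" for u v z
        using that y(1) by (simp add: algebra_simps)
      from this[OF ny ky rank] show ?thesis .
    qed
    also have "\<dots> \<le> 2 powr (4 * x) * (2 powr (17 * x) * y)"
    proof -
      have "(16::real) = 2 powr 4" by simp
      also have "\<dots> \<le> 2 powr (4 * x)" using x(1) by (intro powr_mono) auto
      finally show ?thesis using a(2) y by (intro mult_mono) auto
    qed
    also have "\<dots> = 2 powr (21 * x) * y" by (simp add: powr_add[symmetric] mult.assoc[symmetric])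
    also have "\<dots> \<le> 2 powr (25 * x) * y" using x(1) y(1) by (intro mult_right_mono) auto
    finally have "real (3 * (ilog ?n s + rank_of ?k d) + 3) \<le> 2 powr (25 * x) * y" by simp
    then show ?thesis using class_system_sparse[OF two[OF a(3)] two[OF b0]] 2 unfolding x_def y_def by blast
  qed
qed

section \<open>Depth reduction for polynomials\<close>

context monomial_algebra begin

lemma monotone_mono:
  assumes "alg_formula K n G" "alg_formula K n H" "poly H = poly G" "pmonos H \<subseteq> pmonos G" "monotone_formula K M G"
  shows "monotone_formula K M H"
  using assms(3-5) unfolding monotone_formula_iff[OF assms(1)] monotone_formula_iff[OF assms(2)] by auto

text \<open>Pruning is used twice: beforehand to give all parse trees of a homogeneous formula one
  degree, and afterwards to turn the generic result into a proper formula.\<close>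

theorem reduced_formula_exists:
  fixes \<epsilon> :: real
  assumes F: "alg_formula K n F" "1 \<le> synt_degree F" and \<epsilon>: "0 < \<epsilon>"
  shows "\<exists>F''. alg_formula K n F'' \<and> poly F'' = poly F \<and>
          real (formula_size F'') \<le> real (formula_size F) powr (1 + \<epsilon>) \<and>
          real (formula_depth F'') \<le> 2 powr (25 * max 1 (1 / \<epsilon>)) * max 1 (log 2 (real (synt_degree F))) \<and>
          (homogeneous_formula K M F \<longrightarrow> homogeneous_formula K M F'') \<and>
          (monotone_formula K M F \<longrightarrow> monotone_formula K M F'')"
proof (cases "\<exists>m. poly F m \<noteq> \<zero>")
  case False
  \<comment> \<open>Proper formulas have no empty sums, so zero is written as a difference.\<close>
  define Z where "Z = Plus_Gate [(\<one>, One_Leaf), (\<ominus> \<one>, One_Leaf)]"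
  have zero: "poly F = \<zero>\<^bsub>P\<^esub>" using False by (auto simp: zero_eq)
  have minus_one: "\<ominus> \<one> \<noteq> \<zero>" 
  proof
    assume "\<ominus> \<one> = \<zero>"
    then have "\<one> \<oplus> \<zero> = \<zero>" using r_neg[OF one_closed] by simp
    then show False by simp
  qed
  have alg: "alg_formula K n Z" using minus_one by (simp add: Z_def)
  have "poly Z = poly F"
    unfolding zero Z_def by (auto simp: fun_eq_iff add_eq scale_eq zero_eq one_eq r_neg)
  moreover have "real (formula_size Z) \<le> real (formula_size F) powr (1 + \<epsilon>)"
  proof -
    have "\<not> formula_size F \<le> 1"
    proof
      assume "formula_size F \<le> 1"
      then obtain c m where c: "c \<noteq> \<zero>" "poly F = monomial c m"
        using poly_size_one_nonzero[OF F(1)] by blast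
      have "poly F m = c" unfolding c(2) by (simp add: monomial_def)
      then show False using False c(1) by blast
    qed
    then have s: "2 \<le> real (formula_size F)" by simp
    have "real (formula_size Z) = 2" by (simp add: Z_def)
    also have "2 \<le> real (formula_size F) powr 1" using s by simp
    also have "\<dots> \<le> real (formula_size F) powr (1 + \<epsilon>)" using s \<epsilon> by (intro powr_mono) auto
    finally show ?thesis .
  qed
  moreover have "real (formula_depth Z) \<le> 2 powr (25 * max 1 (1 / \<epsilon>)) * max 1 (log 2 (real (synt_degree F)))"
  proof -
    have "1 * 1 \<le> 2 powr (25 * max 1 (1 / \<epsilon>)) * max 1 (log 2 (real (synt_degree F)))"
      by (intro mult_mono ge_one_powr_ge_zero) auto
    then show ?thesis by (simp add: Z_def)
  qed
  moreover have "homogeneous_formula K M Z"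
    by (rule homogeneous_if_single_degree[OF alg, of "mdeg M \<one>\<^bsub>M\<^esub>"]) (simp add: Z_def)
  \<comment> \<open>\<open>F\<close> has parse-tree monomials, and all of them cancel.\<close>
  moreover have "\<not> monotone_formula K M F"
    unfolding monotone_formula_iff[OF F(1)] using pmonos_nonempty[OF F(1)] False by blast
  ultimately show ?thesis using alg by blast
next
  case True
  then obtain m where m: "poly F m \<noteq> \<zero>" by blast
  obtain G where "prunes n (homogeneous_formula K M F) F G"
    using prune[OF generic_formula_of_alg[OF F(1)] m] by blast
  then have G: "alg_formula K n G" "poly G = poly F" "formula_size G \<le> formula_size F"
     "generic_degree G \<le> generic_degree F" "pmonos G \<subseteq> pmonos F"
     "homogeneous_formula K M F \<Longrightarrow> \<exists>k. \<forall>m \<in> pmonos G. mdeg M m = k"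
    unfolding prunes_def by blast+
  define s where "s = formula_size G"
  \<comment> \<open>Pruning can lower the degree to 0, while the choice of classes needs a positive
    degree.\<close>
  define d where "d = max 1 (generic_degree G)"
  \<comment> \<open>The choice of classes assumes an exponent of at most 1; replacing a larger
    \<open>\<epsilon>\<close> by 1 only strengthens the size bound.\<close>
  define \<delta> where "\<delta> = min \<epsilon> 1"
  have \<delta>: "0 < \<delta>" "\<delta> \<le> 1" "\<delta> \<le> \<epsilon>" using \<epsilon> by (auto simp: \<delta>_def)
  have \<delta>_inv: "1 / \<delta> = max 1 (1 / \<epsilon>)" using \<epsilon> by (auto simp: \<delta>_def min_def max_def field_simps)
  have s: "1 \<le> s" using alg_formula_size_pos[OF G(1)] by (simp add: s_def)
  have d: "0 < d" "d \<le> s" using generic_degree_le_size[of G] s by (auto simp: d_def s_def)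
  obtain q rank terms expo drank dexpo R N where cs: "class_system q rank terms expo drank dexpo R N"
    and size: "real (s * (2 ^ expo s * N ^ dexpo d)) \<le> real s powr (1 + \<delta>)"
    and depth: "real (3 * (rank s + drank d) + 3) \<le> 2 powr (25 * (1 / \<delta>)) * max 1 (log 2 (real d))"
    using class_system_exists[OF \<delta>(1,2) d] by blast
  interpret DR: depth_reduction "joint_ring K M" K "joint_scale K" "joint_var K M" joint_le n q rank terms expo drank dexpo R N
    by (intro depth_reduction.intro joint_scalar_semiring cs)
  obtain H where H: "generic_formula K n H" "joint_le (DR.ev H) (DR.ev G)"
    "formula_size H \<le> DR.cost (formula_size G) (generic_degree G)"
    "generic_depth H \<le> DR.level (formula_size G) (generic_degree G) + 2"
    using DR.depth_reduction[OF generic_formula_of_alg[OF G(1)]] by blast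
  have H': "poly H = poly G" "pmonos H \<subseteq> pmonos G"
    using H(2) unfolding joint_value joint_le_def by auto
  have "formula_size H \<le> s * (2 ^ expo s * N ^ dexpo d)"
    using H(3) DR.cost_le[of "formula_size G" s "generic_degree G" d] unfolding s_def d_def by simp
  moreover have "generic_depth H \<le> 3 * (rank s + drank d) + 2"
    using H(4) DR.level_mono[of "formula_size G" s "generic_degree G" d] unfolding s_def d_def DR.level_def by simp
  \<comment> \<open>Homogeneity needs no flag here: the monomials of \<open>F''\<close> are among
    those of \<open>G\<close>, which already have a single degree.\<close>
  moreover obtain F'' where "prunes n False H F''"
    using prune[OF H(1), of m False] m H' G(2) by auto
  ultimately have F'': "alg_formula K n F''" "poly F'' = poly F" "formula_size F'' \<le> s * (2 ^ expo s * N ^ dexpo d)"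
     "formula_depth F'' \<le> 3 * (rank s + drank d) + 2" "pmonos F'' \<subseteq> pmonos G"
    using H' G(2) generic_depth_of_alg[of K n F''] unfolding prunes_def by auto
  have "real (formula_size F'') \<le> real s powr (1 + \<delta>)" using F''(3) size by linarith
  also have "\<dots> \<le> real s powr (1 + \<epsilon>)" using s \<delta>(3) by (intro powr_mono) auto
  also have "\<dots> \<le> real (formula_size F) powr (1 + \<epsilon>)" using G(3) \<epsilon> by (intro powr_mono2) (auto simp: s_def)
  finally have 1: "real (formula_size F'') \<le> real (formula_size F) powr (1 + \<epsilon>)" .
  have "real (formula_depth F'') \<le> 2 powr (25 * (1 / \<delta>)) * max 1 (log 2 (real d))" using F''(4) depth by linarith
  also have "\<dots> \<le> 2 powr (25 * (1 / \<delta>)) * max 1 (log 2 (real (synt_degree F)))"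
  proof -
    have "d \<le> synt_degree F" using G(4) F(2) generic_degree_of_alg[OF F(1)] by (simp add: d_def)
    then have "log 2 (real d) \<le> log 2 (real (synt_degree F))" using d(1) by simp
    then show ?thesis by (intro mult_left_mono max.mono) auto
  qed
  finally have 2: "real (formula_depth F'') \<le> 2 powr (25 * max 1 (1 / \<epsilon>)) * max 1 (log 2 (real (synt_degree F)))"
    unfolding \<delta>_inv .
  have "homogeneous_formula K M F''" if "homogeneous_formula K M F"
    using G(6)[OF that] homogeneous_if_single_degree[OF F''(1)] F''(5) by blast
  moreover have "monotone_formula K M F''" if "monotone_formula K M F"
    using monotone_mono[OF F(1) F''(1,2) _ that] F''(5) G(5) by blast
  ultimately show ?thesis using F''(1,2) 1 2 by blast
qed

end

section \<open>Commutative and non-commutative monomials, and the theorem\<close>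

lemma comm_monomial_algebra:
  assumes "field K"
  shows "monomial_algebra K comm_monomials"
proof (intro monomial_algebra.intro monomial_algebra_axioms.intro assms)
  show "monoid comm_monomials" by (rule monoidI) (auto simp: comm_monomials_def)
  show "finite {w. fst w \<otimes>\<^bsub>comm_monomials\<^esub> snd w = m}" for m
  proof (rule finite_subset)
    let ?S = "\<Union>k \<le> size m. multisets_of_size (set_mset m) k"
    show "finite (?S \<times> ?S)" by (intro finite_cartesian_product finite_UN_I finite_multisets_of_size) auto
    show "{w. fst w \<otimes>\<^bsub>comm_monomials\<^esub> snd w = m} \<subseteq> ?S \<times> ?S" by (auto simp: comm_monomials_def multisets_of_size_def)
  qed
qed (auto simp: comm_monomials_def)

lemma noncomm_monomial_algebra:
  assumes "field K"
  shows "monomial_algebra K noncomm_monomials"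
proof (intro monomial_algebra.intro monomial_algebra_axioms.intro assms)
  show "monoid noncomm_monomials" by (rule monoidI) (auto simp: noncomm_monomials_def)
  show "finite {w. fst w \<otimes>\<^bsub>noncomm_monomials\<^esub> snd w = m}" for m
  proof (rule finite_subset)
    let ?f = "\<lambda>i. (take i m, drop i m)"
    show "finite (?f ` {..length m})" by simp
    show "{w. fst w \<otimes>\<^bsub>noncomm_monomials\<^esub> snd w = m} \<subseteq> ?f ` {..length m}"
    proof
      fix w assume "w \<in> {w. fst w \<otimes>\<^bsub>noncomm_monomials\<^esub> snd w = m}"
      then have "m = fst w @ snd w" by (auto simp: noncomm_monomials_def)
      then show "w \<in> ?f ` {..length m}" by (intro image_eqI[of _ _ "length (fst w)"]) auto
    qed
  qed
qed (auto simp: noncomm_monomials_def)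

theorem theorem3p6:
  "\<exists>C::real. C > 0 \<and>
    (\<forall>(\<epsilon>::real) (K::'a ring) (n::nat) (F::'a formula) (s::nat) (d::nat).
      \<epsilon> > 0 \<longrightarrow> field K \<longrightarrow> alg_formula K n F \<longrightarrow>
      formula_size F = s \<longrightarrow> synt_degree F = d \<longrightarrow> d \<ge> 1 \<longrightarrow>
      (\<forall>P. formula_poly K comm_monomials F = P \<longrightarrow>
        (\<exists>F''. alg_formula K n F'' \<and> formula_poly K comm_monomials F'' = P \<and>
          real (formula_size F'') \<le> real s powr (1 + \<epsilon>) \<and>
          real (formula_depth F'') \<le> 2 powr (C * max 1 (1 / \<epsilon>)) * max 1 (log 2 (real d)) \<and>
          (homogeneous_formula K comm_monomials F \<longrightarrow> homogeneous_formula K comm_monomials F'') \<and>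
          (monotone_formula K comm_monomials F \<longrightarrow> monotone_formula K comm_monomials F''))) \<and>
      (\<forall>P. formula_poly K noncomm_monomials F = P \<longrightarrow>
        (\<exists>F''. alg_formula K n F'' \<and> formula_poly K noncomm_monomials F'' = P \<and>
          real (formula_size F'') \<le> real s powr (1 + \<epsilon>) \<and>
          real (formula_depth F'') \<le> 2 powr (C * max 1 (1 / \<epsilon>)) * max 1 (log 2 (real d)) \<and>
          (homogeneous_formula K noncomm_monomials F \<longrightarrow> homogeneous_formula K noncomm_monomials F'') \<and>
          (monotone_formula K noncomm_monomials F \<longrightarrow> monotone_formula K noncomm_monomials F''))))"
proof (intro exI[of _ 25] conjI allI impI)
  show "(25::real) > 0" by simp
next
  fix \<epsilon> :: real and K :: "'a ring" and n :: nat and F :: "'a formula" and s d :: nat and P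
  assume "field K"
  then interpret monomial_algebra K comm_monomials by (rule comm_monomial_algebra)
  assume "\<epsilon> > 0" "alg_formula K n F" "formula_size F = s" "synt_degree F = d" "d \<ge> 1"
    "formula_poly K comm_monomials F = P"
  then show "\<exists>F''. alg_formula K n F'' \<and> formula_poly K comm_monomials F'' = P \<and>
          real (formula_size F'') \<le> real s powr (1 + \<epsilon>) \<and>
          real (formula_depth F'') \<le> 2 powr (25 * max 1 (1 / \<epsilon>)) * max 1 (log 2 (real d)) \<and>
          (homogeneous_formula K comm_monomials F \<longrightarrow> homogeneous_formula K comm_monomials F'') \<and>
          (monotone_formula K comm_monomials F \<longrightarrow> monotone_formula K comm_monomials F'')"
    using reduced_formula_exists[of n F \<epsilon>] by blast
next
  fix \<epsilon> :: real and K :: "'a ring" and n :: nat and F :: "'a formula" and s d :: nat and P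
  assume "field K"
  then interpret monomial_algebra K noncomm_monomials by (rule noncomm_monomial_algebra)
  assume "\<epsilon> > 0" "alg_formula K n F" "formula_size F = s" "synt_degree F = d" "d \<ge> 1"
    "formula_poly K noncomm_monomials F = P"
  then show "\<exists>F''. alg_formula K n F'' \<and> formula_poly K noncomm_monomials F'' = P \<and>
          real (formula_size F'') \<le> real s powr (1 + \<epsilon>) \<and>
          real (formula_depth F'') \<le> 2 powr (25 * max 1 (1 / \<epsilon>)) * max 1 (log 2 (real d)) \<and>
          (homogeneous_formula K noncomm_monomials F \<longrightarrow> homogeneous_formula K noncomm_monomials F'') \<and>
          (monotone_formula K noncomm_monomials F \<longrightarrow> monotone_formula K noncomm_monomials F'')"
    using reduced_formula_exists[of n F \<epsilon>] by blast
qed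

end
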